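(* Let $k,t,m$ be general complex numbers with $\operatorname{Re}(m)\geq 0$. Then $$\Phi\left(e^{-2 i m \pi},-k,1-\frac{t}{2\pi}\right)= i(-1)^k e^{-\frac{1}{2} i\left(3k\pi+2m(-2\pi+t)\right)}(2\pi)^{-1-k}\,\Gamma(1+k)\left(-\Phi\left(e^{-it},1+k,m\right)+(-1)^k e^{it}\,\Phi\left(e^{it},1+k,1-m\right)\right).$$
   Context: $\Phi(z,s,a)$ denotes the Hurwitz-Lerch zeta function (Lerch transcendent), defined by $\Phi(z,s,a)=\sum_{n=0}^{\infty}\frac{z^n}{(a+n)^s}$ where this series converges, and by analytic continuation elsewhere. $\Gamma$ is the Euler gamma function. Complex powers are principal values; in particular $(-1)^k=e^{i\pi k}$.
   Formalization: The printed formula fails (e.g. k=0, m=1/2, t=-π). Proved for 0<Re t<2π, or Re t=0≤Im t, or Re t=2π with Im t<0, and with Re m<1 or Im m≤0 or k a natural number; integer m, poles of Γ(1+k) and k=t=0 are excluded; on the cut (1,∞) Φ is the limit from below. *)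

theory Defs
  imports "HOL-Complex_Analysis.Complex_Analysis"
begin

text \<open>
  The Hurwitz-Lerch zeta function, with principal powers. All definitions are meant for
  parameters \<open>a\<close> other than \<open>0, -1, -2, ...\<close>, as some term of the series has a zero base otherwise.
\<close>

definition lerch_series :: "complex \<Rightarrow> complex \<Rightarrow> complex \<Rightarrow> complex" where
  "lerch_series z s a = (\<Sum>n. z ^ n / (a + of_nat n) powr s)"

text \<open>
  Continuation in \<open>z\<close> from the unit disc to the plane slit along \<open>[1, \<infinity>)\<close>. The slit plane is
  connected, so all functions \<open>F\<close> as below agree there; their values on the slit are arbitrary.
\<close>

definition lerch_slit :: "complex \<Rightarrow> complex \<Rightarrow> complex \<Rightarrow> complex" where
  "lerch_slit s a = (SOME F. F holomorphic_on (- complex_of_real ` {1..}) \<and>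
     (\<forall>z. norm z < 1 \<longrightarrow> F z = lerch_series z s a))"

text \<open>
  At the branch point \<open>z = 1\<close> the continuation is in \<open>s\<close>, from the half-plane of absolute
  convergence; this is the Hurwitz zeta function, whose only pole is \<open>s = 1\<close>.
\<close>

definition lerch_at_1 :: "complex \<Rightarrow> complex \<Rightarrow> complex" where
  "lerch_at_1 a = (SOME F. F holomorphic_on (- {1}) \<and>
     (\<forall>s. Re s > 1 \<longrightarrow> F s = lerch_series 1 s a))"

text \<open>
  On the cut \<open>(1, \<infinity>)\<close> the value is the limit from the lower half-plane. This is the usual
  convention for polylogarithms, and the one given by the principal logarithm in
  \<open>z \<Phi>(z, 1, 1) = - Ln (1 - z)\<close>. At points of the unit circle other than \<open>1\<close> where the series
  converges only conditionally, its sum is the value of the continuation, by Abel's theorem.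
\<close>

definition lerch_phi :: "complex \<Rightarrow> complex \<Rightarrow> complex \<Rightarrow> complex" where
  "lerch_phi z s a =
     (if norm z < 1 \<or> norm z = 1 \<and> Re s > 1 then lerch_series z s a
      else if z = 1 then lerch_at_1 a s
      else if z \<in> complex_of_real ` {1<..} then Lim (at z within {w. Im w < 0}) (lerch_slit s a)
      else lerch_slit s a z)"

end

theory Submission
  imports Defs
begin

text \<open>
  Put \<open>s = 1 + k\<close>, \<open>a = 1 - t / (2 \<pi>)\<close> and \<open>e(x) = exp (2 \<pi> \<i> x)\<close>. The claim is Lerch's
  transformation formula, which relates \<open>\<Phi>(e(-m), 1 - s, a)\<close> to \<open>\<Phi>(e(a), s, m)\<close> and
  \<open>\<Phi>(e(-a), s, 1 - m)\<close>. It is proved in the form \<open>lerch_equation\<close>, in which \<open>\<Gamma>(s)\<close> is moved to the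
  left as \<open>rGamma s\<close>, so that no poles occur while \<open>a\<close> and \<open>m\<close> are in the open strips.

  The heart of the matter is the case where \<open>Re s\<close>, \<open>Re a\<close> and \<open>Re m\<close> all lie strictly between 0 and 1.
  Up to a factor \<open>\<Gamma>(1 - s)\<close> the left side is then the Mellin transform of
  \<open>exp (- a x) / (1 - e(-m) exp (- x))\<close>, and this function has the partial fraction expansion with poles \<open>- 2 \<pi> \<i> (m + n)\<close> and residues
  \<open>e(a (m + n))\<close>. Applying the Mellin transform to each fraction gives the two series on the right.
  To avoid conditionally convergent sums, each half of the expansion is summed into an integral over
  the half-line (\<open>exp_over_one_minus_eq_lerch\<close>, which is the beta integral
  \<open>\<integral> u powr (\<mu> - 1) / (1 + c u) du\<close>), and the interchange of the two integrations
  is made legal by a factor \<open>exp (- \<epsilon> x)\<close> (\<open>oscillatory_fubini\<close>, \<open>oscillatory_limit\<close>).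

  Everything else is continuation. Integration by parts continues the Lerch integral to an entire
  function of \<open>s\<close> which is holomorphic in \<open>z\<close> off the slit and in \<open>a\<close> for \<open>Re a > 0\<close> (\<open>lerch_cont\<close>); the
  identity theorem then gives \<open>lerch_functional_eq\<close> for all \<open>s\<close>. The boundary cases are
  limits. When \<open>e(a)\<close> or \<open>e(-a)\<close> lies on the cut or at the branch point, the equation itself,
  known in the open strip, yields the existence of the boundary values there: the cut values directly
  (\<open>tendsto_cut_value_strip\<close>), the Hurwitz zeta function by solving a linear system
  (\<open>hurwitz_formula_eq_series\<close>). Both are obtained for \<open>Re m < 1\<close> only, and the duplication formula
  \<open>\<Phi>(z, s, a) = 2 powr (1 - s) * \<Phi>(z\<^sup>2, s, a / 2) - \<Phi>(-z, s, a)\<close> carries them across the line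
  \<open>Re m = 1\<close>. Finally the line \<open>Re m = 0\<close> is reached by continuity in \<open>m\<close>, and \<open>Re m \<ge> 1\<close> by the
  periodicity of the right side under \<open>m \<mapsto> m + 1\<close>. That periodicity amounts to
  \<open>(- m) powr s = exp (\<pi> \<i> s) * m powr s\<close>, which for principal powers and \<open>Re m > 0\<close> means that
  \<open>Im m \<le> 0\<close> or that \<open>s\<close> is an integer.
\<close>

section \<open>Integrals depending holomorphically on a parameter\<close>

text \<open>
  Difference quotients of a holomorphic function on a disc are bounded by its supremum, by
  Cauchy's inequality. A local integrable majorant of the integrand therefore also dominates its
  difference quotients, and dominated convergence differentiates under the integral sign.
\<close>

lemma holomorphic_on_integral_param:
  fixes f :: "complex \<Rightarrow> 'a \<Rightarrow> complex"
  assumes U: "open U"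
    and hol: "\<And>x. x \<in> space M \<Longrightarrow> (\<lambda>p. f p x) holomorphic_on U"
    and meas: "\<And>p. p \<in> U \<Longrightarrow> f p \<in> borel_measurable M"
    and dom: "\<And>p. p \<in> U \<Longrightarrow> \<exists>r>0. \<exists>B. integrable M B \<and>
       (\<forall>q. norm (q - p) \<le> r \<longrightarrow> q \<in> U \<and> (\<forall>x\<in>space M. norm (f q x) \<le> B x))"
  shows "(\<lambda>p. \<integral>x. f p x \<partial>M) holomorphic_on U"
proof -
  have "(\<lambda>p. \<integral>x. f p x \<partial>M) field_differentiable (at p)" if p: "p \<in> U" for p
  proof -
    obtain r B where r: "r > 0" and B: "integrable M B"
      and cU: "\<And>q. norm (q - p) \<le> r \<Longrightarrow> q \<in> U"
      and bnd: "\<And>q x. norm (q - p) \<le> r \<Longrightarrow> x \<in> space M \<Longrightarrow> norm (f q x) \<le> B x"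
      using dom[OF p] by blast
    have int: "integrable M (f q)" if "norm (q - p) \<le> r" for q
      by (rule Bochner_Integration.integrable_bound[OF B])
         (use that meas[OF cU] bnd in \<open>auto intro!: AE_I2 order.trans[OF bnd]\<close>)
    have lip: "norm (f (p + h) x - f p x) \<le> 2 * B x / r * norm h"
      if h: "norm h < r / 2" and x: "x \<in> space M" for h x
    proof -
      have hb: "(\<lambda>p. f p x) holomorphic_on U" by (rule hol[OF x])
      have d: "norm (deriv (\<lambda>p. f p x) q) \<le> 2 * B x / r" if q: "q \<in> ball p (r/2)" for q
      proof -
        have sub: "norm (y - p) \<le> r" if "y \<in> cball q (r/2)" for y
          using norm_triangle_ineq[of "y - q" "q - p"] q that
          by (auto simp: dist_norm norm_minus_commute)
        have sub': "cball q (r/2) \<subseteq> U" using sub cU by blast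
        have "norm ((deriv ^^ 1) (\<lambda>p. f p x) q) \<le> fact 1 * B x / (r/2) ^ 1"
        proof (rule Cauchy_inequality)
          show "(\<lambda>p. f p x) holomorphic_on ball q (r/2)"
            using hb sub' ball_subset_cball holomorphic_on_subset by blast
          show "continuous_on (cball q (r/2)) (\<lambda>p. f p x)"
            using hb sub' holomorphic_on_imp_continuous_on holomorphic_on_subset by blast
          show "norm (f y x) \<le> B x" if "norm (q - y) = r/2" for y
            by (rule bnd[OF sub x]) (use that in \<open>auto simp: dist_norm\<close>)
        qed (use r in auto)
        thus ?thesis by (simp add: field_simps)
      qed
      have "norm (f (p + h) x - f p x) \<le> 2 * B x / r * norm ((p + h) - p)"
      proof (rule field_differentiable_bound[where S = "ball p (r/2)" and f = "\<lambda>p. f p x"])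
        show "((\<lambda>p. f p x) has_field_derivative deriv (\<lambda>p. f p x) z) (at z within ball p (r / 2))"
          if "z \<in> ball p (r/2)" for z
        proof -
          have "z \<in> U" using cU[of z] that r by (auto simp: dist_norm norm_minus_commute)
          thus ?thesis using hb U holomorphic_derivI has_field_derivative_at_within by metis
        qed
      qed (use d h r in \<open>auto simp: dist_norm\<close>)
      thus ?thesis by simp
    qed
    define D where "D = (\<integral>x. deriv (\<lambda>p. f p x) p \<partial>M)"
    have "((\<lambda>h. ((\<integral>x. f (p + h) x \<partial>M) - (\<integral>x. f p x \<partial>M)) / h) \<longlongrightarrow> D) (at 0)"
      unfolding tendsto_at_iff_sequentially comp_def
    proof (intro allI impI)
      fix X :: "nat \<Rightarrow> complex"
      assume X: "\<forall>i. X i \<in> UNIV - {0}" and lim: "X \<longlonglongrightarrow> 0"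
      have "eventually (\<lambda>n. norm (X n) < r/2) sequentially"
        using lim r by (metis half_gt_zero_iff order_tendstoD(2) tendsto_norm_zero)
      then obtain N where N: "\<And>n. n \<ge> N \<Longrightarrow> norm (X n) < r/2"
        by (auto simp: eventually_sequentially)
      define Y where "Y n = X (n + N)" for n
      have Y: "norm (Y n) < r/2" "Y n \<noteq> 0" for n using N X by (auto simp: Y_def)
      have Yl: "norm ((p + Y n) - p) \<le> r" for n using Y(1)[of n] r by auto
      have Ylim: "Y \<longlonglongrightarrow> 0" unfolding Y_def using lim by (rule LIMSEQ_ignore_initial_segment)
      have ptw: "(\<lambda>n. (f (p + Y n) x - f p x) / Y n) \<longlonglongrightarrow> deriv (\<lambda>p. f p x) p"
        if x: "x \<in> space M" for x
      proof -
        have "((\<lambda>p. f p x) has_field_derivative deriv (\<lambda>p. f p x) p) (at p)"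
          using hol[OF x] U p holomorphic_derivI by blast
        hence "((\<lambda>h. (f (p + h) x - f p x) / h) \<longlongrightarrow> deriv (\<lambda>p. f p x) p) (at 0)"
          by (simp add: DERIV_def)
        thus ?thesis using Ylim Y(2)
          by (auto simp: tendsto_at_iff_sequentially comp_def)
      qed
      have "(\<lambda>n. \<integral>x. (f (p + Y n) x - f p x) / Y n \<partial>M) \<longlonglongrightarrow> D"
        unfolding D_def
      proof (rule integral_dominated_convergence[where w = "\<lambda>x. 2 * B x / r"])
        have m: "(\<lambda>x. (f (p + Y n) x - f p x) / Y n) \<in> borel_measurable M" for n
          using meas[OF cU[OF Yl]] meas[OF p] by measurable
        show "(\<lambda>x. (f (p + Y n) x - f p x) / Y n) \<in> borel_measurable M" for n by (rule m)
        show "(\<lambda>x. deriv (\<lambda>p. f p x) p) \<in> borel_measurable M"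
          by (rule borel_measurable_LIMSEQ_metric[OF m ptw])
        show "integrable M (\<lambda>x. 2 * B x / r)" using B by simp
        show "AE x in M. (\<lambda>n. (f (p + Y n) x - f p x) / Y n) \<longlonglongrightarrow> deriv (\<lambda>p. f p x) p"
          using ptw by simp
        show "AE x in M. norm ((f (p + Y n) x - f p x) / Y n) \<le> 2 * B x / r" for n
          using lip[OF Y(1)[of n]] Y(2)[of n] r by (auto simp: norm_divide field_simps intro!: AE_I2)
      qed
      moreover have "(\<integral>x. f (p + Y n) x - f p x \<partial>M)
          = (\<integral>x. f (p + Y n) x \<partial>M) - (\<integral>x. f p x \<partial>M)" for n
        using int[OF Yl] int[of p] r by simp
      ultimately have "(\<lambda>n. ((\<integral>x. f (p + Y n) x \<partial>M) - (\<integral>x. f p x \<partial>M)) / Y n) \<longlonglongrightarrow> D" by simp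
      thus "(\<lambda>n. ((\<integral>x. f (p + X n) x \<partial>M) - (\<integral>x. f p x \<partial>M)) / X n) \<longlonglongrightarrow> D"
        unfolding Y_def by (rule LIMSEQ_offset)
    qed
    thus ?thesis unfolding field_differentiable_def DERIV_def by blast
  qed
  thus ?thesis by (auto simp: holomorphic_on_def intro: field_differentiable_at_within)
qed

text \<open>
  The half-line is a measure space of its own, so that measurability on it is a consequence of
  continuity on the open half-line, and no indicator functions appear.
\<close>

definition hline :: "real measure" where "hline = restrict_space lborel {0<..}"

lemma space_hline [simp]: "space hline = {0<..}"
  by (simp add: hline_def space_restrict_space)

lemma sigma_finite_hline: "sigma_finite_measure hline"
  unfolding hline_def by (intro sigma_finite_measure_restrict_space) (auto intro: sigma_finite_lborel)

lemma integrable_hline: "integrable hline f \<longleftrightarrow> set_integrable lborel {0<..} (f :: real \<Rightarrow> 'a::{banach,second_countable_topology})"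
  unfolding hline_def set_integrable_def by (subst integrable_restrict_space) auto

lemma integral_hline: "integral\<^sup>L hline f = (LBINT x:{0<..}. (f x :: 'a::{banach,second_countable_topology}))"
  unfolding hline_def set_lebesgue_integral_def by (subst integral_restrict_space) auto

lemma measurable_hline:
  fixes f :: "real \<Rightarrow> 'a::topological_space"
  assumes "continuous_on {0<..} f" shows "f \<in> borel_measurable hline"
proof -
  have "sets hline = sets (restrict_space borel {0::real<..})"
    unfolding hline_def by (rule sets_restrict_space_cong) simp
  hence "borel_measurable hline = (borel_measurable (restrict_space borel {0::real<..}) :: (real \<Rightarrow> 'a) set)"
    by (rule measurable_cong_sets) simp
  thus ?thesis using borel_measurable_continuous_on_restrict[OF assms] by simp
qed

lemma Gamma_integral_hline:
  fixes s :: complex and c :: real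
  assumes s: "Re s > 0" and c: "c > 0"
  shows "integrable hline (\<lambda>x. complex_of_real x powr (s - 1) * exp (- of_real (c * x)))"
    and "(\<integral>x. complex_of_real x powr (s - 1) * exp (- of_real (c * x)) \<partial>hline) = Gamma s / of_real c powr s"
proof -
  have eq: "complex_of_real x powr (s - 1) * exp (- of_real (c * x)) = of_real x powr (s - 1) / of_real (exp (c * x))" for c x
    by (simp add: exp_minus exp_of_real field_simps flip: exp_of_real)
  have I: "integrable hline (\<lambda>x. complex_of_real x powr (s - 1) * exp (- of_real (c * x)))" if c: "c > 0" for c
    unfolding integrable_hline eq set_integrable_def
  proof (subst integrable_completion [symmetric])
    let ?F = "\<lambda>x. indicat_real {0<..} x *\<^sub>R (complex_of_real x powr (s - 1) / of_real (exp (c * x)))"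
    have "continuous_on {0<..} (\<lambda>x. complex_of_real x powr (s - 1) / of_real (exp (c * x)))"
      by (intro continuous_intros) auto
    hence "?F \<in> borel_measurable borel"
      by (intro borel_measurable_continuous_on_indicator) auto
    thus "?F \<in> borel_measurable lborel"
      by simp
    show "integrable lebesgue ?F"
      using absolutely_integrable_Gamma_integral[OF s c] by (simp add: set_integrable_def)
  qed
  show "integrable hline (\<lambda>x. complex_of_real x powr (s - 1) * exp (- of_real (c * x)))" by (rule I[OF c])
  show "(\<integral>x. complex_of_real x powr (s - 1) * exp (- of_real (c * x)) \<partial>hline) = Gamma s / of_real c powr s"
  proof -
    define f where "f c x = complex_of_real x powr (s - 1) * exp (- of_real (c * x))" for c x
    have "(\<integral>x. f 1 x \<partial>hline) = integral {0<..} (f 1)"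
      unfolding integral_hline using I[of 1] unfolding integrable_hline f_def
      by (rule set_borel_integral_eq_integral) auto
    also have "\<dots> = Gamma s"
      unfolding f_def eq using Gamma_integral_complex'[OF s] by (simp add: integral_unique)
    finally have G: "(\<integral>x. indicator {0<..} x *\<^sub>R f 1 x \<partial>lborel) = Gamma s"
      by (simp add: integral_hline set_lebesgue_integral_def del: mult_scaleR_right)
    have "Gamma s = \<bar>c\<bar> *\<^sub>R (\<integral>x. indicator {0<..} (0 + c * x) *\<^sub>R f 1 (0 + c * x) \<partial>lborel)"
      unfolding G[symmetric] using c by (intro lborel_integral_real_affine) auto
    also have "(\<integral>x. indicator {0<..} (0 + c * x) *\<^sub>R f 1 (0 + c * x) \<partial>lborel)
        = (\<integral>x. of_real c powr (s - 1) * (indicator {0<..} x *\<^sub>R f c x) \<partial>lborel)"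
      using c by (intro Bochner_Integration.integral_cong)
        (auto simp: f_def indicator_def zero_less_mult_iff powr_times_real)
    also have "\<dots> = of_real c powr (s - 1) * (\<integral>x. f c x \<partial>hline)"
      by (simp add: integral_hline set_lebesgue_integral_def del: mult_scaleR_right)
    finally have "Gamma s = of_real c * of_real c powr (s - 1) * (\<integral>x. f c x \<partial>hline)"
      using c by (simp add: scaleR_conv_of_real)
    also have "complex_of_real c * of_real c powr (s - 1) = of_real c powr s"
      using c by (simp add: powr_diff)
    finally show ?thesis using c by (simp add: f_def field_simps)
  qed
qed

section \<open>Lerch integrals on the slit plane\<close>

definition slit_plane :: "complex set" where
  "slit_plane = - complex_of_real ` {1..}"

lemma slit_plane_iff: "z \<in> slit_plane \<longleftrightarrow> Im z \<noteq> 0 \<or> Re z < 1"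
proof -
  have "z = complex_of_real (Re z)" if "Im z = 0" using that by (simp add: complex_eq_iff)
  hence "z \<in> complex_of_real ` {1..} \<longleftrightarrow> Im z = 0 \<and> Re z \<ge> 1"
    by (metis Im_complex_of_real Re_complex_of_real atLeast_iff image_iff)
  thus ?thesis by (auto simp: slit_plane_def)
qed

lemma slit_planeI: "Im z \<noteq> 0 \<or> Re z < 1 \<Longrightarrow> z \<in> slit_plane"
  by (simp add: slit_plane_iff)

lemma open_slit_plane: "open slit_plane"
proof -
  have "slit_plane = - ({z. Im z = 0} \<inter> {z. Re z \<ge> 1})"
    by (auto simp: slit_plane_iff)
  moreover have "closed {z. Im z = 0}" "closed {z. Re z \<ge> 1}"
    by (intro closed_Collect_eq closed_Collect_le continuous_intros)+
  ultimately show ?thesis by (metis closed_Int open_Compl)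
qed

lemma norm_less_1_slit: "norm z < 1 \<Longrightarrow> z \<in> slit_plane"
  using complex_Re_le_cmod[of z] by (intro slit_planeI) linarith

lemma slit_denominator_nz:
  assumes "z \<in> slit_plane" "0 \<le> y" "y \<le> 1"
  shows "1 - z * complex_of_real y \<noteq> 0"
proof
  assume "1 - z * complex_of_real y = 0"
  hence e: "z * of_real y = 1" by simp
  hence "y \<noteq> 0" by auto
  hence "z = of_real (1 / y)" using e by (simp add: field_simps)
  moreover have "1 / y \<ge> 1" using assms \<open>y \<noteq> 0\<close> by (simp add: field_simps)
  ultimately have "Im z = 0" "Re z \<ge> 1" by simp_all
  thus False using assms(1) slit_plane_iff[of z] by simp
qed

lemma exp_uminus_le_1: "0 < x \<Longrightarrow> exp (- complex_of_real x) = of_real (exp (-x)) \<and> 0 \<le> exp (-x) \<and> exp (-x) \<le> 1"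
  by (simp add: exp_of_real flip: of_real_minus)

text \<open>
  The denominators \<open>1 - z * exp (- x)\<close> stay away from zero, uniformly in \<open>x\<close> and locally uniformly in
  \<open>z\<close>: for \<open>y = exp (- x)\<close> in the compact interval \<open>[0, 1]\<close> they vanish only for \<open>z\<close> on the slit.
\<close>

lemma slit_denominator_bound:
  assumes "z0 \<in> slit_plane"
  obtains r \<delta> where "r > 0" "\<delta> > 0" "cball z0 r \<subseteq> slit_plane"
    "\<And>z x. norm (z - z0) \<le> r \<Longrightarrow> x > (0::real) \<Longrightarrow> \<delta> \<le> norm (1 - z * exp (- of_real x))"
proof -
  obtain r where r: "r > 0" "cball z0 r \<subseteq> slit_plane"
    using open_contains_cball[of slit_plane] open_slit_plane assms by blast
  let ?f = "\<lambda>(z, y). norm (1 - z * complex_of_real y)"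
  have "compact (cball z0 r \<times> {0..1::real})" by (intro compact_Times) auto
  moreover have "continuous_on (cball z0 r \<times> {0..1::real}) ?f"
    unfolding case_prod_unfold by (intro continuous_intros)
  moreover have "cball z0 r \<times> {0..1::real} \<noteq> {}" using r by auto
  ultimately obtain m where m: "m \<in> cball z0 r \<times> {0..1}" "\<And>q. q \<in> cball z0 r \<times> {0..1} \<Longrightarrow> ?f m \<le> ?f q"
    by (metis (no_types, lifting) continuous_attains_inf)
  have "?f m > 0" using m(1) slit_denominator_nz r by (cases m) auto
  moreover have "?f m \<le> norm (1 - z * exp (- of_real x))" if "norm (z - z0) \<le> r" "x > 0" for z and x :: real
    using m(2)[of "(z, exp (-x))"] that exp_uminus_le_1[of x] by (simp add: dist_norm norm_minus_commute)
  ultimately show ?thesis using that r by blast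
qed

text \<open>
  For \<open>j = 1\<close> this is the integrand of the classical representation of \<open>\<Gamma>(s) \<Phi>(z, s, a)\<close>. Integration by
  parts leads to all powers of the denominator, and \<open>j = 0\<close> is Euler's integral.
\<close>

definition lerch_integrand :: "nat \<Rightarrow> complex \<Rightarrow> complex \<Rightarrow> complex \<Rightarrow> real \<Rightarrow> complex" where
  "lerch_integrand j s a z x = of_real x powr (s - 1) * exp (- (a * of_real x)) / (1 - z * exp (- of_real x)) ^ j"

definition lerch_integral :: "nat \<Rightarrow> complex \<Rightarrow> complex \<Rightarrow> complex \<Rightarrow> complex" where
  "lerch_integral j s a z = (\<integral>x. lerch_integrand j s a z x \<partial>hline)"

lemma lerch_denominator_nz: "z \<in> slit_plane \<Longrightarrow> 0 < x \<Longrightarrow> 1 - z * exp (- complex_of_real x) \<noteq> 0"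
  using slit_denominator_nz[of z "exp (-x)"] exp_uminus_le_1[of x] by simp

lemma measurable_lerch_integrand:
  assumes "z \<in> slit_plane" shows "lerch_integrand j s a z \<in> borel_measurable hline"
  unfolding lerch_integrand_def
  by (intro measurable_hline continuous_intros) (use lerch_denominator_nz[OF assms] in auto)

lemma integrable_real_gamma:
  fixes \<sigma> \<alpha> :: real assumes "\<sigma> > 0" "\<alpha> > 0"
  shows "integrable hline (\<lambda>x. x powr (\<sigma> - 1) * exp (- (\<alpha> * x)))"
proof -
  have "integrable hline (\<lambda>x. norm (complex_of_real x powr (of_real \<sigma> - 1) * exp (- of_real (\<alpha> * x))))"
    using Gamma_integral_hline(1)[of "of_real \<sigma>" \<alpha>] assms by (intro integrable_norm) auto
  also have "?this \<longleftrightarrow> ?thesis"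
    by (intro Bochner_Integration.integrable_cong) (auto simp: norm_mult norm_powr_real_powr)
  finally show ?thesis .
qed

abbreviation lerch_majorant :: "nat \<Rightarrow> complex \<Rightarrow> complex \<Rightarrow> complex \<Rightarrow> real \<Rightarrow> (real \<Rightarrow> real) \<Rightarrow> bool" where
  "lerch_majorant j s0 a0 z0 r B \<equiv> \<forall>s a z. norm (s - s0) \<le> r \<longrightarrow> norm (a - a0) \<le> r \<longrightarrow> norm (z - z0) \<le> r \<longrightarrow>
    Re s > 0 \<and> Re a > 0 \<and> z \<in> slit_plane \<and> (\<forall>x>0. norm (lerch_integrand j s a z x) \<le> B x)"

text \<open>
  One majorant serves all nearby parameters: \<open>x powr (Re s - 1)\<close> lies below the sum of the powers
  with the extreme exponents, one of which is relevant for \<open>x \<le> 1\<close> and the other for \<open>x \<ge> 1\<close>.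
\<close>

lemma lerch_majorant_ex:
  assumes s0: "Re s0 > 0" and a0: "Re a0 > 0" and z0: "z0 \<in> slit_plane"
  shows "\<exists>r>0. \<exists>B. integrable hline B \<and> lerch_majorant j s0 a0 z0 r B"
proof -
  obtain r1 \<delta> where r1: "r1 > 0" "\<delta> > 0" "cball z0 r1 \<subseteq> slit_plane"
    and \<delta>: "\<And>z x. norm (z - z0) \<le> r1 \<Longrightarrow> x > (0::real) \<Longrightarrow> \<delta> \<le> norm (1 - z * exp (- of_real x))"
    using slit_denominator_bound[OF z0] by metis
  define r where "r = min r1 (min (Re s0 / 2) (Re a0 / 2))"
  define \<sigma> where "\<sigma> = Re s0 / 2"
  define \<tau> where "\<tau> = 2 * Re s0"
  define \<alpha> where "\<alpha> = Re a0 / 2"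
  define B where "B x = (x powr (\<sigma> - 1) * exp (- (\<alpha> * x)) + x powr (\<tau> - 1) * exp (- (\<alpha> * x))) / \<delta> ^ j" for x :: real
  have r: "r > 0" using r1 s0 a0 by (simp add: r_def)
  have B: "integrable hline B" unfolding B_def
    using integrable_real_gamma[of \<sigma> \<alpha>] integrable_real_gamma[of \<tau> \<alpha>] s0 a0
    by (simp add: \<sigma>_def \<tau>_def \<alpha>_def)
  have s: "\<sigma> \<le> Re s \<and> Re s \<le> \<tau>" if "norm (s - s0) \<le> r" for s
    using abs_Re_le_cmod[of "s - s0"] that s0 unfolding r_def \<sigma>_def \<tau>_def by auto
  have a: "\<alpha> \<le> Re a" if "norm (a - a0) \<le> r" for a
    using abs_Re_le_cmod[of "a - a0"] that a0 unfolding r_def \<alpha>_def by auto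
  have bound: "norm (lerch_integrand j s a z x) \<le> B x"
    if *: "norm (s - s0) \<le> r" "norm (a - a0) \<le> r" "norm (z - z0) \<le> r" and x: "x > (0::real)" for s a z x
  proof -
    have 1: "x powr (Re s - 1) \<le> x powr (\<sigma> - 1) + x powr (\<tau> - 1)"
    proof (cases "x \<le> 1")
      case True
      hence "x powr (Re s - 1) \<le> x powr (\<sigma> - 1)" using x s[OF *(1)] by (intro powr_mono') auto
      thus ?thesis by (simp add: add_increasing2)
    next
      case False
      hence "x powr (Re s - 1) \<le> x powr (\<tau> - 1)" using x s[OF *(1)] by (intro powr_mono) auto
      thus ?thesis by (simp add: add_increasing)
    qed
    have 2: "exp (- (Re a * x)) \<le> exp (- (\<alpha> * x))" using a[OF *(2)] x by simp
    have "norm (z - z0) \<le> r1" using *(3) by (simp add: r_def)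
    hence 3: "\<delta> ^ j \<le> norm (1 - z * exp (- of_real x)) ^ j"
      using \<delta>[OF _ x] r1 by (intro power_mono) auto
    have "norm (lerch_integrand j s a z x) = x powr (Re s - 1) * exp (- (Re a * x)) / norm (1 - z * exp (- of_real x)) ^ j"
      using x by (simp add: lerch_integrand_def norm_mult norm_divide norm_power norm_powr_real_powr)
    also have "\<dots> \<le> (x powr (\<sigma> - 1) + x powr (\<tau> - 1)) * exp (- (\<alpha> * x)) / \<delta> ^ j"
      using r1 by (intro frac_le mult_mono 1 2 3) auto
    also have "\<dots> = B x" by (simp add: B_def ring_distribs)
    finally show "norm (lerch_integrand j s a z x) \<le> B x" .
  qed
  have Rs: "Re s > 0" if "norm (s - s0) \<le> r" for s using s[OF that] s0 by (simp add: \<sigma>_def)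
  have Ra: "Re a > 0" if "norm (a - a0) \<le> r" for a using a[OF that] a0 by (simp add: \<alpha>_def)
  have sz: "z \<in> slit_plane" if "norm (z - z0) \<le> r" for z
    by (rule subsetD[OF r1(3)]) (use that in \<open>simp add: r_def dist_norm norm_minus_commute\<close>)
  have "lerch_majorant j s0 a0 z0 r B"
    by (intro allI impI conjI Rs Ra sz bound)
  with r B show ?thesis by (intro exI[of _ r] exI[of _ B] conjI)
qed

lemma integrable_lerch_integrand:
  assumes "Re s > 0" "Re a > 0" "z \<in> slit_plane"
  shows "integrable hline (lerch_integrand j s a z)"
proof -
  obtain r B where "r > 0" and B: "integrable hline B" and D: "lerch_majorant j s a z r B"
    using lerch_majorant_ex[OF assms, where j = j] by (elim exE conjE) (rule that)
  have "norm (lerch_integrand j s a z x) \<le> norm (B x)" if "x > 0" for x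
    using D[rule_format, of s a z] that \<open>r > 0\<close> by (simp add: order.trans[OF _ abs_ge_self])
  thus ?thesis
    by (intro Bochner_Integration.integrable_bound[OF B] measurable_lerch_integrand assms(3) AE_I2) simp
qed

text \<open>
  Holomorphy in all three arguments at once is expressed by substituting holomorphic functions.
\<close>

lemma holomorphic_lerch_integral:
  assumes S: "open S" and hol: "f holomorphic_on S" "g holomorphic_on S" "h holomorphic_on S"
    and dom: "\<And>p. p \<in> S \<Longrightarrow> Re (f p) > 0" "\<And>p. p \<in> S \<Longrightarrow> Re (g p) > 0" "\<And>p. p \<in> S \<Longrightarrow> h p \<in> slit_plane"
  shows "(\<lambda>p. lerch_integral j (f p) (g p) (h p)) holomorphic_on S"
  unfolding lerch_integral_def
proof (rule holomorphic_on_integral_param[OF S])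
  show "(\<lambda>p. lerch_integrand j (f p) (g p) (h p) x) holomorphic_on S" if "x \<in> space hline" for x
    unfolding lerch_integrand_def using that by (intro holomorphic_intros hol) (use lerch_denominator_nz dom in auto)
  show "lerch_integrand j (f p) (g p) (h p) \<in> borel_measurable hline" if "p \<in> S" for p
    by (rule measurable_lerch_integrand[OF dom(3)[OF that]])
  fix p0 assume p0: "p0 \<in> S"
  obtain r B where r: "r > 0" and B: "integrable hline B" and D: "lerch_majorant j (f p0) (g p0) (h p0) r B"
    using lerch_majorant_ex[OF dom(1-3)[OF p0], where j = j] by (elim exE conjE) (rule that)
  have near: "\<forall>\<^sub>F p in nhds p0. norm (\<phi> p - \<phi> p0) \<le> r" if "\<phi> holomorphic_on S" for \<phi>
  proof -
    have "isCont \<phi> p0"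
      using holomorphic_on_imp_continuous_on[OF that] S p0 by (simp add: continuous_on_eq_continuous_at)
    hence "(\<phi> \<longlongrightarrow> \<phi> p0) (nhds p0)" by (simp add: isCont_def tendsto_at_iff_tendsto_nhds)
    hence "\<forall>\<^sub>F p in nhds p0. dist (\<phi> p) (\<phi> p0) < r" using r by (rule tendstoD)
    thus ?thesis by eventually_elim (simp add: dist_norm)
  qed
  have "\<forall>\<^sub>F p in nhds p0. p \<in> S \<and> norm (f p - f p0) \<le> r \<and> norm (g p - g p0) \<le> r \<and> norm (h p - h p0) \<le> r"
    by (intro eventually_conj near hol eventually_nhds_in_open S p0)
  then obtain d where d: "d > 0" "\<And>p. dist p p0 < d \<Longrightarrow>
      p \<in> S \<and> norm (f p - f p0) \<le> r \<and> norm (g p - g p0) \<le> r \<and> norm (h p - h p0) \<le> r"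
    unfolding eventually_nhds_metric by (elim exE conjE) (rule that, auto)
  have "p \<in> S \<and> (\<forall>x\<in>space hline. norm (lerch_integrand j (f p) (g p) (h p) x) \<le> B x)"
    if "norm (p - p0) \<le> d / 2" for p
    using D[rule_format, of "f p" "g p" "h p"] d(2)[of p] d(1) that by (simp add: dist_norm)
  hence "\<forall>q. norm (q - p0) \<le> d / 2 \<longrightarrow> q \<in> S \<and> (\<forall>x\<in>space hline. norm (lerch_integrand j (f q) (g q) (h q) x) \<le> B x)"
    by (intro allI impI)
  thus "\<exists>r>0. \<exists>B. integrable hline B \<and> (\<forall>q. norm (q - p0) \<le> r \<longrightarrow>
      q \<in> S \<and> (\<forall>x\<in>space hline. norm (lerch_integrand j (f q) (g q) (h q) x) \<le> B x))"
    using B d(1) by (intro exI[of _ "d / 2"] exI[of _ B] conjI) simp_all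
qed

lemma holomorphic_eq_0_of_pos_reals:
  assumes "f holomorphic_on S" "open S" "connected S" "complex_of_real ` {0<..} \<subseteq> S"
    and "\<And>x. x > (0::real) \<Longrightarrow> f (of_real x) = 0" and "w \<in> S"
  shows "f w = 0"
proof (rule analytic_continuation[OF assms(1-4), where \<xi> = 1])
  show "1 islimpt complex_of_real ` {0<..}"
    unfolding islimpt_approachable
  proof (intro allI impI)
    fix e :: real assume "e > 0"
    thus "\<exists>x'\<in>complex_of_real ` {0<..}. x' \<noteq> 1 \<and> dist x' 1 < e"
      by (intro bexI[of _ "of_real (1 + e / 2)"] imageI) (auto simp: dist_norm)
  qed
  show "1 \<in> S" using assms(4) by (auto dest!: subsetD[where c = 1] intro!: image_eqI[of _ _ 1])
qed (use assms in auto)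

text \<open>
  Both sides are holomorphic in \<open>c\<close>, and for real \<open>c\<close> the formula is a change of scale.
\<close>

lemma Gamma_integral_complex_rate:
  assumes s: "Re s > 0" and c: "Re c > 0"
  shows "(\<integral>x. of_real x powr (s - 1) * exp (- (c * of_real x)) \<partial>hline) = Gamma s / c powr s"
proof -
  have e: "lerch_integral 0 s c 0 = (\<integral>x. of_real x powr (s - 1) * exp (- (c * of_real x)) \<partial>hline)" for c
    by (simp add: lerch_integral_def lerch_integrand_def)
  have "lerch_integral 0 s c 0 - Gamma s / c powr s = 0"
  proof (rule holomorphic_eq_0_of_pos_reals[where S = "{a. Re a > 0}" and f = "\<lambda>c. lerch_integral 0 s c 0 - Gamma s / c powr s"])
    show "(\<lambda>c. lerch_integral 0 s c 0 - Gamma s / c powr s) holomorphic_on {a. Re a > 0}"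
      by (intro holomorphic_intros holomorphic_lerch_integral norm_less_1_slit)
         (auto simp: complex_nonpos_Reals_iff open_halfspace_Re_gt s)
    show "lerch_integral 0 s (of_real x) 0 - Gamma s / of_real x powr s = 0" if "x > 0" for x :: real
      using that Gamma_integral_hline(2)[OF s, of x] by (simp add: e)
  qed (use c in \<open>auto intro: convex_connected convex_halfspace_Re_gt simp: open_halfspace_Re_gt\<close>)
  thus ?thesis by (simp add: e)
qed

section \<open>Continuation in the exponent\<close>

text \<open>
  With \<open>D = 1 - z * exp (- x)\<close> one has \<open>D' = 1 - D\<close>, so the derivative of
  \<open>x powr s * exp (- a x) / D ^ j\<close> is a combination of integrands with denominators \<open>D ^ j\<close> and
  \<open>D ^ (j + 1)\<close>. The integral of this derivative is zero.
\<close>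

lemma lerch_integral_by_parts:
  assumes s: "Re s > 0" and a: "Re a > 0" and z: "z \<in> slit_plane"
  shows "s * lerch_integral j s a z = (a - of_nat j) * lerch_integral j (s + 1) a z + of_nat j * lerch_integral (j + 1) (s + 1) a z"
proof -
  define D where "D w = 1 - z * exp (- w)" for w :: complex
  define F where "F w = w powr s * exp (- (a * w)) / D w ^ j" for w
  define f where "f x = s * lerch_integrand j s a z x - (a - of_nat j) * lerch_integrand j (s + 1) a z x
      - of_nat j * lerch_integrand (j + 1) (s + 1) a z x" for x :: real
  have nz: "D (of_real x) \<noteq> 0" if "x > 0" for x :: real
    using lerch_denominator_nz[OF z that] by (simp add: D_def)
  have int: "integrable hline (lerch_integrand i t a z)" if "Re t > 0" for i t
    using integrable_lerch_integrand[OF that a z] .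
  have int1: "integrable hline (lerch_integrand i (s + 1) a z)" for i using int[of "s + 1"] s by simp
  have intf: "integrable hline f"
    unfolding f_def by (intro Bochner_Integration.integrable_diff integrable_mult_right int int1 s)
  have der: "((\<lambda>x. F (of_real x)) has_vector_derivative f x) (at x)" if x: "x > 0" for x :: real
  proof (rule has_vector_derivative_real_field)
    define w where "w = complex_of_real x"
    have w: "w \<notin> \<real>\<^sub>\<le>\<^sub>0" "w \<noteq> 0" using x by (auto simp: w_def)
    have Dw: "D w \<noteq> 0" using nz[OF x] by (simp add: w_def)
    have D': "(D has_field_derivative (1 - D w)) (at w)"
      unfolding D_def by (auto intro!: derivative_eq_intros)
    have "(F has_field_derivative
        ((s * w powr (s - 1) * exp (- (a * w)) + w powr s * (exp (- (a * w)) * (- a))) * D w ^ j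
          - w powr s * exp (- (a * w)) * (of_nat j * D w ^ (j - 1) * (1 - D w))) / (D w ^ j * D w ^ j)) (at w)"
      unfolding F_def using w Dw
      by (auto intro!: derivative_eq_intros D' has_field_derivative_powr simp: algebra_simps)
    also have "((s * w powr (s - 1) * exp (- (a * w)) + w powr s * (exp (- (a * w)) * (- a))) * D w ^ j
          - w powr s * exp (- (a * w)) * (of_nat j * D w ^ (j - 1) * (1 - D w))) / (D w ^ j * D w ^ j) = f x"
    proof (cases j)
      case 0
      thus ?thesis by (simp add: f_def lerch_integrand_def D_def w_def algebra_simps)
    next
      case (Suc i)
      have l: "lerch_integrand n t a z x = w powr (t - 1) * exp (- (a * w)) / D w ^ n" for n t
        by (simp add: lerch_integrand_def D_def w_def)
      show ?thesis unfolding f_def l using Dw by (simp add: Suc divide_simps) (simp add: algebra_simps)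
    qed
    finally show "(F has_field_derivative f x) (at (of_real x))" by (simp add: w_def)
  qed
  obtain r \<delta> where \<delta>0: "\<delta> > 0" "r > 0"
    and \<delta>: "\<And>z' x. norm (z' - z) \<le> r \<Longrightarrow> x > (0::real) \<Longrightarrow> \<delta> \<le> norm (1 - z' * exp (- of_real x))"
    using slit_denominator_bound[OF z] by metis
  have Fb: "norm (F (of_real x)) \<le> x powr Re s * exp (- (Re a * x)) / \<delta> ^ j" if x: "x > 0" for x :: real
  proof -
    have "norm (F (of_real x)) = x powr Re s * exp (- (Re a * x)) / norm (D (of_real x)) ^ j"
      using x by (simp add: F_def norm_mult norm_divide norm_power norm_powr_real_powr)
    also have "\<dots> \<le> x powr Re s * exp (- (Re a * x)) / \<delta> ^ j"
      using \<delta>[of z x] \<delta>0 x by (intro divide_left_mono power_mono mult_pos_pos zero_less_power) (auto simp: D_def intro: less_le_trans)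
    finally show ?thesis .
  qed
  have lim0: "((\<lambda>x. F (of_real x)) \<longlongrightarrow> 0) (at_right 0)"
  proof (rule Lim_null_comparison)
    show "eventually (\<lambda>x. norm (F (of_real x)) \<le> x powr Re s * exp (- (Re a * x)) / \<delta> ^ j) (at_right 0)"
      using eventually_at_right_less[of 0] by eventually_elim (rule Fb)
    have "((\<lambda>x. x powr Re s * exp (- (Re a * x))) \<longlongrightarrow> 0) (at_right 0)" using s a by real_asymp
    from tendsto_divide[OF this tendsto_const[of "\<delta> ^ j"]] \<delta>0
    show "((\<lambda>x. x powr Re s * exp (- (Re a * x)) / \<delta> ^ j) \<longlongrightarrow> 0) (at_right 0)" by simp
  qed
  have lim1: "((\<lambda>x. F (of_real x)) \<longlongrightarrow> 0) at_top"
  proof (rule Lim_null_comparison)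
    show "eventually (\<lambda>x. norm (F (of_real x)) \<le> x powr Re s * exp (- (Re a * x)) / \<delta> ^ j) at_top"
      using eventually_gt_at_top[of 0] by eventually_elim (rule Fb)
    have "((\<lambda>x. x powr Re s * exp (- (Re a * x))) \<longlongrightarrow> 0) at_top" using s a by real_asymp
    from tendsto_divide[OF this tendsto_const[of "\<delta> ^ j"]] \<delta>0
    show "((\<lambda>x. x powr Re s * exp (- (Re a * x)) / \<delta> ^ j) \<longlongrightarrow> 0) at_top" by simp
  qed
  have "(LBINT x=0..\<infinity>. f x) = 0 - 0"
  proof (rule interval_integral_FTC_integrable)
    show "((\<lambda>x. F (of_real x)) has_vector_derivative f x) (at x)" if "0 < ereal x" for x
      using der that by simp
    show "isCont f x" if "0 < ereal x" for x
      unfolding f_def lerch_integrand_def using that lerch_denominator_nz[OF z, of x]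
      by (intro continuous_intros) (auto simp: complex_nonpos_Reals_iff)
    show "set_integrable lborel (einterval 0 \<infinity>) f"
      using intf by (simp add: integrable_hline einterval_def greaterThan_def zero_ereal_def)
    show "(((\<lambda>x. F (of_real x)) \<circ> real_of_ereal) \<longlongrightarrow> 0) (at_right 0)"
      using lim0 by (simp add: zero_ereal_def ereal_tendsto_simps1)
    show "(((\<lambda>x. F (of_real x)) \<circ> real_of_ereal) \<longlongrightarrow> 0) (at_left \<infinity>)"
      using lim1 by (simp add: ereal_tendsto_simps1)
  qed simp
  also have "(LBINT x=0..\<infinity>. f x) = (\<integral>x. f x \<partial>hline)"
    by (simp add: integral_hline interval_lebesgue_integral_def einterval_def greaterThan_def zero_ereal_def)
  also have "\<dots> = s * lerch_integral j s a z - (a - of_nat j) * lerch_integral j (s + 1) a z - of_nat j * lerch_integral (j + 1) (s + 1) a z"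
    unfolding f_def lerch_integral_def
    by (simp add: Bochner_Integration.integral_diff Bochner_Integration.integrable_diff integrable_mult_right int int1 s)
  finally show ?thesis by (simp add: algebra_simps)
qed

text \<open>
  The recursion is integration by parts, divided by \<open>\<Gamma>(s + 1) = s \<Gamma>(s)\<close>. Each step uses integrals with an
  exponent larger by one, so level \<open>N\<close> makes sense for \<open>Re s > - N\<close>.
\<close>

fun lerch_ext :: "nat \<Rightarrow> nat \<Rightarrow> complex \<Rightarrow> complex \<Rightarrow> complex \<Rightarrow> complex" where
  "lerch_ext 0 j s a z = rGamma s * lerch_integral j s a z"
| "lerch_ext (Suc N) j s a z = (a - of_nat j) * lerch_ext N j (s + 1) a z + of_nat j * lerch_ext N (j + 1) (s + 1) a z"

lemma lerch_ext_Suc: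
  assumes "Re a > 0" "z \<in> slit_plane" "Re s > - real N"
  shows "lerch_ext (Suc N) j s a z = lerch_ext N j s a z"
  using assms(3)
proof (induction N arbitrary: s j)
  case 0
  hence s: "Re s > 0" by simp
  have "s * lerch_integral j s a z = (a - of_nat j) * lerch_integral j (s + 1) a z + of_nat j * lerch_integral (j + 1) (s + 1) a z"
    using lerch_integral_by_parts[OF s assms(1,2)] .
  hence "rGamma (s + 1) * (s * lerch_integral j s a z) = rGamma (s + 1) *
      ((a - of_nat j) * lerch_integral j (s + 1) a z + of_nat j * lerch_integral (j + 1) (s + 1) a z)" by simp
  moreover have "rGamma (s + 1) * (s * lerch_integral j s a z) = rGamma s * lerch_integral j s a z"
    unfolding rGamma_plus1[of s, symmetric] by (simp only: mult_ac)
  ultimately have "rGamma s * lerch_integral j s a z = rGamma (s + 1) *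
      ((a - of_nat j) * lerch_integral j (s + 1) a z + of_nat j * lerch_integral (j + 1) (s + 1) a z)"
    by (simp only:)
  thus ?case by (simp add: algebra_simps)
next
  case (Suc N)
  have "Re (s + 1) > - real N" using Suc.prems by simp
  thus ?case using Suc.IH[of "s + 1"] by (metis lerch_ext.simps(2))
qed

lemma lerch_ext_add:
  assumes "Re a > 0" "z \<in> slit_plane" "Re s > - real N"
  shows "lerch_ext (N + d) j s a z = lerch_ext N j s a z"
proof (induction d)
  case (Suc d)
  have "lerch_ext (Suc (N + d)) j s a z = lerch_ext (N + d) j s a z"
    by (rule lerch_ext_Suc) (use assms in auto)
  thus ?case using Suc by (simp del: lerch_ext.simps)
qed simp

text \<open>
  The level is large enough for \<open>s\<close>; by \<open>lerch_ext_add\<close> larger levels give the same value.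
\<close>

definition lerch_cont :: "complex \<Rightarrow> complex \<Rightarrow> complex \<Rightarrow> complex" where
  "lerch_cont s a z = lerch_ext (nat \<lceil>- Re s\<rceil> + 1) 1 s a z"

lemma lerch_cont_eq:
  assumes "Re a > 0" "z \<in> slit_plane" "Re s > - real N"
  shows "lerch_cont s a z = lerch_ext N 1 s a z"
proof -
  define M where "M = nat \<lceil>- Re s\<rceil> + 1"
  have M: "Re s > - real M" unfolding M_def by linarith
  have "lerch_ext M 1 s a z = lerch_ext (max M N) 1 s a z"
    using lerch_ext_add[OF assms(1,2) M, of "max M N - M"] by simp
  also have "\<dots> = lerch_ext N 1 s a z"
    using lerch_ext_add[OF assms(1,2,3), of "max M N - N"] by simp
  finally show ?thesis by (simp add: lerch_cont_def M_def)
qed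

lemma holomorphic_lerch_ext:
  assumes "open S" "f holomorphic_on S" "g holomorphic_on S" "h holomorphic_on S"
    and "\<And>p. p \<in> S \<Longrightarrow> Re (f p) > - real N" "\<And>p. p \<in> S \<Longrightarrow> Re (g p) > 0" "\<And>p. p \<in> S \<Longrightarrow> h p \<in> slit_plane"
  shows "(\<lambda>p. lerch_ext N j (f p) (g p) (h p)) holomorphic_on S"
  using assms
proof (induction N arbitrary: f j)
  case 0
  have "(\<lambda>p. rGamma (f p)) holomorphic_on S" by (intro holomorphic_intros 0)
  moreover have "(\<lambda>p. lerch_integral j (f p) (g p) (h p)) holomorphic_on S"
    by (rule holomorphic_lerch_integral) (use 0 in auto)
  ultimately show ?case by (auto intro: holomorphic_on_mult)
next
  case (Suc N)
  have "(\<lambda>p. lerch_ext N i (f p + 1) (g p) (h p)) holomorphic_on S" for i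
  proof (rule Suc.IH)
    show "(\<lambda>p. f p + 1) holomorphic_on S" by (intro holomorphic_intros Suc.prems)
    show "Re (f p + 1) > - real N" if "p \<in> S" for p using Suc.prems(5)[OF that] by simp
  qed (use Suc.prems in auto)
  thus ?case using Suc.prems(3) by (auto intro!: holomorphic_intros)
qed

lemma holomorphic_lerch_cont:
  assumes S: "open S" and hol: "f holomorphic_on S" "g holomorphic_on S" "h holomorphic_on S"
    and dom: "\<And>p. p \<in> S \<Longrightarrow> Re (g p) > 0" "\<And>p. p \<in> S \<Longrightarrow> h p \<in> slit_plane"
  shows "(\<lambda>p. lerch_cont (f p) (g p) (h p)) holomorphic_on S"
proof -
  have "(\<lambda>p. lerch_cont (f p) (g p) (h p)) field_differentiable (at p)" if p: "p \<in> S" for p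
  proof -
    define N where "N = nat \<lceil>- Re (f p)\<rceil> + 1"
    define T where "T = S \<inter> f -` {s. Re s > - real N}"
    have T: "open T" unfolding T_def
      by (rule continuous_open_preimage[OF holomorphic_on_imp_continuous_on[OF hol(1)] S open_halfspace_Re_gt])
    have pT: "p \<in> T" using p unfolding T_def N_def by simp linarith
    have "(\<lambda>p. lerch_ext N 1 (f p) (g p) (h p)) holomorphic_on T"
      by (rule holomorphic_lerch_ext) (use T dom in \<open>auto simp: T_def intro: holomorphic_on_subset hol\<close>)
    hence "(\<lambda>p. lerch_cont (f p) (g p) (h p)) holomorphic_on T"
      by (rule holomorphic_transform) (use dom in \<open>auto simp: T_def lerch_cont_eq\<close>)
    thus ?thesis using T pT by (rule holomorphic_on_imp_differentiable_at)
  qed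
  thus ?thesis by (auto simp: holomorphic_on_def intro: field_differentiable_at_within)
qed

lemma holomorphic_lerch_cont_s:
  assumes "Re a > 0" "z \<in> slit_plane" shows "(\<lambda>s. lerch_cont s a z) holomorphic_on A"
proof -
  have "(\<lambda>s. lerch_cont s a z) holomorphic_on UNIV"
    by (rule holomorphic_lerch_cont) (use assms in \<open>auto intro: holomorphic_intros\<close>)
  thus ?thesis by (rule holomorphic_on_subset) simp
qed

lemma holomorphic_lerch_cont_z:
  assumes "Re a > 0" shows "(\<lambda>z. lerch_cont s a z) holomorphic_on slit_plane"
  by (rule holomorphic_lerch_cont) (use assms open_slit_plane in \<open>auto intro: holomorphic_intros\<close>)

lemma holomorphic_lerch_cont_a:
  assumes "z \<in> slit_plane" shows "(\<lambda>a. lerch_cont s a z) holomorphic_on {a. Re a > 0}"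
  by (rule holomorphic_lerch_cont) (use assms open_halfspace_Re_gt in \<open>auto intro: holomorphic_intros\<close>)

section \<open>The series in the open unit disc\<close>

lemma holomorphic_on_suminf:
  fixes f :: "nat \<Rightarrow> complex \<Rightarrow> complex"
  assumes S: "open S" and hol: "\<And>n. f n holomorphic_on S"
    and dom: "\<And>x. x \<in> S \<Longrightarrow> \<exists>d>0. \<exists>M. cball x d \<subseteq> S \<and> summable M \<and>
       (\<forall>\<^sub>F n in sequentially. \<forall>y\<in>cball x d. norm (f n y) \<le> M n)"
  shows "(\<lambda>x. \<Sum>n. f n x) holomorphic_on S"
proof (rule holomorphic_uniform_sequence[OF S, where f = "\<lambda>n x. \<Sum>i<n. f i x"])
  show "(\<lambda>x. \<Sum>i<n. f i x) holomorphic_on S" for n by (intro holomorphic_intros hol)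
  fix x assume "x \<in> S"
  from dom[OF this] obtain d M where d: "d > 0" "cball x d \<subseteq> S" and M: "summable M"
    and ev: "\<forall>\<^sub>F n in sequentially. \<forall>y\<in>cball x d. norm (f n y) \<le> M n" by blast
  have "uniform_limit (cball x d) (\<lambda>n x. \<Sum>i<n. f i x) (\<lambda>x. \<Sum>n. f n x) sequentially"
    by (rule Weierstrass_m_test_ev[OF ev M])
  thus "\<exists>d>0. cball x d \<subseteq> S \<and> uniform_limit (cball x d) (\<lambda>n x. \<Sum>i<n. f i x) (\<lambda>x. \<Sum>n. f n x) sequentially"
    using d by blast
qed

abbreviation lerch_term :: "complex \<Rightarrow> complex \<Rightarrow> complex \<Rightarrow> nat \<Rightarrow> complex" where
  "lerch_term z s a n \<equiv> z ^ n / (a + of_nat n) powr s"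

text \<open>
  The argument of a principal logarithm is at most \<open>\<pi>\<close> in absolute value.
\<close>

lemma norm_powr_bound:
  fixes c s :: complex assumes "c \<noteq> 0"
  shows "norm (c powr s) \<le> norm c powr Re s * exp (pi * norm s)"
proof -
  have "norm (c powr s) = exp (Re s * ln (norm c) - Im s * Im (Ln c))"
    using assms by (simp add: powr_def)
  also have "- (Im s * Im (Ln c)) \<le> \<bar>Im s\<bar> * \<bar>Im (Ln c)\<bar>" by (metis abs_ge_minus_self abs_mult)
  hence "Re s * ln (norm c) - Im s * Im (Ln c) \<le> Re s * ln (norm c) + norm s * pi"
    using mult_mono[of "\<bar>Im s\<bar>" "norm s" "\<bar>Im (Ln c)\<bar>" pi] abs_Im_le_cmod[of s]
      mpi_less_Im_Ln[OF assms] Im_Ln_le_pi[OF assms] by fastforce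
  hence "exp (Re s * ln (norm c) - Im s * Im (Ln c)) \<le> exp (Re s * ln (norm c)) * exp (pi * norm s)"
    by (simp add: mult.commute flip: exp_add)
  also have "exp (Re s * ln (norm c)) = norm c powr Re s" using assms by (simp add: powr_def)
  finally show ?thesis .
qed

lemma norm_lerch_term:
  assumes "a + of_nat n \<noteq> 0"
  shows "norm (lerch_term z s a n) \<le> norm z ^ n * (norm (a + of_nat n) powr (- Re s) * exp (pi * norm s))"
proof -
  have "lerch_term z s a n = z ^ n * (a + of_nat n) powr (- s)"
    using assms by (simp add: powr_minus divide_inverse)
  also have "norm \<dots> \<le> norm z ^ n * (norm (a + of_nat n) powr (Re (- s)) * exp (pi * norm (- s)))"
    unfolding norm_mult norm_power by (intro mult_left_mono norm_powr_bound assms) auto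
  finally show ?thesis by simp
qed

lemma norm_add_of_nat_ge: "Re a > 0 \<Longrightarrow> real n \<le> norm (a + of_nat n)"
  using complex_Re_le_cmod[of "a + of_nat n"] by simp

text \<open>
  The powers \<open>(a + n) powr s\<close> grow at most polynomially, uniformly for bounded \<open>s\<close>, hence are absorbed
  by half of the geometric decay of \<open>z ^ n\<close>.
\<close>

lemma lerch_term_geometric:
  assumes a: "Re a > 0" and z: "norm z < 1"
  obtains q where "0 < q" "q < 1"
    "\<forall>\<^sub>F n in sequentially. \<forall>s. norm s \<le> R \<longrightarrow> norm (lerch_term z s a n) \<le> q ^ n"
proof -
  define q where "q = sqrt ((1 + norm z) / 2)"
  have q: "0 < q" "q < 1" "norm z \<le> q * q" using z by (auto simp: q_def add_pos_nonneg)
  have "((\<lambda>n. q ^ n * ((norm a + real n) powr R * exp (pi * R))) \<longlongrightarrow> 0) sequentially"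
    using q(1,2) by real_asymp
  hence "\<forall>\<^sub>F n in sequentially. q ^ n * ((norm a + real n) powr R * exp (pi * R)) < 1"
    by (rule order_tendstoD) simp
  hence "\<forall>\<^sub>F n in sequentially. \<forall>s. norm s \<le> R \<longrightarrow> norm (lerch_term z s a n) \<le> q ^ n"
    using eventually_ge_at_top[of 1]
  proof eventually_elim
    case (elim n)
    show ?case
    proof (intro allI impI)
      fix s :: complex assume s: "norm s \<le> R"
      have n1: "1 \<le> norm (a + of_nat n)" using norm_add_of_nat_ge[OF a, of n] elim(2) by simp
      have nz: "a + of_nat n \<noteq> 0" using n1 by auto
      have "norm (a + of_nat n) powr (- Re s) \<le> norm (a + of_nat n) powr R"
        using n1 s abs_Re_le_cmod[of s] by (intro powr_mono) auto
      also have "\<dots> \<le> (norm a + real n) powr R"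
        using norm_triangle_ineq[of a "of_nat n"] order.trans[OF norm_ge_zero s]
        by (intro powr_mono2) (auto intro: order.trans)
      finally have b: "norm (a + of_nat n) powr (- Re s) \<le> (norm a + real n) powr R" .
      have "norm (lerch_term z s a n) \<le> norm z ^ n * (norm (a + of_nat n) powr (- Re s) * exp (pi * norm s))"
        by (rule norm_lerch_term[OF nz])
      also have "\<dots> \<le> (q * q) ^ n * ((norm a + real n) powr R * exp (pi * R))"
        using s b q by (intro mult_mono power_mono) auto
      also have "\<dots> = q ^ n * (q ^ n * ((norm a + real n) powr R * exp (pi * R)))"
        by (simp add: power_mult_distrib mult_ac)
      also have "\<dots> \<le> q ^ n * 1" using elim(1) q(1) by (intro mult_left_mono) auto
      finally show "norm (lerch_term z s a n) \<le> q ^ n" by simp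
    qed
  qed
  thus ?thesis using that q by blast
qed

lemma summable_lerch_disc:
  assumes "Re a > 0" "norm z < 1"
  shows "summable (\<lambda>n. norm (lerch_term z s a n))"
proof -
  obtain q where q: "0 < q" "q < 1"
    "\<forall>\<^sub>F n in sequentially. \<forall>t. norm t \<le> norm s \<longrightarrow> norm (lerch_term z t a n) \<le> q ^ n"
    using lerch_term_geometric[OF assms, where R = "norm s"] by blast
  show ?thesis
    by (rule summable_comparison_test_ev[of _ "\<lambda>n. q ^ n"])
       (use q in \<open>auto elim: eventually_mono\<close>)
qed

lemma holomorphic_lerch_series_s_disc:
  assumes "Re a > 0" "norm z < 1"
  shows "(\<lambda>s. lerch_series z s a) holomorphic_on UNIV"
  unfolding lerch_series_def
proof (rule holomorphic_on_suminf)
  have nz: "a + of_nat n \<noteq> 0" for n using assms(1) by (auto simp: complex_eq_iff)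
  show "(\<lambda>s. lerch_term z s a n) holomorphic_on UNIV" for n
    by (intro holomorphic_intros) (auto simp: nz)
  fix s :: complex
  obtain q where q: "0 < q" "q < 1"
    "\<forall>\<^sub>F n in sequentially. \<forall>t. norm t \<le> norm s + 1 \<longrightarrow> norm (lerch_term z t a n) \<le> q ^ n"
    using lerch_term_geometric[OF assms, where R = "norm s + 1"] by blast
  have "norm t \<le> norm s + 1" if "t \<in> cball s 1" for t
    using that norm_triangle_ineq2[of t s] by (auto simp: dist_norm norm_minus_commute)
  hence "\<forall>\<^sub>F n in sequentially. \<forall>t\<in>cball s 1. norm (lerch_term z t a n) \<le> q ^ n"
    using q(3) by (auto elim!: eventually_mono)
  moreover have "summable (\<lambda>n. q ^ n)" using q by simp
  ultimately show "\<exists>d>0. \<exists>M. cball s d \<subseteq> UNIV \<and> summable M \<and>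
       (\<forall>\<^sub>F n in sequentially. \<forall>y\<in>cball s d. norm (lerch_term z y a n) \<le> M n)"
    by (intro exI[of _ "1::real"] exI[of _ "\<lambda>n. q ^ n"] conjI) auto
qed auto

text \<open>
  Expand \<open>1 / (1 - z * exp (- x))\<close> into a geometric series and integrate term by term.
\<close>

lemma lerch_integral_eq_series:
  assumes s: "Re s > 0" and a: "Re a > 0" and z: "norm z < 1"
  shows "lerch_integral 1 s a z = Gamma s * lerch_series z s a"
proof -
  define f where "f n x = z ^ n * (of_real x powr (s - 1) * exp (- ((a + of_nat n) * of_real x)))" for n and x :: real
  have sl: "(0::complex) \<in> slit_plane" by (simp add: slit_plane_iff)
  have int: "integrable hline (f n)" for n
    using integrable_lerch_integrand[OF s _ sl, of "a + of_nat n" 0] a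
    unfolding f_def by (intro integrable_mult_right) (simp add: lerch_integrand_def[abs_def])
  have f_eq: "f n x = of_real x powr (s - 1) * exp (- (a * of_real x)) * (z * exp (- of_real x)) ^ n" for n x
    by (simp add: f_def power_mult_distrib ring_distribs exp_diff exp_minus field_simps flip: exp_of_nat_mult)
  have lt1: "norm (z * exp (- complex_of_real x)) < 1" if "x > 0" for x
    using z that mult_left_le[of "exp (-x)" "norm z"] by (auto simp: norm_mult)
  have "(\<lambda>n. integral\<^sup>L hline (f n)) sums (\<integral>x. (\<Sum>n. f n x) \<partial>hline)"
  proof (rule sums_integral)
    show "AE x in hline. summable (\<lambda>n. norm (f n x))"
      using lt1 by (intro AE_I2) (auto simp: f_eq norm_mult norm_power intro!: summable_mult summable_geometric)
    show "summable (\<lambda>n. \<integral>x. norm (f n x) \<partial>hline)"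
    proof (rule summable_comparison_test)
      have int0: "integrable hline (\<lambda>x. x powr (Re s - 1) * exp (- (Re a * x)))"
        by (rule integrable_real_gamma[OF s a])
      have "norm (\<integral>x. norm (f n x) \<partial>hline) \<le> norm z ^ n * (\<integral>x. x powr (Re s - 1) * exp (- (Re a * x)) \<partial>hline)" for n
      proof -
        have "(\<integral>x. norm (f n x) \<partial>hline) \<le> (\<integral>x. norm z ^ n * (x powr (Re s - 1) * exp (- (Re a * x))) \<partial>hline)"
        proof (rule integral_mono)
          show "norm (f n x) \<le> norm z ^ n * (x powr (Re s - 1) * exp (- (Re a * x)))" if "x \<in> space hline" for x
            using that by (auto simp: f_def norm_mult norm_power norm_powr_real_powr ring_distribs intro!: mult_left_mono)
        qed (use int int0 in auto)
        thus ?thesis by simp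
      qed
      thus "\<exists>N. \<forall>n\<ge>N. norm (\<integral>x. norm (f n x) \<partial>hline) \<le> norm z ^ n * (\<integral>x. x powr (Re s - 1) * exp (- (Re a * x)) \<partial>hline)"
        by blast
      show "summable (\<lambda>n. norm z ^ n * (\<integral>x. x powr (Re s - 1) * exp (- (Re a * x)) \<partial>hline))"
        using z by (intro summable_mult2 summable_geometric) auto
    qed
  qed (rule int)
  also have "(\<integral>x. (\<Sum>n. f n x) \<partial>hline) = lerch_integral 1 s a z"
    unfolding lerch_integral_def
  proof (rule Bochner_Integration.integral_cong)
    fix x assume "x \<in> space hline"
    hence "x > 0" by simp
    show "(\<Sum>n. f n x) = lerch_integrand 1 s a z x"
      unfolding f_eq lerch_integrand_def
      using suminf_mult[OF summable_geometric[OF lt1[OF \<open>x > 0\<close>]]] suminf_geometric[OF lt1[OF \<open>x > 0\<close>]] by simp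
  qed simp
  also have "(\<lambda>n. integral\<^sup>L hline (f n)) = (\<lambda>n. Gamma s * lerch_term z s a n)"
  proof
    fix n
    have "integral\<^sup>L hline (f n) = z ^ n * (\<integral>x. of_real x powr (s - 1) * exp (- ((a + of_nat n) * of_real x)) \<partial>hline)"
      unfolding f_def by (rule integral_mult_right_zero)
    thus "integral\<^sup>L hline (f n) = Gamma s * lerch_term z s a n"
      using Gamma_integral_complex_rate[OF s, of "a + of_nat n"] a by simp
  qed
  finally have "(\<lambda>n. Gamma s * lerch_term z s a n) sums lerch_integral 1 s a z" .
  moreover have "(\<lambda>n. Gamma s * lerch_term z s a n) sums (Gamma s * lerch_series z s a)"
    unfolding lerch_series_def by (intro sums_mult summable_sums summable_norm_cancel[OF summable_lerch_disc[OF a z]])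
  ultimately show ?thesis by (rule sums_unique2)
qed

lemma lerch_cont_eq_integral:
  assumes "Re s > 0" "Re a > 0" "z \<in> slit_plane"
  shows "lerch_cont s a z = rGamma s * lerch_integral 1 s a z"
  using lerch_cont_eq[OF assms(2,3), where N = 0] assms(1) by simp

text \<open>
  Both sides are entire in \<open>s\<close>.
\<close>

lemma lerch_cont_eq_series:
  assumes a: "Re a > 0" and z: "norm z < 1"
  shows "lerch_cont s a z = lerch_series z s a"
proof -
  have sl: "z \<in> slit_plane" by (rule norm_less_1_slit[OF z])
  show ?thesis
  proof (rule analytic_continuation_open[where f = "\<lambda>s. lerch_cont s a z" and g = "\<lambda>s. lerch_series z s a" and s = "{s. Re s > 0}" and s' = UNIV])
    show "lerch_cont s a z = lerch_series z s a" if "s \<in> {s. Re s > 0}" for s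
    proof -
      have s: "Re s > 0" using that by simp
      hence "rGamma s * Gamma s = 1"
        by (subst rGamma_inverse_Gamma, intro left_inverse) (auto simp: Gamma_eq_zero_iff elim!: nonpos_Ints_cases)
      thus ?thesis using lerch_cont_eq_integral[OF s a sl] lerch_integral_eq_series[OF s a z] by (simp add: mult.assoc[symmetric])
    qed
    show "{s. 0 < Re s} \<noteq> {}" by (auto intro: exI[of _ 1])
  qed (use holomorphic_lerch_cont_s[OF a sl] holomorphic_lerch_series_s_disc[OF a z] in \<open>auto simp: open_halfspace_Re_gt\<close>)
qed

section \<open>A beta integral on the slit plane\<close>

lemma connected_minus_nonpos_Reals: "connected (- (\<real>\<^sub>\<le>\<^sub>0 :: complex set))"
proof -
  have "(\<real>\<^sub>\<le>\<^sub>0 :: complex set) = complex_of_real ` {..0}"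
    by (auto simp: nonpos_Reals_def)
  thus ?thesis using starlike_imp_connected[OF starlike_slotted_complex_plane_left[of 0]] by simp
qed

lemma pair_sigma_finite_hline: "pair_sigma_finite hline hline"
  by (intro pair_sigma_finite.intro sigma_finite_hline)

text \<open>
  Write \<open>1 / (1 + c u)\<close> as the integral of \<open>exp (- (1 + c u) v)\<close> over \<open>v\<close> and exchange the order of
  integration. Both integrals become Gamma integrals.
\<close>

lemma beta_integral_pos:
  fixes c :: real
  assumes \<mu>: "0 < Re \<mu>" "Re \<mu> < 1" and c: "c > 0"
  shows "integrable hline (\<lambda>u. of_real u powr (\<mu> - 1) / (1 + of_real (c * u)))"
    and "(\<integral>u. of_real u powr (\<mu> - 1) / (1 + of_real (c * u)) \<partial>hline) = Gamma \<mu> * Gamma (1 - \<mu>) / of_real c powr \<mu>"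
proof -
  interpret pair_sigma_finite hline hline by (rule pair_sigma_finite_hline)
  define f where "f = (\<lambda>(v, u). complex_of_real u powr (\<mu> - 1) * (exp (- of_real (c * v * u)) * exp (- of_real v)))"
  have m1: "(\<lambda>u. complex_of_real u powr (\<mu> - 1)) \<in> borel_measurable hline"
    by (intro measurable_hline continuous_intros) auto
  have m2 [measurable]: "(\<lambda>x::real. x) \<in> borel_measurable hline"
    by (intro measurable_hline continuous_intros)
  have m3 [measurable]: "exp \<in> borel_measurable (borel :: complex measure)"
    by (intro borel_measurable_continuous_onI continuous_intros)
  have mf: "f \<in> borel_measurable (hline \<Otimes>\<^sub>M hline)"
    unfolding f_def case_prod_unfold using m1 by measurable
  have nf: "norm (f (v, u)) = u powr (Re \<mu> - 1) * exp (- (c * v * u)) * exp (- v)" if "u > 0" for u v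
    using that by (simp add: f_def norm_mult norm_powr_real_powr)
  have I1: "integrable hline (\<lambda>u. f (v, u))" if v: "v > 0" for v
    using Gamma_integral_hline(1)[OF \<mu>(1), of "c * v"] v c
    by (auto simp: f_def mult.assoc[symmetric] intro!: integrable_mult_left)
  have I1': "(\<integral>u. f (v, u) \<partial>hline) = exp (- of_real v) * (Gamma \<mu> / of_real (c * v) powr \<mu>)" if v: "v > 0" for v
    using Gamma_integral_hline(2)[OF \<mu>(1), of "c * v"] v c
    by (simp add: f_def mult.assoc[symmetric])
  have In: "(\<integral>u. norm (f (v, u)) \<partial>hline) = exp (- v) * (Gamma (Re \<mu>) / (c * v) powr Re \<mu>)" if v: "v > 0" for v
  proof -
    have r: "0 < Re (complex_of_real (Re \<mu>))" using \<mu> by simp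
    have "complex_of_real (\<integral>u. norm (f (v, u)) \<partial>hline) = (\<integral>u. complex_of_real (norm (f (v, u))) \<partial>hline)"
      by (rule integral_complex_of_real[symmetric])
    also have "\<dots> = (\<integral>u. of_real (exp (- v)) * (of_real u powr (of_real (Re \<mu>) - 1) * exp (- of_real (c * v * u))) \<partial>hline)"
      by (intro Bochner_Integration.integral_cong)
         (auto simp: nf powr_of_real[symmetric] exp_of_real[symmetric] mult_ac)
    also have "\<dots> = of_real (exp (- v)) * (Gamma (of_real (Re \<mu>)) / of_real (c * v) powr of_real (Re \<mu>))"
      using Gamma_integral_hline(2)[OF r, of "c * v"] v c by simp
    also have "\<dots> = of_real (exp (- v) * (Gamma (Re \<mu>) / (c * v) powr Re \<mu>))"
      using v c by (simp add: Gamma_complex_of_real powr_of_real[symmetric])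
    finally show ?thesis by (simp only: of_real_eq_iff)
  qed
  have int: "integrable (hline \<Otimes>\<^sub>M hline) f"
  proof (rule Fubini_integrable[OF mf])
    have "integrable hline (\<lambda>v. Gamma (Re \<mu>) / c powr Re \<mu> * (v powr ((1 - Re \<mu>) - 1) * exp (- (1 * v))))"
      by (intro integrable_mult_right integrable_real_gamma) (use \<mu> in auto)
    also have "?this \<longleftrightarrow> integrable hline (\<lambda>v. \<integral>u. norm (f (v, u)) \<partial>hline)"
      using c by (intro Bochner_Integration.integrable_cong) (auto simp: In powr_mult powr_minus field_simps)
    finally show "integrable hline (\<lambda>v. \<integral>u. norm (f (v, u)) \<partial>hline)" .
    show "AE v in hline. integrable hline (\<lambda>u. f (v, u))" by (rule AE_I2) (simp add: I1)
  qed
  have inner: "(\<integral>v. f (v, u) \<partial>hline) = of_real u powr (\<mu> - 1) / (1 + of_real (c * u))" if u: "u > 0" for u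
  proof -
    have "(\<integral>v. f (v, u) \<partial>hline) = (\<integral>v. of_real u powr (\<mu> - 1) * (of_real v powr (1 - 1) * exp (- of_real ((1 + c * u) * v))) \<partial>hline)"
      by (intro Bochner_Integration.integral_cong) (auto simp: f_def ring_distribs mult_ac simp flip: exp_add)
    also have "\<dots> = of_real u powr (\<mu> - 1) * (Gamma 1 / of_real (1 + c * u) powr 1)"
      using Gamma_integral_hline(2)[of 1 "1 + c * u"] u c by (simp add: add_pos_pos)
    also have "\<dots> = of_real u powr (\<mu> - 1) / (1 + of_real (c * u))" by simp
    finally show ?thesis .
  qed
  have int': "integrable (hline \<Otimes>\<^sub>M hline) (\<lambda>(u, v). f (v, u))"
    using integrable_product_swap[OF int] by simp
  have "integrable hline (\<lambda>u. \<integral>v. f (v, u) \<partial>hline)"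
    using integrable_fst'[OF int'] by simp
  also have "?this \<longleftrightarrow> integrable hline (\<lambda>u. of_real u powr (\<mu> - 1) / (1 + of_real (c * u)))"
    by (intro Bochner_Integration.integrable_cong) (auto simp: inner)
  finally show "integrable hline (\<lambda>u. of_real u powr (\<mu> - 1) / (1 + of_real (c * u)))" .
  have "(\<integral>u. of_real u powr (\<mu> - 1) / (1 + of_real (c * u)) \<partial>hline) = (\<integral>u. \<integral>v. f (v, u) \<partial>hline \<partial>hline)"
    by (intro Bochner_Integration.integral_cong) (auto simp: inner)
  also have "\<dots> = (\<integral>v. \<integral>u. f (v, u) \<partial>hline \<partial>hline)"
    using Fubini_integral[of "\<lambda>v u. f (v, u)"] int by simp
  also have "\<dots> = (\<integral>v. Gamma \<mu> / of_real c powr \<mu> * (of_real v powr ((1 - \<mu>) - 1) * exp (- of_real (1 * v))) \<partial>hline)"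
    using c by (intro Bochner_Integration.integral_cong)
      (auto simp: I1' powr_times_real powr_minus field_simps)
  also have "\<dots> = Gamma \<mu> / of_real c powr \<mu> * Gamma (1 - \<mu>)"
    using Gamma_integral_hline(2)[of "1 - \<mu>" 1] \<mu> by simp
  finally show "(\<integral>u. of_real u powr (\<mu> - 1) / (1 + of_real (c * u)) \<partial>hline) = Gamma \<mu> * Gamma (1 - \<mu>) / of_real c powr \<mu>"
    by simp
qed

lemma integral_hline_HK:
  fixes f :: "real \<Rightarrow> complex"
  assumes "integrable hline f"
  shows "f absolutely_integrable_on {0<..}" "(\<integral>x. f x \<partial>hline) = integral {0<..} f"
proof -
  have si: "set_integrable lborel {0<..} f" using assms by (simp add: integrable_hline)
  show "f absolutely_integrable_on {0<..}"
    using si integrable_completion[of "\<lambda>x. indicat_real {0<..} x *\<^sub>R f x" lborel]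
    unfolding set_integrable_def by (auto dest: borel_measurable_integrable)
  show "(\<integral>x. f x \<partial>hline) = integral {0<..} f"
    unfolding integral_hline by (rule set_borel_integral_eq_integral(2)[OF si])
qed

text \<open>
  The two summands are the parts of the integral below 1 and above 1.
\<close>

lemma exp_substitution:
  fixes h :: "real \<Rightarrow> complex"
  assumes h: "integrable hline h"
    and i1: "integrable hline (\<lambda>y. exp (-y) *\<^sub>R h (exp (-y)))" and i2: "integrable hline (\<lambda>y. exp y *\<^sub>R h (exp y))"
  shows "(\<integral>u. h u \<partial>hline) = (\<integral>y. exp (-y) *\<^sub>R h (exp (-y)) \<partial>hline) + (\<integral>y. exp y *\<^sub>R h (exp y) \<partial>hline)"
proof -
  define g1 where "g1 y = exp (- y)" for y :: real
  have im1: "g1 ` {0<..} = {0<..<1}"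
  proof (intro equalityI subsetI)
    fix u :: real assume "u \<in> {0<..<1}"
    thus "u \<in> g1 ` {0<..}" by (intro image_eqI[of _ _ "- ln u"]) (auto simp: g1_def ln_less_zero)
  qed (auto simp: g1_def)
  have im2: "exp ` {0<..} = {1::real<..}"
  proof (intro equalityI subsetI)
    fix u :: real assume "u \<in> {1<..}"
    thus "u \<in> exp ` {0<..}" by (intro image_eqI[of _ _ "ln u"]) auto
  qed auto
  have a1: "h absolutely_integrable_on g1 ` {0<..} \<and> integral (g1 ` {0<..}) h = integral {0<..} (\<lambda>y. \<bar>- exp (-y)\<bar> *\<^sub>R h (g1 y))"
    by (subst has_absolute_integral_change_of_variables_real[symmetric, where h = "\<lambda>y. - exp (-y)"])
       (use integral_hline_HK(1)[OF i1] in \<open>auto simp: g1_def[abs_def] inj_on_def intro!: derivative_eq_intros\<close>)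
  have a2: "h absolutely_integrable_on exp ` {0<..} \<and> integral (exp ` {0<..}) h = integral {0<..} (\<lambda>y. \<bar>exp y\<bar> *\<^sub>R h (exp y))"
    by (subst has_absolute_integral_change_of_variables_real[symmetric, where h = exp])
       (use integral_hline_HK(1)[OF i2] in \<open>auto simp: inj_on_def intro!: derivative_eq_intros\<close>)
  have b1: "(h has_integral integral {0<..} (\<lambda>y. exp (-y) *\<^sub>R h (exp (-y)))) {0<..<1}"
    using a1 unfolding im1 by (auto simp: g1_def absolutely_integrable_on_def dest!: integrable_integral)
  have b2: "(h has_integral integral {0<..} (\<lambda>y. exp y *\<^sub>R h (exp y))) {1<..}"
    using a2 unfolding im2 by (auto simp: absolutely_integrable_on_def dest!: integrable_integral)
  have spike: "(h has_integral y) ({0<..<1} \<union> {1<..}) \<longleftrightarrow> (h has_integral y) {0<..}" for y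
    by (rule has_integral_spike_set_eq; rule negligible_subset[of "{1}"]) auto
  have "(h has_integral (integral {0<..} (\<lambda>y. exp (-y) *\<^sub>R h (exp (-y))) + integral {0<..} (\<lambda>y. exp y *\<^sub>R h (exp y)))) ({0<..<1} \<union> {1<..})"
    by (rule has_integral_Un[OF b1 b2]) (auto simp: negligible_empty intro: negligible_subset[of "{}"])
  hence "(h has_integral (integral {0<..} (\<lambda>y. exp (-y) *\<^sub>R h (exp (-y))) + integral {0<..} (\<lambda>y. exp y *\<^sub>R h (exp y)))) {0<..}"
    unfolding spike .
  thus ?thesis
    using integral_hline_HK(2)[OF h] integral_hline_HK(2)[OF i1] integral_hline_HK(2)[OF i2]
    by (simp add: integral_unique)
qed

lemma beta_lerch_pos:
  fixes c :: real
  assumes \<mu>: "0 < Re \<mu>" "Re \<mu> < 1" and c: "c > 0"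
  shows "lerch_integral 1 1 \<mu> (- of_real c) + lerch_integral 1 1 (1 - \<mu>) (- 1 / of_real c) / of_real c
    = Gamma \<mu> * Gamma (1 - \<mu>) / of_real c powr \<mu>"
proof -
  define h where "h u = of_real u powr (\<mu> - 1) / (1 + of_real (c * u))" for u :: real
  have sl: "- complex_of_real c \<in> slit_plane" "- 1 / complex_of_real c \<in> slit_plane"
    using c by (auto simp: slit_plane_iff field_simps)
  have nz: "1 + complex_of_real (c * u) \<noteq> 0" if "u > 0" for u
  proof -
    have "1 + c * u > 0" using c that by (simp add: add_pos_pos)
    thus ?thesis by (metis less_irrefl of_real_1 of_real_add of_real_eq_0_iff)
  qed
  have pw: "complex_of_real (exp t) powr w = exp (w * of_real t)" for t w
    by (simp add: powr_def Ln_of_real)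
  have e1: "exp (-y) *\<^sub>R h (exp (-y)) = lerch_integrand 1 1 \<mu> (- of_real c) y" if "y > 0" for y
  proof -
    have "exp (-y) *\<^sub>R h (exp (-y)) = exp (- of_real y) * exp ((\<mu> - 1) * of_real (- y)) / (1 + of_real c * exp (- of_real y))"
      by (simp only: h_def scaleR_conv_of_real pw) (simp add: exp_of_real flip: exp_of_real)
    also have "exp (- of_real y) * exp ((\<mu> - 1) * of_real (- y)) = exp (- (\<mu> * of_real y))"
      by (simp add: algebra_simps flip: exp_add)
    finally show ?thesis using that by (simp add: lerch_integrand_def)
  qed
  have e2: "exp y *\<^sub>R h (exp y) = lerch_integrand 1 1 (1 - \<mu>) (- 1 / of_real c) y / of_real c" if "y > 0" for y
  proof -
    have "exp y *\<^sub>R h (exp y) = exp (\<mu> * of_real y) / (1 + of_real c * exp (of_real y))"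
    proof -
      have "exp y *\<^sub>R h (exp y) = exp (of_real y) * exp ((\<mu> - 1) * of_real y) / (1 + of_real c * exp (of_real y))"
        by (simp only: h_def scaleR_conv_of_real pw) (simp add: exp_of_real flip: exp_of_real)
      also have "exp (of_real y) * exp ((\<mu> - 1) * of_real y) = exp (\<mu> * of_real y)"
        by (simp add: algebra_simps flip: exp_add)
      finally show ?thesis .
    qed
    also have "1 + of_real c * exp (of_real y) = of_real c * exp (of_real y) * (1 + exp (- complex_of_real y) / of_real c)"
    proof -
      have "exp (complex_of_real y) * exp (- complex_of_real y) = 1" by (simp flip: exp_add)
      thus ?thesis using c by (simp add: ring_distribs)
    qed
    also have "exp (\<mu> * of_real y) / (of_real c * exp (of_real y) * (1 + exp (- of_real y) / of_real c))
        = exp (- ((1 - \<mu>) * of_real y)) / (1 + exp (- of_real y) / of_real c) / of_real c"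
      by (simp add: ring_distribs exp_diff)
    finally show ?thesis using that by (simp add: lerch_integrand_def)
  qed
  have I1: "integrable hline (lerch_integrand 1 1 \<mu> (- of_real c))"
    by (rule integrable_lerch_integrand) (use \<mu> sl in auto)
  have I2: "integrable hline (lerch_integrand 1 1 (1 - \<mu>) (- 1 / of_real c))"
    by (rule integrable_lerch_integrand) (use \<mu> sl in auto)
  have "(\<integral>u. h u \<partial>hline) = (\<integral>y. exp (-y) *\<^sub>R h (exp (-y)) \<partial>hline) + (\<integral>y. exp y *\<^sub>R h (exp y) \<partial>hline)"
  proof (rule exp_substitution)
    show "integrable hline h" unfolding h_def by (rule beta_integral_pos(1)[OF assms])
    show "integrable hline (\<lambda>y. exp (-y) *\<^sub>R h (exp (-y)))"
      by (rule iffD1[OF Bochner_Integration.integrable_cong[OF refl] I1]) (simp add: e1)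
    show "integrable hline (\<lambda>y. exp y *\<^sub>R h (exp y))"
      by (rule iffD1[OF Bochner_Integration.integrable_cong[OF refl] integrable_divide_zero[OF I2, where c = "complex_of_real c"]]) (simp add: e2)
  qed
  also have "(\<integral>y. exp (-y) *\<^sub>R h (exp (-y)) \<partial>hline) = lerch_integral 1 1 \<mu> (- of_real c)"
    unfolding lerch_integral_def by (intro Bochner_Integration.integral_cong) (auto simp: e1)
  also have "(\<integral>y. exp y *\<^sub>R h (exp y) \<partial>hline) = (\<integral>y. lerch_integrand 1 1 (1 - \<mu>) (- 1 / of_real c) y / of_real c \<partial>hline)"
    by (intro Bochner_Integration.integral_cong) (auto simp: e2)
  also have "\<dots> = lerch_integral 1 1 (1 - \<mu>) (- 1 / of_real c) / of_real c"
    unfolding lerch_integral_def by simp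
  finally show ?thesis using beta_integral_pos(2)[OF assms] by (simp add: h_def)
qed

lemma slit_plane_minus_nonpos: "v \<notin> \<real>\<^sub>\<le>\<^sub>0 \<Longrightarrow> - v \<in> slit_plane"
  by (auto simp: slit_plane_iff complex_nonpos_Reals_iff)

lemma inverse_nonpos_Reals: "v \<notin> \<real>\<^sub>\<le>\<^sub>0 \<Longrightarrow> inverse v \<notin> (\<real>\<^sub>\<le>\<^sub>0 :: complex set)"
  by (metis inverse_inverse_eq nonpos_Reals_inverse_I)

text \<open>
  The two Lerch integrals with exponent 1 are the two halves of a beta integral. This is clear for
  \<open>v > 0\<close> from \<open>exp_substitution\<close>, and the identity theorem extends it to the slit plane.
\<close>

lemma beta_lerch:
  assumes \<mu>: "0 < Re \<mu>" "Re \<mu> < 1" and v: "v \<notin> \<real>\<^sub>\<le>\<^sub>0"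
  shows "lerch_integral 1 1 \<mu> (- v) + lerch_integral 1 1 (1 - \<mu>) (- inverse v) / v
    = Gamma \<mu> * Gamma (1 - \<mu>) / v powr \<mu>"
proof -
  define f where "f v = lerch_integral 1 1 \<mu> (- v) + lerch_integral 1 1 (1 - \<mu>) (- inverse v) / v
    - Gamma \<mu> * Gamma (1 - \<mu>) / v powr \<mu>" for v
  have "f v = 0"
  proof (rule holomorphic_eq_0_of_pos_reals[where f = f and S = "- \<real>\<^sub>\<le>\<^sub>0"])
    have op: "open (- (\<real>\<^sub>\<le>\<^sub>0 :: complex set))" by (simp add: open_Compl closed_nonpos_Reals_complex)
    have 2: "(\<lambda>v. lerch_integral 1 1 \<mu> (- v)) holomorphic_on - \<real>\<^sub>\<le>\<^sub>0"
      by (rule holomorphic_lerch_integral[OF op]) (use \<mu> slit_plane_minus_nonpos in \<open>auto intro!: holomorphic_intros\<close>)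
    have 3: "(\<lambda>v. lerch_integral 1 1 (1 - \<mu>) (- inverse v)) holomorphic_on - \<real>\<^sub>\<le>\<^sub>0"
      by (rule holomorphic_lerch_integral[OF op])
         (use \<mu> slit_plane_minus_nonpos inverse_nonpos_Reals in \<open>auto intro!: holomorphic_intros\<close>)
    show "f holomorphic_on - \<real>\<^sub>\<le>\<^sub>0" unfolding f_def
      by (intro holomorphic_intros 2 3) auto
    show "f (of_real x) = 0" if "x > 0" for x
      using beta_lerch_pos[OF \<mu> that] by (simp add: f_def divide_inverse)
  qed (use v in \<open>auto simp: open_Compl connected_minus_nonpos_Reals closed_nonpos_Reals_complex\<close>)
  thus ?thesis by (simp add: f_def)
qed

section \<open>The functional equation in the open strips\<close>

definition expi :: "complex \<Rightarrow> complex" where "expi x = exp (2 * of_real pi * \<i> * x)"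

lemma expi_nonzero [simp]: "expi x \<noteq> 0" by (simp add: expi_def)
lemma expi_add: "expi (x + y) = expi x * expi y" by (simp add: expi_def ring_distribs exp_add)
lemma expi_diff: "expi (x - y) = expi x / expi y" by (simp add: expi_def ring_distribs exp_diff)
lemma expi_minus: "expi (- x) = inverse (expi x)" by (simp add: expi_def exp_minus)
lemma expi_1 [simp]: "expi 1 = 1" by (simp add: expi_def exp_eq_1)
lemma norm_expi: "norm (expi x) = exp (- 2 * pi * Im x)" by (simp add: expi_def)

lemma expi_eq_minus_exp: "- expi a = exp (2 * of_real pi * \<i> * (a - 1 / 2))"
proof -
  have "2 * of_real pi * \<i> * (a - 1 / 2) = 2 * of_real pi * \<i> * a - of_real pi * \<i>"
    by (simp add: algebra_simps)
  thus ?thesis by (simp add: expi_def exp_diff)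
qed

lemma Ln_minus_expi:
  assumes "0 < Re a" "Re a \<le> 1"
  shows "Ln (- expi a) = 2 * of_real pi * \<i> * (a - 1 / 2)"
  unfolding expi_eq_minus_exp
proof (rule Ln_exp)
  have "Im (2 * of_real pi * \<i> * (a - 1 / 2)) = pi * (2 * Re a - 1)" by (simp add: algebra_simps)
  moreover have "pi * (2 * Re a - 1) > pi * (-1)" using assms by (intro mult_strict_left_mono) auto
  moreover have "pi * (2 * Re a - 1) \<le> pi * 1" using assms by (intro mult_left_mono) auto
  ultimately show "- pi < Im (2 * of_real pi * \<i> * (a - 1 / 2))" "Im (2 * of_real pi * \<i> * (a - 1 / 2)) \<le> pi" by linarith+
qed

lemma minus_expi_not_nonpos:
  assumes "0 < Re a" "Re a < 1" shows "- expi a \<notin> \<real>\<^sub>\<le>\<^sub>0"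
proof
  assume *: "- expi a \<in> \<real>\<^sub>\<le>\<^sub>0"
  have "Im (Ln (- expi a)) = pi"
  proof -
    have "Re (expi a) \<noteq> 0 \<or> Im (expi a) \<noteq> 0"
      using expi_nonzero[of a] unfolding complex_eq_iff by simp
    thus ?thesis using * by (subst Im_Ln_eq_pi) (auto simp: complex_nonpos_Reals_iff less_le)
  qed
  moreover have "Im (Ln (- expi a)) = pi * (2 * Re a - 1)"
  proof -
    have "Im (Ln (- expi a)) = Im (2 * of_real pi * \<i> * (a - 1 / 2))"
      using Ln_minus_expi[of a] assms by simp
    thus ?thesis by (simp add: algebra_simps)
  qed
  moreover have "pi * (2 * Re a - 1) < pi * 1" using assms by (intro mult_strict_left_mono) auto
  ultimately show False by simp
qed

lemma expi_slit: "0 < Re a \<Longrightarrow> Re a < 1 \<Longrightarrow> expi a \<in> slit_plane"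
  using slit_plane_minus_nonpos[OF minus_expi_not_nonpos] by simp

text \<open>
  The factor \<open>exp (- \<epsilon> x)\<close> makes the double integral absolutely convergent. Without it the inner
  integral over \<open>x\<close> would not converge absolutely.
\<close>

lemma oscillatory_fubini:
  fixes h :: "real \<Rightarrow> complex" and \<eta> \<epsilon> :: real
  assumes s: "0 < Re s" "Re s < 1" and h: "integrable hline h" and \<epsilon>: "\<epsilon> > 0"
  defines "F \<equiv> \<lambda>x. of_real x powr (- s) * exp (- of_real (\<epsilon> * x)) * (\<integral>y. h y * exp (\<i> * of_real (\<eta> * x * y)) \<partial>hline)"
  shows "integrable hline F"
    and "(\<integral>x. F x \<partial>hline) = Gamma (1 - s) * (\<integral>y. h y * (of_real \<epsilon> - \<i> * of_real (\<eta> * y)) powr (s - 1) \<partial>hline)"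
proof -
  interpret pair_sigma_finite hline hline by (rule pair_sigma_finite_hline)
  define f where "f = (\<lambda>(x, y). complex_of_real x powr (- s) * exp (- of_real (\<epsilon> * x)) * (h y * exp (\<i> * of_real (\<eta> * x * y))))"
  have m1: "(\<lambda>x. complex_of_real x powr (- s) * exp (- of_real (\<epsilon> * x))) \<in> borel_measurable hline"
    by (intro measurable_hline continuous_intros) auto
  have m2 [measurable]: "(\<lambda>x::real. x) \<in> borel_measurable hline"
    by (intro measurable_hline continuous_intros)
  have m3 [measurable]: "exp \<in> borel_measurable (borel :: complex measure)"
    by (intro borel_measurable_continuous_onI continuous_intros)
  have m4 [measurable]: "h \<in> borel_measurable hline" using h by (rule borel_measurable_integrable)
  have mf: "f \<in> borel_measurable (hline \<Otimes>\<^sub>M hline)"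
    unfolding f_def case_prod_unfold using m1 by measurable
  have nf: "norm (f (x, y)) = x powr ((1 - Re s) - 1) * exp (- (\<epsilon> * x)) * norm (h y)" if "x > 0" for x y
    using that by (simp add: f_def norm_mult norm_powr_real_powr)
  have int: "integrable (hline \<Otimes>\<^sub>M hline) f"
  proof (rule Fubini_integrable[OF mf])
    have "integrable hline (\<lambda>x. x powr ((1 - Re s) - 1) * exp (- (\<epsilon> * x)) * (\<integral>y. norm (h y) \<partial>hline))"
      by (intro integrable_mult_left integrable_real_gamma) (use s \<epsilon> in auto)
    also have "?this \<longleftrightarrow> integrable hline (\<lambda>x. \<integral>y. norm (f (x, y)) \<partial>hline)"
      by (intro Bochner_Integration.integrable_cong) (auto simp: nf)
    finally show "integrable hline (\<lambda>x. \<integral>y. norm (f (x, y)) \<partial>hline)" .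
    have "integrable hline (\<lambda>y. f (x, y))" for x
    proof -
      have "integrable hline (\<lambda>y. h y * exp (\<i> * of_real (\<eta> * x * y)))"
        by (rule Bochner_Integration.integrable_bound[OF h]) (auto simp: norm_mult)
      thus ?thesis unfolding f_def by simp
    qed
    thus "AE x in hline. integrable hline (\<lambda>y. f (x, y))" by simp
  qed
  have F: "F x = (\<integral>y. f (x, y) \<partial>hline)" for x
    by (simp add: F_def f_def)
  show "integrable hline F"
    using integrable_fst'[OF int] by (simp add: F[abs_def])
  have "(\<integral>x. F x \<partial>hline) = (\<integral>y. \<integral>x. f (x, y) \<partial>hline \<partial>hline)"
    using Fubini_integral[of "\<lambda>x y. f (x, y)"] int by (simp add: F)
  also have "\<dots> = (\<integral>y. Gamma (1 - s) * (h y * (of_real \<epsilon> - \<i> * of_real (\<eta> * y)) powr (s - 1)) \<partial>hline)"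
  proof (rule Bochner_Integration.integral_cong[OF refl])
    fix y
    define c where "c = of_real \<epsilon> - \<i> * of_real (\<eta> * y)"
    have c: "Re c > 0" using \<epsilon> by (simp add: c_def)
    have "(\<integral>x. f (x, y) \<partial>hline) = (\<integral>x. h y * (of_real x powr ((1 - s) - 1) * exp (- (c * of_real x))) \<partial>hline)"
      by (intro Bochner_Integration.integral_cong) (auto simp: f_def c_def ring_distribs mult_ac simp flip: exp_add)
    also have "\<dots> = h y * (Gamma (1 - s) / c powr (1 - s))"
      using Gamma_integral_complex_rate[OF _ c, of "1 - s"] s by simp
    also have "\<dots> = Gamma (1 - s) * (h y * c powr (s - 1))"
      using c powr_minus[of c "1 - s"] by (simp add: divide_inverse)
    finally show "(\<integral>x. f (x, y) \<partial>hline) = Gamma (1 - s) * (h y * (of_real \<epsilon> - \<i> * of_real (\<eta> * y)) powr (s - 1))"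
      by (simp add: c_def)
  qed
  finally show "(\<integral>x. F x \<partial>hline) = Gamma (1 - s) * (\<integral>y. h y * (of_real \<epsilon> - \<i> * of_real (\<eta> * y)) powr (s - 1) \<partial>hline)"
    by simp
qed

text \<open>
  Since \<open>Re s < 1\<close> and \<open>|\<epsilon> - \<i> \<eta> y| \<ge> |\<eta> y|\<close>, the limit integrand is, up to a constant,
  a majorant.
\<close>

lemma oscillatory_limit:
  fixes h :: "real \<Rightarrow> complex" and \<eta> :: real
  assumes s: "0 < Re s" "Re s < 1" and h: "integrable hline h" and \<eta>: "\<eta> \<noteq> 0"
    and hs: "integrable hline (\<lambda>y. of_real y powr (s - 1) * h y)"
  shows "(\<lambda>n. \<integral>y. h y * (of_real (inverse (Suc n)) - \<i> * of_real (\<eta> * y)) powr (s - 1) \<partial>hline)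
    \<longlonglongrightarrow> (- \<i> * of_real \<eta>) powr (s - 1) * (\<integral>y. of_real y powr (s - 1) * h y \<partial>hline)"
proof -
  let ?g = "\<lambda>n y. h y * (of_real (inverse (Suc n)) - \<i> * of_real (\<eta> * y)) powr (s - 1)"
  define w where "w y = \<bar>\<eta>\<bar> powr (Re s - 1) * exp (pi * norm (s - 1)) * norm (of_real y powr (s - 1) * h y)" for y
  have lim: "(\<lambda>n. ?g n y)
      \<longlonglongrightarrow> (- \<i> * of_real \<eta>) powr (s - 1) * (of_real y powr (s - 1) * h y)" if y: "y > 0" for y
  proof -
    have "(\<lambda>n. complex_of_real (inverse (Suc n))) \<longlonglongrightarrow> of_real 0"
      by (intro tendsto_of_real LIMSEQ_inverse_real_of_nat)
    hence "(\<lambda>n. ?g n y)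
      \<longlonglongrightarrow> h y * (of_real 0 - \<i> * of_real (\<eta> * y)) powr (s - 1)"
      using y \<eta> by (intro tendsto_mult tendsto_const tendsto_powr_complex tendsto_diff) (auto simp: complex_nonpos_Reals_iff)
    also have "of_real 0 - \<i> * of_real (\<eta> * y) = of_real y * (- \<i> * of_real \<eta>)" by simp
    also have "(of_real y * (- \<i> * of_real \<eta>)) powr (s - 1) = of_real y powr (s - 1) * (- \<i> * of_real \<eta>) powr (s - 1)"
      using y by (intro powr_times_real_left) auto
    finally show ?thesis by (simp only: mult_ac)
  qed
  have "(\<lambda>n. \<integral>y. ?g n y \<partial>hline)
    \<longlonglongrightarrow> (\<integral>y. (- \<i> * of_real \<eta>) powr (s - 1) * (of_real y powr (s - 1) * h y) \<partial>hline)"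
  proof (rule integral_dominated_convergence[where w = w])
    show "(\<lambda>y. (- \<i> * of_real \<eta>) powr (s - 1) * (of_real y powr (s - 1) * h y)) \<in> borel_measurable hline"
      using borel_measurable_integrable[OF hs] by simp
    have "(\<lambda>y. (of_real (inverse (Suc n)) - \<i> * of_real (\<eta> * y)) powr (s - 1)) \<in> borel_measurable hline" for n
      using \<eta> by (intro measurable_hline continuous_intros) (auto simp: complex_nonpos_Reals_iff)
    thus "(\<lambda>y. ?g n y) \<in> borel_measurable hline" for n
      using borel_measurable_integrable[OF h] by simp
    show "integrable hline w" unfolding w_def by (intro integrable_mult_right integrable_norm hs)
    show "AE y in hline. (\<lambda>n. ?g n y)
        \<longlonglongrightarrow> (- \<i> * of_real \<eta>) powr (s - 1) * (of_real y powr (s - 1) * h y)"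
      by (rule AE_I2) (use lim in simp)
    have "norm (?g n y) \<le> w y" if y: "y > 0" for n y
    proof -
      define c where "c = of_real (inverse (Suc n)) - \<i> * of_real (\<eta> * y)"
      have c: "norm c \<ge> \<bar>\<eta> * y\<bar>" using abs_Im_le_cmod[of c] by (simp add: c_def)
      have p: "\<bar>\<eta> * y\<bar> > 0" using \<eta> y by simp
      have "norm (c powr (s - 1)) \<le> norm c powr Re (s - 1) * exp (pi * norm (s - 1))"
        using c p by (intro norm_powr_bound) auto
      also have "norm c powr Re (s - 1) \<le> \<bar>\<eta> * y\<bar> powr Re (s - 1)"
        using c p s by (intro powr_mono2') auto
      also have "\<bar>\<eta> * y\<bar> powr Re (s - 1) = \<bar>\<eta>\<bar> powr (Re s - 1) * y powr (Re s - 1)"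
        using y by (simp add: abs_mult powr_mult)
      finally have "norm (c powr (s - 1)) \<le> \<bar>\<eta>\<bar> powr (Re s - 1) * y powr (Re s - 1) * exp (pi * norm (s - 1))"
        by simp
      hence "norm (h y) * norm (c powr (s - 1)) \<le> norm (h y) * (\<bar>\<eta>\<bar> powr (Re s - 1) * y powr (Re s - 1) * exp (pi * norm (s - 1)))"
        by (rule mult_left_mono) simp
      also have "\<dots> = w y" using y by (simp add: w_def norm_mult norm_powr_real_powr)
      finally show ?thesis by (simp add: norm_mult c_def)
    qed
    thus "AE y in hline. norm (?g n y) \<le> w y" for n
      by (intro AE_I2) simp
  qed
  thus ?thesis by simp
qed

text \<open>
  This is the expansion of \<open>1 / (1 - e(-\<mu>))\<close> into partial fractions, each half of it summed into an
  integral. It is also the functional equation for \<open>s = 1\<close>. The product \<open>\<Gamma>(\<mu>) \<Gamma>(1 - \<mu>)\<close> in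
  \<open>beta_lerch\<close> supplies the sine.
\<close>

lemma exp_over_one_minus_eq_lerch:
  assumes \<mu>: "0 < Re \<mu>" "Re \<mu> < 1" and a: "0 < Re a" "Re a < 1"
  shows "lerch_integral 1 1 \<mu> (expi a) - expi (- a) * lerch_integral 1 1 (1 - \<mu>) (expi (- a))
    = 2 * of_real pi * \<i> * expi (- (a * \<mu>)) / (1 - expi (- \<mu>))"
proof -
  define E where "E = exp (of_real pi * \<i> * \<mu>)"
  have E2: "E * E = expi \<mu>" by (simp add: E_def expi_def mult_ac flip: exp_add)
  have E0: "E \<noteq> 0" by (simp add: E_def)
  have one: "expi \<mu> \<noteq> 1"
    using expi_slit[OF \<mu>] by (auto simp: slit_plane_iff)
  have "lerch_integral 1 1 \<mu> (expi a) - expi (- a) * lerch_integral 1 1 (1 - \<mu>) (expi (- a))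
      = Gamma \<mu> * Gamma (1 - \<mu>) / (- expi a) powr \<mu>"
    using beta_lerch[OF \<mu> minus_expi_not_nonpos[OF a]] by (simp add: expi_minus field_simps)
  also have "(- expi a) powr \<mu> = expi (a * \<mu>) / E"
  proof -
    have "(- expi a) powr \<mu> = exp (\<mu> * (2 * of_real pi * \<i> * (a - 1 / 2)))"
      using a Ln_minus_expi[of a] by (simp add: powr_def)
    also have "\<mu> * (2 * of_real pi * \<i> * (a - 1 / 2)) = 2 * of_real pi * \<i> * (a * \<mu>) - of_real pi * \<i> * \<mu>"
      by (simp add: algebra_simps)
    finally show ?thesis by (simp add: expi_def E_def exp_diff)
  qed
  also have "Gamma \<mu> * Gamma (1 - \<mu>) = of_real pi / sin (of_real pi * \<mu>)" by (rule Gamma_reflection_complex)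
  also have "sin (of_real pi * \<mu>) = (E - inverse E) / (2 * \<i>)"
    by (simp add: sin_exp_eq E_def exp_minus mult_ac)
  also have "of_real pi / ((E - inverse E) / (2 * \<i>)) / (expi (a * \<mu>) / E) = 2 * of_real pi * \<i> * inverse (expi (a * \<mu>)) / (1 - inverse (E * E))"
    using E0 one unfolding E2[symmetric] by (simp add: divide_simps)
  finally show ?thesis by (simp add: E2 expi_minus)
qed

text \<open>
  For \<open>x > 0\<close> take \<open>\<mu> = m - \<i> x / (2 \<pi>)\<close> in the partial fraction formula, so that
  \<open>e(-\<mu>) = e(-m) exp (- x)\<close>. Its left side is then an oscillatory integral over \<open>y\<close>, and the Mellin
  transform over \<open>x\<close> can be carried out first. The regularizing factor shifts \<open>a\<close> to \<open>a + \<epsilon>\<close>.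
\<close>

lemma lerch_functional_eq_strip:
  assumes s: "0 < Re s" "Re s < 1" and a: "0 < Re a" "Re a < 1" and m: "0 < Re m" "Re m < 1"
  shows "lerch_integral 1 (1 - s) a (expi (- m)) = expi (a * m) / (2 * of_real pi * \<i>) * Gamma (1 - s) *
     ((- \<i> * of_real (1 / (2 * pi))) powr (s - 1) * lerch_integral 1 s m (expi a)
      - expi (- a) * ((\<i> * of_real (1 / (2 * pi))) powr (s - 1) * lerch_integral 1 s (1 - m) (expi (- a))))"
proof -
  have slm: "expi (- m) \<in> slit_plane"
    using expi_slit[of "1 - m"] m by (simp add: expi_diff expi_minus divide_inverse)
  have sla: "expi a \<in> slit_plane" by (rule expi_slit[OF a])
  have sla': "expi (- a) \<in> slit_plane"
    using expi_slit[of "1 - a"] a by (simp add: expi_diff expi_minus divide_inverse)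
  define \<eta> where "\<eta> = 1 / (2 * pi)"
  define C where "C = expi (a * m) / (2 * of_real pi * \<i>)"
  define h1 where "h1 = lerch_integrand 1 1 m (expi a)"
  define h2 where "h2 = lerch_integrand 1 1 (1 - m) (expi (- a))"
  have h1: "integrable hline h1" unfolding h1_def by (rule integrable_lerch_integrand) (use m sla in auto)
  have h2: "integrable hline h2" unfolding h2_def by (rule integrable_lerch_integrand) (use m sla' in auto)
  have hs1: "of_real y powr (s - 1) * h1 y = lerch_integrand 1 s m (expi a) y" if "y > 0" for y
    using that by (simp add: h1_def lerch_integrand_def)
  have hs2: "of_real y powr (s - 1) * h2 y = lerch_integrand 1 s (1 - m) (expi (- a)) y" if "y > 0" for y
    using that by (simp add: h2_def lerch_integrand_def)
  have ihs1: "integrable hline (\<lambda>y. of_real y powr (s - 1) * h1 y)"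
    by (rule iffD1[OF Bochner_Integration.integrable_cong[OF refl] integrable_lerch_integrand[of s m "expi a" 1]])
       (use hs1 s m sla in auto)
  have ihs2: "integrable hline (\<lambda>y. of_real y powr (s - 1) * h2 y)"
    by (rule iffD1[OF Bochner_Integration.integrable_cong[OF refl] integrable_lerch_integrand[of s "1 - m" "expi (- a)" 1]])
       (use hs2 s m sla' in auto)
  define F where "F \<eta> h \<epsilon> x = of_real x powr (- s) * exp (- of_real (\<epsilon> * x)) * (\<integral>y. h y * exp (\<i> * of_real (\<eta> * x * y)) \<partial>hline)"
    for \<eta> h \<epsilon> x
  have pf: "lerch_integrand 1 (1 - s) (a + of_real \<epsilon>) (expi (- m)) x = C * (F \<eta> h1 \<epsilon> x - expi (- a) * F (- \<eta>) h2 \<epsilon> x)"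
    if x: "x > 0" for \<epsilon> x
  proof -
    define \<mu> where "\<mu> = m - \<i> * of_real (\<eta> * x)"
    have \<mu>: "0 < Re \<mu>" "Re \<mu> < 1" using m by (simp_all add: \<mu>_def)
    have pi\<eta>: "complex_of_real pi * of_real \<eta> = 1 / 2" by (simp add: \<eta>_def)
    have 1: "lerch_integral 1 1 \<mu> (expi a) = (\<integral>y. h1 y * exp (\<i> * of_real (\<eta> * x * y)) \<partial>hline)"
      unfolding lerch_integral_def h1_def lerch_integrand_def
      by (intro Bochner_Integration.integral_cong) (auto simp: \<mu>_def algebra_simps exp_add exp_diff exp_minus field_simps)
    have 2: "lerch_integral 1 1 (1 - \<mu>) (expi (- a)) = (\<integral>y. h2 y * exp (\<i> * of_real (- \<eta> * x * y)) \<partial>hline)"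
      unfolding lerch_integral_def h2_def lerch_integrand_def
      by (intro Bochner_Integration.integral_cong) (auto simp: \<mu>_def algebra_simps exp_add exp_diff exp_minus field_simps)
    have e1: "expi (- \<mu>) = expi (- m) * exp (- of_real x)"
    proof -
      have "2 * of_real pi * \<i> * (- \<mu>) = 2 * of_real pi * \<i> * (- m) + (\<i> * \<i>) * 2 * (of_real pi * of_real \<eta>) * of_real x"
        by (simp add: \<mu>_def algebra_simps)
      also have "\<dots> = 2 * of_real pi * \<i> * (- m) + - of_real x" unfolding pi\<eta> by simp
      finally show ?thesis unfolding expi_def by (simp only: exp_add)
    qed
    have e2: "expi (- (a * \<mu>)) * expi (a * m) = exp (- (a * of_real x))"
    proof -
      have "2 * of_real pi * \<i> * (- (a * \<mu>)) + 2 * of_real pi * \<i> * (a * m) = (\<i> * \<i>) * 2 * (of_real pi * of_real \<eta>) * a * of_real x"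
        by (simp add: \<mu>_def algebra_simps)
      also have "\<dots> = - (a * of_real x)" unfolding pi\<eta> by simp
      finally show ?thesis unfolding expi_def by (simp only: exp_add[symmetric])
    qed
    have "C * (2 * of_real pi * \<i> * expi (- (a * \<mu>)) / (1 - expi (- \<mu>))) = exp (- (a * of_real x)) / (1 - expi (- m) * exp (- of_real x))"
    proof -
      have "C * (2 * of_real pi * \<i>) = expi (a * m)" by (simp add: C_def)
      thus ?thesis unfolding e2[symmetric] e1
        by (simp only: times_divide_eq_right mult.assoc[symmetric] mult.commute[of "expi (a * m)"])
    qed
    hence g: "exp (- (a * of_real x)) / (1 - expi (- m) * exp (- of_real x)) =
        C * ((\<integral>y. h1 y * exp (\<i> * of_real (\<eta> * x * y)) \<partial>hline) - expi (- a) * (\<integral>y. h2 y * exp (\<i> * of_real (- \<eta> * x * y)) \<partial>hline))"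
      unfolding 1[symmetric] 2[symmetric] exp_over_one_minus_eq_lerch[OF \<mu> a] by simp
    have "lerch_integrand 1 (1 - s) (a + of_real \<epsilon>) (expi (- m)) x
        = of_real x powr (- s) * exp (- of_real (\<epsilon> * x)) * (exp (- (a * of_real x)) / (1 - expi (- m) * exp (- of_real x)))"
      by (simp add: lerch_integrand_def ring_distribs exp_diff exp_minus field_simps exp_add)
    thus ?thesis unfolding g F_def by (simp add: algebra_simps)
  qed
  have eq: "lerch_integral 1 (1 - s) (a + of_real \<epsilon>) (expi (- m)) = C * Gamma (1 - s) *
      ((\<integral>y. h1 y * (of_real \<epsilon> - \<i> * of_real (\<eta> * y)) powr (s - 1) \<partial>hline)
       - expi (- a) * (\<integral>y. h2 y * (of_real \<epsilon> - \<i> * of_real (- \<eta> * y)) powr (s - 1) \<partial>hline))" if \<epsilon>: "\<epsilon> > 0" for \<epsilon>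
  proof -
    note f1 = oscillatory_fubini[OF s h1 \<epsilon>, of \<eta>, folded F_def]
    note f2 = oscillatory_fubini[OF s h2 \<epsilon>, of "- \<eta>", folded F_def]
    have "lerch_integral 1 (1 - s) (a + of_real \<epsilon>) (expi (- m)) = (\<integral>x. C * (F \<eta> h1 \<epsilon> x - expi (- a) * F (- \<eta>) h2 \<epsilon> x) \<partial>hline)"
      unfolding lerch_integral_def by (intro Bochner_Integration.integral_cong refl pf) simp
    also have "\<dots> = C * ((\<integral>x. F \<eta> h1 \<epsilon> x \<partial>hline) - expi (- a) * (\<integral>x. F (- \<eta>) h2 \<epsilon> x \<partial>hline))"
      using f1(1) f2(1) by simp
    finally show ?thesis unfolding f1(2) f2(2) by (simp add: algebra_simps)
  qed
  have \<eta>: "\<eta> \<noteq> 0" "- \<eta> \<noteq> 0" by (simp_all add: \<eta>_def)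
  have lim1: "(\<lambda>n. lerch_integral 1 (1 - s) (a + of_real (inverse (Suc n))) (expi (- m))) \<longlonglongrightarrow>
      C * Gamma (1 - s) * ((- \<i> * of_real \<eta>) powr (s - 1) * (\<integral>y. of_real y powr (s - 1) * h1 y \<partial>hline)
       - expi (- a) * ((- \<i> * of_real (- \<eta>)) powr (s - 1) * (\<integral>y. of_real y powr (s - 1) * h2 y \<partial>hline)))"
    by (subst eq, simp, intro tendsto_intros oscillatory_limit s h1 h2 ihs1 ihs2 \<eta>)
  have "continuous_on {a. Re a > 0} (\<lambda>a. lerch_integral 1 (1 - s) a (expi (- m)))"
    by (intro holomorphic_on_imp_continuous_on holomorphic_lerch_integral)
       (use s slm in \<open>auto intro: holomorphic_intros simp: open_halfspace_Re_gt\<close>)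
  hence "isCont (\<lambda>a. lerch_integral 1 (1 - s) a (expi (- m))) a"
    using a by (simp add: continuous_on_eq_continuous_at open_halfspace_Re_gt)
  moreover have "(\<lambda>n. a + of_real (inverse (Suc n))) \<longlonglongrightarrow> a + of_real 0"
    by (intro tendsto_intros LIMSEQ_inverse_real_of_nat)
  ultimately have lim2: "(\<lambda>n. lerch_integral 1 (1 - s) (a + of_real (inverse (Suc n))) (expi (- m))) \<longlonglongrightarrow>
     lerch_integral 1 (1 - s) a (expi (- m))"
    by (intro isCont_tendsto_compose[where g = "\<lambda>a. lerch_integral 1 (1 - s) a (expi (- m))"]) simp_all
  have "(\<integral>y. of_real y powr (s - 1) * h1 y \<partial>hline) = lerch_integral 1 s m (expi a)"
    unfolding lerch_integral_def by (intro Bochner_Integration.integral_cong) (auto simp: hs1)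
  moreover have "(\<integral>y. of_real y powr (s - 1) * h2 y \<partial>hline) = lerch_integral 1 s (1 - m) (expi (- a))"
    unfolding lerch_integral_def by (intro Bochner_Integration.integral_cong) (auto simp: hs2)
  ultimately show ?thesis
    using LIMSEQ_unique[OF lim2 lim1] by (simp add: C_def \<eta>_def)
qed

text \<open>
  The factors \<open>(2 \<pi>) powr (1 - s) * exp (\<minusplus> \<pi> \<i> (s - 1) / 2)\<close>, in the form in which they arise from
  rotating the Mellin integral onto the imaginary axis.
\<close>

definition rotm :: "complex \<Rightarrow> complex" where "rotm s = (- \<i> * of_real (1 / (2 * pi))) powr (s - 1)"
definition rotp :: "complex \<Rightarrow> complex" where "rotp s = (\<i> * of_real (1 / (2 * pi))) powr (s - 1)"

text \<open>
  The right side of the functional equation, divided by \<open>\<Gamma>(s)\<close>. The values \<open>P\<close> and \<open>Q\<close> of the two Lerch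
  functions are arguments, because they are obtained from \<open>lerch_cont\<close>, from the series, as
  boundary values or from the Hurwitz zeta function in different cases.
\<close>

definition lerch_dual :: "complex \<Rightarrow> complex \<Rightarrow> complex \<Rightarrow> complex \<Rightarrow> complex \<Rightarrow> complex" where
  "lerch_dual s a m P Q = expi (a * m) / (2 * of_real pi * \<i>) * (rotm s * P - expi (- a) * (rotp s * Q))"

lemma rGamma_Gamma: "Re s > 0 \<Longrightarrow> rGamma s * Gamma s = (1 :: complex)"
  by (subst rGamma_inverse_Gamma, intro left_inverse) (auto simp: Gamma_eq_zero_iff elim!: nonpos_Ints_cases)

lemma expi_minus_slit: "0 < Re m \<Longrightarrow> Re m < 1 \<Longrightarrow> expi (- m) \<in> slit_plane"
  using expi_slit[of "1 - m"] by (simp add: expi_diff expi_minus divide_inverse)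

text \<open>
  Both sides are entire in \<open>s\<close>.
\<close>

lemma lerch_functional_eq:
  assumes a: "0 < Re a" "Re a < 1" and m: "0 < Re m" "Re m < 1"
  shows "rGamma s * lerch_cont (1 - s) a (expi (- m)) =
    lerch_dual s a m (lerch_cont s m (expi a)) (lerch_cont s (1 - m) (expi (- a)))"
proof (rule analytic_continuation_open[where s = "{s. Re s > 0} \<inter> {s. Re s < 1}" and s' = UNIV
    and f = "\<lambda>s. rGamma s * lerch_cont (1 - s) a (expi (- m))"
    and g = "\<lambda>s. lerch_dual s a m (lerch_cont s m (expi a)) (lerch_cont s (1 - m) (expi (- a)))"])
  note sl = expi_minus_slit[OF m] expi_slit[OF a] expi_minus_slit[OF a]
  have "(\<lambda>s. lerch_cont (1 - s) a (expi (- m))) holomorphic_on UNIV"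
    by (rule holomorphic_lerch_cont) (use a sl in \<open>auto intro: holomorphic_intros\<close>)
  thus "(\<lambda>s. rGamma s * lerch_cont (1 - s) a (expi (- m))) holomorphic_on UNIV"
    by (intro holomorphic_intros) auto
  have "(\<lambda>s. lerch_cont s m (expi a)) holomorphic_on UNIV" "(\<lambda>s. lerch_cont s (1 - m) (expi (- a))) holomorphic_on UNIV"
    using holomorphic_lerch_cont_s m sl by auto
  thus "(\<lambda>s. lerch_dual s a m (lerch_cont s m (expi a)) (lerch_cont s (1 - m) (expi (- a)))) holomorphic_on UNIV"
    unfolding lerch_dual_def rotm_def rotp_def by (intro holomorphic_intros) auto
  show "open ({s::complex. Re s > 0} \<inter> {s. Re s < 1})"
    by (intro open_Int open_halfspace_Re_gt open_halfspace_Re_lt)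
  have "(1 / 2 :: complex) \<in> {s. Re s > 0} \<inter> {s. Re s < 1}" by simp
  thus "{s::complex. Re s > 0} \<inter> {s. Re s < 1} \<noteq> {}" by blast
  fix s :: complex assume "s \<in> {s. Re s > 0} \<inter> {s. Re s < 1}"
  hence s: "0 < Re s" "Re s < 1" by auto
  define G where "G = Gamma s"
  define H where "H = Gamma (1 - s)"
  have G: "rGamma s * G = 1" "rGamma (1 - s) * H = 1" using rGamma_Gamma[of s] rGamma_Gamma[of "1 - s"] s by (simp_all add: G_def H_def)
  have L: "lerch_cont (1 - s) a (expi (- m)) = rGamma (1 - s) * lerch_integral 1 (1 - s) a (expi (- m))"
    "lerch_cont s m (expi a) = rGamma s * lerch_integral 1 s m (expi a)"
    "lerch_cont s (1 - m) (expi (- a)) = rGamma s * lerch_integral 1 s (1 - m) (expi (- a))"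
    using s a m sl by (simp_all add: lerch_cont_eq_integral)
  show "rGamma s * lerch_cont (1 - s) a (expi (- m)) =
    lerch_dual s a m (lerch_cont s m (expi a)) (lerch_cont s (1 - m) (expi (- a)))"
  proof -
    have "rGamma s * (rGamma (1 - s) * (K * H * (p * I1 - e * (q * I2)))) = K * (p * (rGamma s * I1) - e * (q * (rGamma s * I2)))"
      for K p I1 e q I2
    proof -
      have "rGamma s * (rGamma (1 - s) * (K * H * (p * I1 - e * (q * I2)))) =
          (rGamma (1 - s) * H) * (K * (p * (rGamma s * I1) - e * (q * (rGamma s * I2))))"
        by (simp add: algebra_simps)
      thus ?thesis by (simp add: G(2))
    qed
    thus ?thesis unfolding L lerch_functional_eq_strip[OF s a m] lerch_dual_def rotm_def rotp_def H_def[symmetric] by (simp only:)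
  qed
qed auto

section \<open>Induction along shifts of the parameter\<close>

lemma nonpos_Ints_plus_1: "a \<notin> \<int>\<^sub>\<le>\<^sub>0 \<Longrightarrow> a + 1 \<notin> (\<int>\<^sub>\<le>\<^sub>0 :: complex set)"
proof
  assume "a \<notin> \<int>\<^sub>\<le>\<^sub>0" "a + 1 \<in> \<int>\<^sub>\<le>\<^sub>0"
  then obtain n where "a + 1 = of_int n" "n \<le> 0" by (auto elim: nonpos_Ints_cases)
  hence "a = of_int (n - 1)" by (simp add: algebra_simps)
  thus False using \<open>a \<notin> \<int>\<^sub>\<le>\<^sub>0\<close> \<open>n \<le> 0\<close> by (metis nonpos_Ints_of_int diff_le_eq add_increasing2 zero_le_one order.trans)
qed

lemma Re_pos_not_nonpos_Ints: "Re a > 0 \<Longrightarrow> a \<notin> \<int>\<^sub>\<le>\<^sub>0"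
  by (auto elim!: nonpos_Ints_cases)

lemma shift_induct [consumes 1, case_names pos step]:
  assumes "a \<notin> \<int>\<^sub>\<le>\<^sub>0"
    and pos: "\<And>a. Re a > 0 \<Longrightarrow> P a"
    and step: "\<And>a. a \<notin> \<int>\<^sub>\<le>\<^sub>0 \<Longrightarrow> P (a + 1) \<Longrightarrow> P a"
  shows "P (a :: complex)"
proof -
  obtain n :: nat where "- Re a < real n" using reals_Archimedean2 by blast
  thus ?thesis using assms(1)
  proof (induction n arbitrary: a)
    case 0
    thus ?case using pos by simp
  next
    case (Suc n)
    have "P (a + 1)" using Suc by (intro Suc.IH nonpos_Ints_plus_1) auto
    thus ?case using step Suc.prems by blast
  qed
qed

text \<open>
  Boundary values are first known for \<open>0 < Re a < 2\<close> only. Since \<open>\<Phi>(z, s, a)\<close> and \<open>\<Phi>(z, s, a + 1)\<close>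
  determine each other, this strip suffices.
\<close>

lemma shift_induct_strip [consumes 1, case_names strip down up]:
  assumes "a \<notin> \<int>\<^sub>\<le>\<^sub>0"
    and strip: "\<And>a. 0 < Re a \<Longrightarrow> Re a < 2 \<Longrightarrow> P a"
    and down: "\<And>a. a \<notin> \<int>\<^sub>\<le>\<^sub>0 \<Longrightarrow> P (a + 1) \<Longrightarrow> P a"
    and up: "\<And>a. a \<notin> \<int>\<^sub>\<le>\<^sub>0 \<Longrightarrow> P a \<Longrightarrow> P (a + 1)"
  shows "P (a :: complex)"
  using assms(1)
proof (induction rule: shift_induct)
  case (pos a)
  obtain n :: nat where "Re a < real n" using reals_Archimedean2 by blast
  thus ?case using pos
  proof (induction n arbitrary: a)
    case (Suc n)
    show ?case
    proof (cases "Re a < 2")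
      case False
      have "P (a - 1)" using Suc.prems False by (intro Suc.IH) auto
      thus ?thesis using up[of "a - 1"] False Re_pos_not_nonpos_Ints[of "a - 1"] by simp
    qed (use Suc strip in auto)
  qed simp
qed (use down in blast)

section \<open>The series on the closed unit disc\<close>

text \<open>
  For \<open>Re a > 0\<close> one has \<open>|a + n| \<ge> n\<close>, so that the majorant does not depend on \<open>a\<close>.
\<close>

lemma lerch_term_p_series:
  assumes a: "Re a > 0" and s: "\<sigma> \<le> Re s" "norm s \<le> R" and z: "norm z \<le> 1" and n: "n \<ge> 1" and \<sigma>: "\<sigma> > 0"
  shows "norm (lerch_term z s a n) \<le> exp (pi * R) * real n powr (- \<sigma>)"
proof -
  have n1: "real n \<le> norm (a + of_nat n)" using norm_add_of_nat_ge[OF a] .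
  have nz: "a + of_nat n \<noteq> 0" using n1 n by auto
  have "norm (lerch_term z s a n) \<le> norm z ^ n * (norm (a + of_nat n) powr (- Re s) * exp (pi * norm s))"
    by (rule norm_lerch_term[OF nz])
  also have "\<dots> \<le> 1 * (real n powr (- \<sigma>) * exp (pi * R))"
  proof (intro mult_mono)
    have "norm (a + of_nat n) powr (- Re s) \<le> norm (a + of_nat n) powr (- \<sigma>)"
      using n1 n s by (intro powr_mono) auto
    also have "\<dots> \<le> real n powr (- \<sigma>)" using n1 n \<sigma> by (intro powr_mono2') auto
    finally show "norm (a + of_nat n) powr (- Re s) \<le> real n powr (- \<sigma>)" .
  qed (use z s in \<open>auto intro: power_le_one\<close>)
  finally show ?thesis by (simp add: mult_ac)
qed

lemma summable_p_series: "\<sigma> > 1 \<Longrightarrow> summable (\<lambda>n. C * real n powr (- \<sigma>))"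
  by (intro summable_mult) (simp add: summable_real_powr_iff)

lemma continuous_on_suminf_M:
  fixes f :: "nat \<Rightarrow> complex \<Rightarrow> complex"
  assumes "\<And>n. continuous_on K (f n)" "summable M" "\<forall>\<^sub>F n in sequentially. \<forall>y\<in>K. norm (f n y) \<le> M n"
  shows "continuous_on K (\<lambda>x. \<Sum>n. f n x)"
proof (rule uniform_limit_theorem)
  show "uniform_limit K (\<lambda>n x. \<Sum>i<n. f i x) (\<lambda>x. \<Sum>n. f n x) sequentially"
    by (rule Weierstrass_m_test_ev[OF assms(3,2)])
  show "\<forall>\<^sub>F n in sequentially. continuous_on K (\<lambda>x. \<Sum>i<n. f i x)"
    by (intro always_eventually allI continuous_on_sum assms(1))
qed auto

lemma lerch_term_le_ev:
  assumes s: "Re s > 1"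
  shows "\<forall>\<^sub>F n in sequentially. \<forall>a z. Re a > 0 \<longrightarrow> norm z \<le> 1 \<longrightarrow>
    norm (lerch_term z s a n) \<le> exp (pi * norm s) * real n powr (- Re s)"
  using eventually_ge_at_top[of 1]
  by eventually_elim (use s in \<open>auto intro!: lerch_term_p_series\<close>)

lemma add_of_nat_nonzero: "Re a > 0 \<Longrightarrow> a + of_nat n \<noteq> 0"
  by (auto simp: complex_eq_iff)

lemma continuous_on_lerch_series_z:
  assumes "Re s > 1" "Re a > 0"
  shows "continuous_on (cball 0 1) (\<lambda>z. lerch_series z s a)"
  unfolding lerch_series_def
proof (rule continuous_on_suminf_M)
  show "summable (\<lambda>n. exp (pi * norm s) * real n powr (- Re s))" by (rule summable_p_series[OF assms(1)])
  show "\<forall>\<^sub>F n in sequentially. \<forall>z\<in>cball 0 1. norm (lerch_term z s a n) \<le> exp (pi * norm s) * real n powr (- Re s)"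
    using lerch_term_le_ev[OF assms(1)] by eventually_elim (use assms(2) in auto)
qed (intro continuous_intros, use add_of_nat_nonzero[OF assms(2)] in auto)

lemma continuous_on_lerch_series_a:
  assumes "Re s > 1"
  shows "continuous_on {a. Re a > 0} (\<lambda>a. lerch_series 1 s a)"
  unfolding lerch_series_def
proof (rule continuous_on_suminf_M)
  show "summable (\<lambda>n. exp (pi * norm s) * real n powr (- Re s))" by (rule summable_p_series[OF assms(1)])
  show "\<forall>\<^sub>F n in sequentially. \<forall>a\<in>{a. Re a > 0}. norm (lerch_term 1 s a n) \<le> exp (pi * norm s) * real n powr (- Re s)"
    using lerch_term_le_ev[OF assms(1)]
  proof eventually_elim
    case (elim n)
    show ?case using elim[rule_format, of _ 1] by simp
  qed
  have nn: "a + of_nat n \<notin> \<real>\<^sub>\<le>\<^sub>0" "(a + of_nat n) powr s \<noteq> 0" if "Re a > 0" for a n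
    using add_of_nat_nonzero[OF that, of n] that by (auto simp: complex_nonpos_Reals_iff)
  show "continuous_on {a. Re a > 0} (\<lambda>a. lerch_term 1 s a n)" for n
    by (intro continuous_intros) (use nn in auto)
qed

lemma holomorphic_lerch_series_1:
  assumes a: "Re a > 0"
  shows "(\<lambda>s. lerch_series 1 s a) holomorphic_on {s. Re s > 1}"
  unfolding lerch_series_def
proof (rule holomorphic_on_suminf)
  show "(\<lambda>s. lerch_term 1 s a n) holomorphic_on {s. Re s > 1}" for n
    by (intro holomorphic_intros) (auto simp: add_of_nat_nonzero[OF a])
  fix s :: complex assume "s \<in> {s. Re s > 1}"
  hence s: "Re s > 1" by simp
  define d where "d = (Re s - 1) / 2"
  define \<sigma> where "\<sigma> = Re s - d"
  have d: "d > 0" "\<sigma> > 1" using s by (auto simp: d_def \<sigma>_def field_simps)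
  have cb: "\<sigma> \<le> Re t \<and> norm t \<le> norm s + d" if "t \<in> cball s d" for t
    using that abs_Re_le_cmod[of "s - t"] norm_triangle_ineq2[of t s]
    by (auto simp: dist_norm \<sigma>_def norm_minus_commute)
  have "\<forall>\<^sub>F n in sequentially. \<forall>t\<in>cball s d. norm (lerch_term 1 t a n) \<le> exp (pi * (norm s + d)) * real n powr (- \<sigma>)"
    using eventually_ge_at_top[of 1]
  proof eventually_elim
    case (elim n)
    show ?case
      by (intro ballI lerch_term_p_series a) (use cb d elim in auto)
  qed
  moreover have "cball s d \<subseteq> {s. Re s > 1}" using cb d by force
  moreover have "summable (\<lambda>n. exp (pi * (norm s + d)) * real n powr (- \<sigma>))" by (rule summable_p_series[OF d(2)])
  ultimately show "\<exists>d>0. \<exists>M. cball s d \<subseteq> {s. Re s > 1} \<and> summable M \<and>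
     (\<forall>\<^sub>F n in sequentially. \<forall>y\<in>cball s d. norm (lerch_term 1 y a n) \<le> M n)"
    using d(1) by blast
qed (simp add: open_halfspace_Re_gt)

definition series_region :: "complex \<Rightarrow> complex \<Rightarrow> bool" where
  "series_region z s \<longleftrightarrow> norm z < 1 \<or> norm z = 1 \<and> Re s > 1"

lemma summable_lerch:
  assumes "a \<notin> \<int>\<^sub>\<le>\<^sub>0" "series_region z s"
  shows "summable (\<lambda>n. lerch_term z s a n)"
  using assms(1)
proof (induction rule: shift_induct)
  case (pos a)
  show ?case
  proof (cases "norm z < 1")
    case True
    show ?thesis using summable_lerch_disc[OF pos True] by (rule summable_norm_cancel)
  next
    case False
    hence s: "Re s > 1" "norm z \<le> 1" using assms(2) by (auto simp: series_region_def)
    have "\<forall>\<^sub>F n in sequentially. norm (lerch_term z s a n) \<le> exp (pi * norm s) * real n powr (- Re s)"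
      using lerch_term_le_ev[OF s(1)] by eventually_elim (use pos s in auto)
    thus ?thesis by (rule summable_comparison_test_ev[OF _ summable_p_series[OF s(1)]])
  qed
next
  case (step a)
  have "summable (\<lambda>n. z * (z ^ n / (a + 1 + of_nat n) powr s))" by (intro summable_mult step)
  also have "(\<lambda>n. z * (z ^ n / (a + 1 + of_nat n) powr s)) = (\<lambda>n. z ^ Suc n / (a + of_nat (Suc n)) powr s)"
    by (simp add: add_ac)
  finally show ?case by (subst (asm) summable_Suc_iff)
qed

lemma lerch_series_shift:
  assumes "a \<notin> \<int>\<^sub>\<le>\<^sub>0" "series_region z s"
  shows "lerch_series z s a = 1 / a powr s + z * lerch_series z s (a + 1)"
proof -
  have "lerch_series z s a = z ^ 0 / (a + of_nat 0) powr s + (\<Sum>n. z ^ Suc n / (a + of_nat (Suc n)) powr s)"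
    unfolding lerch_series_def using suminf_split_head[OF summable_lerch[OF assms]] by simp
  also have "(\<lambda>n. z ^ Suc n / (a + of_nat (Suc n)) powr s) = (\<lambda>n. z * (z ^ n / (a + 1 + of_nat n) powr s))"
    by (simp add: add_ac)
  also have "(\<Sum>n. z * (z ^ n / (a + 1 + of_nat n) powr s)) = z * lerch_series z s (a + 1)"
    unfolding lerch_series_def
    by (intro suminf_mult summable_lerch nonpos_Ints_plus_1 assms)
  finally show ?thesis by simp
qed

lemma powr_double: "(2 * c) powr s = 2 powr s * c powr (s :: complex)"
  by (rule powr_times_real_left) auto

text \<open>
  The terms with odd index cancel.
\<close>

lemma lerch_series_duplication:
  assumes a: "Re a > 0" and z: "series_region z s"
  shows "lerch_series z s a + lerch_series (- z) s a = 2 / 2 powr s * lerch_series (z ^ 2) s (a / 2)"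
proof -
  have an: "a \<notin> \<int>\<^sub>\<le>\<^sub>0" "a / 2 \<notin> \<int>\<^sub>\<le>\<^sub>0" using a by (auto intro!: Re_pos_not_nonpos_Ints)
  have reg: "series_region (- z) s" "series_region (z ^ 2) s"
    using z by (auto simp: series_region_def norm_power power_less_one_iff)
  define f where "f n = lerch_term z s a n + (- z) ^ n / (a + of_nat n) powr s" for n
  have "f sums (lerch_series z s a + lerch_series (- z) s a)"
    unfolding f_def lerch_series_def
    by (intro sums_add summable_sums summable_lerch an z reg)
  hence "(\<lambda>n. f (2 * n)) sums (lerch_series z s a + lerch_series (- z) s a)"
  proof (subst sums_mono_reindex)
    show "strict_mono (\<lambda>n::nat. 2 * n)" by (auto simp: strict_mono_def)
    fix n :: nat assume "n \<notin> range (\<lambda>n. 2 * n)"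
    hence "odd n" by (auto elim!: evenE)
    thus "f n = 0" by (simp add: f_def)
  qed
  moreover have "f (2 * n) = 2 / 2 powr s * ((z ^ 2) ^ n / (a / 2 + of_nat n) powr s)" for n
  proof -
    have "a + of_nat (2 * n) = 2 * (a / 2 + of_nat n)" by simp
    hence "(a + of_nat (2 * n)) powr s = 2 powr s * (a / 2 + of_nat n) powr s" by (simp only: powr_double)
    thus ?thesis by (simp add: f_def power_mult)
  qed
  moreover have "(\<lambda>n. 2 / 2 powr s * ((z ^ 2) ^ n / (a / 2 + of_nat n) powr s)) sums (2 / 2 powr s * lerch_series (z ^ 2) s (a / 2))"
    unfolding lerch_series_def by (intro sums_mult summable_sums summable_lerch an reg)
  ultimately show ?thesis by (auto intro: sums_unique2)
qed

section \<open>The continuation to the slit plane\<close>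

lemma connected_slit_plane: "connected slit_plane"
  unfolding slit_plane_def by (intro starlike_imp_connected starlike_slotted_complex_plane_right)

lemma lerch_slit_exists:
  assumes "a \<notin> \<int>\<^sub>\<le>\<^sub>0"
  shows "\<exists>F. F holomorphic_on slit_plane \<and> (\<forall>z. norm z < 1 \<longrightarrow> F z = lerch_series z s a)"
  using assms
proof (induction rule: shift_induct)
  case (pos a)
  thus ?case using holomorphic_lerch_cont_z[OF pos] lerch_cont_eq_series[OF pos] by blast
next
  case (step a)
  then obtain F where F: "F holomorphic_on slit_plane" "\<And>z. norm z < 1 \<Longrightarrow> F z = lerch_series z s (a + 1)" by blast
  have "(\<lambda>z. 1 / a powr s + z * F z) holomorphic_on slit_plane"
    by (intro holomorphic_intros F) (use step in auto)
  moreover have "1 / a powr s + z * F z = lerch_series z s a" if "norm z < 1" for z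
    using lerch_series_shift[OF step(1), of z s] F(2) that by (simp add: series_region_def)
  ultimately show ?case by blast
qed

lemma
  assumes "a \<notin> \<int>\<^sub>\<le>\<^sub>0"
  shows holomorphic_lerch_slit: "lerch_slit s a holomorphic_on slit_plane"
    and lerch_slit_eq_series: "norm z < 1 \<Longrightarrow> lerch_slit s a z = lerch_series z s a"
proof -
  have "lerch_slit s a holomorphic_on slit_plane \<and> (\<forall>z. norm z < 1 \<longrightarrow> lerch_slit s a z = lerch_series z s a)"
    unfolding lerch_slit_def slit_plane_def[symmetric] by (rule someI_ex[OF lerch_slit_exists[OF assms]])
  thus "lerch_slit s a holomorphic_on slit_plane" "norm z < 1 \<Longrightarrow> lerch_slit s a z = lerch_series z s a" by auto
qed

lemma lerch_slit_unique:
  assumes "a \<notin> \<int>\<^sub>\<le>\<^sub>0" "F holomorphic_on slit_plane" "\<And>z. norm z < 1 \<Longrightarrow> F z = lerch_series z s a" "z \<in> slit_plane"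
  shows "lerch_slit s a z = F z"
proof (rule analytic_continuation_open[where s = "ball 0 1" and s' = slit_plane and f = "lerch_slit s a" and g = F])
  show "lerch_slit s a w = F w" if "w \<in> ball 0 1" for w
    using that assms(3) lerch_slit_eq_series[OF assms(1)] by simp
  show "ball 0 1 \<subseteq> slit_plane" using norm_less_1_slit by auto
qed (use assms holomorphic_lerch_slit open_slit_plane connected_slit_plane in auto)

lemma lerch_slit_eq_cont: "Re a > 0 \<Longrightarrow> z \<in> slit_plane \<Longrightarrow> lerch_slit s a z = lerch_cont s a z"
  by (rule lerch_slit_unique[OF Re_pos_not_nonpos_Ints]) (auto intro: holomorphic_lerch_cont_z lerch_cont_eq_series)

lemma lerch_slit_shift:
  assumes "a \<notin> \<int>\<^sub>\<le>\<^sub>0" "z \<in> slit_plane"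
  shows "lerch_slit s a z = 1 / a powr s + z * lerch_slit s (a + 1) z"
proof (rule lerch_slit_unique[OF assms(1) _ _ assms(2)])
  have a1: "a + 1 \<notin> \<int>\<^sub>\<le>\<^sub>0" by (rule nonpos_Ints_plus_1[OF assms(1)])
  show "(\<lambda>z. 1 / a powr s + z * lerch_slit s (a + 1) z) holomorphic_on slit_plane"
    by (intro holomorphic_intros holomorphic_lerch_slit a1) (use assms in auto)
  show "1 / a powr s + z * lerch_slit s (a + 1) z = lerch_series z s a" if "norm z < 1" for z
    using lerch_series_shift[OF assms(1), of z s] lerch_slit_eq_series[OF a1 that] that by (simp add: series_region_def)
qed

text \<open>
  Abel's theorem, for \<open>Re s > 1\<close> a consequence of uniform convergence on the closed disc.
\<close>

lemma lerch_series_eq_slit: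
  assumes "a \<notin> \<int>\<^sub>\<le>\<^sub>0" "series_region z s" "z \<in> slit_plane"
  shows "lerch_series z s a = lerch_slit s a z"
  using assms(1)
proof (induction rule: shift_induct)
  case (pos a)
  have a: "a \<notin> \<int>\<^sub>\<le>\<^sub>0" using pos by (rule Re_pos_not_nonpos_Ints)
  show ?case
  proof (cases "norm z < 1")
    case False
    hence z: "Re s > 1" "norm z = 1" using assms(2) by (auto simp: series_region_def)
    define r where "r n = complex_of_real (real n / real (Suc n)) * z" for n
    have rl: "r \<longlonglongrightarrow> z"
      unfolding r_def using tendsto_mult[OF tendsto_of_real[OF LIMSEQ_n_over_Suc_n, where 'a = complex] tendsto_const[of z]]
      by simp
    have r1: "norm (r n) < 1" for n unfolding r_def norm_mult norm_of_real z(2) by simp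
    have "(\<lambda>n. lerch_series (r n) s a) \<longlonglongrightarrow> lerch_series z s a"
      using r1 z by (intro continuous_on_tendsto_compose[OF continuous_on_lerch_series_z[OF z(1) pos] rl])
        (auto intro!: always_eventually less_imp_le)
    moreover have "(\<lambda>n. lerch_slit s a (r n)) \<longlonglongrightarrow> lerch_slit s a z"
      by (intro continuous_on_tendsto_compose[OF holomorphic_on_imp_continuous_on[OF holomorphic_lerch_slit[OF a]] rl])
        (auto intro!: always_eventually norm_less_1_slit assms r1)
    moreover have "lerch_series (r n) s a = lerch_slit s a (r n)" for n
      using lerch_slit_eq_series[OF a r1] by simp
    ultimately show ?thesis by (simp add: LIMSEQ_unique)
  qed (use lerch_slit_eq_series[OF a] in auto)
next
  case (step a)
  thus ?case using lerch_series_shift[OF step(1) assms(2)] lerch_slit_shift[OF step(1) assms(3)] by simp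
qed

lemma lerch_phi_slit:
  assumes "a \<notin> \<int>\<^sub>\<le>\<^sub>0" "z \<in> slit_plane"
  shows "lerch_phi z s a = lerch_slit s a z"
proof -
  have "z \<noteq> 1" "z \<notin> complex_of_real ` {1<..}" using assms(2) by (auto simp: slit_plane_iff)
  thus ?thesis using lerch_series_eq_slit[OF assms(1) _ assms(2), of s]
    unfolding lerch_phi_def series_region_def by auto
qed

text \<open>
  The formula holds in the disc, and the union of the disc with the lower half-plane is connected
  and mapped into the slit plane by each of \<open>z\<close>, \<open>- z\<close> and \<open>z ^ 2\<close>.
\<close>

lemma lerch_cont_duplication:
  assumes a: "Re a > 0" and z: "Im z < 0"
  shows "lerch_cont s a z + lerch_cont s a (- z) = 2 / 2 powr s * lerch_cont s (a / 2) (z ^ 2)"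
proof -
  define D where "D = {z. Im z < 0} \<union> ball (0::complex) 1"
  have sl: "z \<in> slit_plane" "- z \<in> slit_plane" "z ^ 2 \<in> slit_plane" if "z \<in> D" for z
  proof -
    have "z \<in> slit_plane \<and> - z \<in> slit_plane \<and> z ^ 2 \<in> slit_plane"
    proof (cases "norm z < 1")
      case True
      thus ?thesis by (auto intro!: norm_less_1_slit simp: norm_power power_less_one_iff)
    next
      case False
      hence "Im z < 0" using that by (auto simp: D_def)
      thus ?thesis by (auto simp: slit_plane_iff power2_eq_square) (smt (verit) mult_neg_neg)
    qed
    thus "z \<in> slit_plane" "- z \<in> slit_plane" "z ^ 2 \<in> slit_plane" by auto
  qed
  note h = holomorphic_lerch_cont_z[OF a, of s]
  have a2: "Re (a / 2) > 0" using a by simp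
  show ?thesis
  proof (rule analytic_continuation_open[where s = "ball 0 1" and s' = D
      and f = "\<lambda>z. lerch_cont s a z + lerch_cont s a (- z)" and g = "\<lambda>z. 2 / 2 powr s * lerch_cont s (a / 2) (z ^ 2)"])
    show D: "open D" unfolding D_def by (intro open_Un open_halfspace_Im_lt open_ball)
    have "{z. Im z < 0} \<inter> ball (0::complex) 1 \<noteq> {}"
    proof -
      have "- \<i> / 2 \<in> {z. Im z < 0} \<inter> ball (0::complex) 1" by (simp add: norm_divide)
      thus ?thesis by blast
    qed
    thus "connected D" unfolding D_def
      by (intro connected_Un convex_connected convex_halfspace_Im_lt convex_ball)
    have 1: "(\<lambda>z. lerch_cont s a z) holomorphic_on D" using h sl holomorphic_on_subset by blast
    have 2: "(\<lambda>z. lerch_cont s a (- z)) holomorphic_on D"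
      by (rule holomorphic_lerch_cont) (use D a sl in \<open>auto intro!: holomorphic_intros\<close>)
    have 3: "(\<lambda>z. lerch_cont s (a / 2) (z ^ 2)) holomorphic_on D"
      by (rule holomorphic_lerch_cont) (use D a sl in \<open>auto intro!: holomorphic_intros\<close>)
    show "(\<lambda>z. lerch_cont s a z + lerch_cont s a (- z)) holomorphic_on D" by (intro holomorphic_intros 1 2)
    show "(\<lambda>z. 2 / 2 powr s * lerch_cont s (a / 2) (z ^ 2)) holomorphic_on D" by (intro holomorphic_intros 3) auto
    fix z :: complex assume "z \<in> ball 0 1"
    hence z: "norm z < 1" "norm (- z) < 1" "norm (z ^ 2) < 1" by (auto simp: norm_power power_less_one_iff)
    show "lerch_cont s a z + lerch_cont s a (- z) = 2 / 2 powr s * lerch_cont s (a / 2) (z ^ 2)"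
      using lerch_series_duplication[OF a, of z s] z by (simp add: lerch_cont_eq_series a a2 series_region_def)
  qed (use z in \<open>auto simp: D_def\<close>)
qed

section \<open>Continuity of the ingredients\<close>

abbreviation below :: "complex \<Rightarrow> complex filter" where
  "below x \<equiv> at x within {w. Im w < 0}"

lemma rotm_nonzero [simp]: "rotm s \<noteq> 0" and rotp_nonzero [simp]: "rotp s \<noteq> 0"
  by (auto simp: rotm_def rotp_def)

abbreviation open_strip :: "real \<Rightarrow> complex set" where
  "open_strip c \<equiv> {m. 0 < Re m \<and> Re m < c}"

lemma isCont_lerch_cont_a: "Re a > 0 \<Longrightarrow> z \<in> slit_plane \<Longrightarrow> isCont (\<lambda>a. lerch_cont s a z) a"
  using holomorphic_on_imp_continuous_on[OF holomorphic_lerch_cont_a, of z s]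
  by (auto simp: continuous_on_eq_continuous_at open_halfspace_Re_gt)

lemma isCont_lerch_cont_z: "Re a > 0 \<Longrightarrow> z \<in> slit_plane \<Longrightarrow> isCont (\<lambda>z. lerch_cont s a z) z"
  using holomorphic_on_imp_continuous_on[OF holomorphic_lerch_cont_z, of a s]
  by (auto simp: continuous_on_eq_continuous_at open_slit_plane)

lemma isCont_expi [continuous_intros]: "isCont f x \<Longrightarrow> isCont (\<lambda>x. expi (f x)) x"
  unfolding expi_def by (intro continuous_intros)

lemma tendsto_expi [tendsto_intros]: "(f \<longlongrightarrow> l) F \<Longrightarrow> ((\<lambda>x. expi (f x)) \<longlongrightarrow> expi l) F"
  unfolding expi_def by (intro tendsto_intros)

lemma tendsto_lerch_dual:
  assumes "(a \<longlongrightarrow> a0) F" "(m \<longlongrightarrow> m0) F" "(P \<longlongrightarrow> P0) F" "(Q \<longlongrightarrow> Q0) F"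
  shows "((\<lambda>n. lerch_dual s (a n) (m n) (P n) (Q n)) \<longlongrightarrow> lerch_dual s a0 m0 P0 Q0) F"
  unfolding lerch_dual_def by (intro tendsto_intros assms) auto

section \<open>Boundary values on the cut\<close>

text \<open>
  A parameter \<open>a\<close> with \<open>e(a) = w\<close>. The branch is chosen such that the lower half-plane corresponds to
  \<open>1 / 2 < Re a < 1\<close>, and the approach to the cut from below to \<open>Re a \<rightarrow> 1\<close>.
\<close>

definition log_param :: "complex \<Rightarrow> complex" where "log_param w = 1 + Ln w / (2 * of_real pi * \<i>)"

lemma expi_log_param: "w \<noteq> 0 \<Longrightarrow> expi (log_param w) = w"
  by (simp add: log_param_def expi_add) (simp add: expi_def)

lemma Re_log_param: "Re (log_param w) = 1 + Im (Ln w) / (2 * pi)"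
  by (simp add: log_param_def complex_eq_iff Re_divide Im_divide power2_eq_square field_simps)

lemma Re_log_param_below: assumes "Im w < 0" shows "0 < Re (log_param w)" "Re (log_param w) < 1"
proof -
  have w: "w \<noteq> 0" using assms by auto
  have "\<not> (0 \<le> Im (Ln w) \<and> Im (Ln w) \<le> pi)" using Im_Ln_pos_le[OF w] assms by simp
  hence "- pi < Im (Ln w)" "Im (Ln w) < 0" using mpi_less_Im_Ln[OF w] Im_Ln_le_pi[OF w] by auto
  thus "0 < Re (log_param w)" "Re (log_param w) < 1" unfolding Re_log_param by (auto simp: field_simps)
qed

text \<open>
  The functional equation with \<open>a = log_param w\<close>, solved for \<open>\<Phi>(w, s, m)\<close>. On the right only values off the
  cut remain, even when \<open>w\<close> lies on it.
\<close>

definition cut_value_strip :: "complex \<Rightarrow> complex \<Rightarrow> complex \<Rightarrow> complex" where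
  "cut_value_strip s w m = (rGamma s * lerch_cont (1 - s) (log_param w) (expi (- m)) * (2 * of_real pi * \<i>) / expi (log_param w * m)
     + inverse w * (rotp s * lerch_cont s (1 - m) (inverse w))) / rotm s"

lemma cut_value_strip_eq:
  assumes w: "Im w < 0" and m: "0 < Re m" "Re m < 1"
  shows "lerch_cont s m w = cut_value_strip s w m"
proof -
  have w0: "w \<noteq> 0" using w by auto
  have e: "expi (log_param w) = w" "expi (- log_param w) = inverse w" using expi_log_param[OF w0] by (auto simp: expi_minus)
  have "rGamma s * lerch_cont (1 - s) (log_param w) (expi (- m)) = expi (log_param w * m) / (2 * of_real pi * \<i>) *
      (rotm s * lerch_cont s m w - inverse w * (rotp s * lerch_cont s (1 - m) (inverse w)))"
    using lerch_functional_eq[OF Re_log_param_below[OF w] m, of s] unfolding e lerch_dual_def .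
  thus ?thesis unfolding cut_value_strip_def by simp
qed

context
  fixes x :: real assumes x: "x > 1"
begin

lemma inverse_slit: "inverse (complex_of_real x) \<in> slit_plane"
  using x by (auto simp: slit_plane_iff field_simps simp flip: of_real_inverse)

lemma Re_log_param_real: "Re (log_param (of_real x)) = 1"
  using x by (simp add: Re_log_param Ln_of_real)

lemma tendsto_cut_value_strip:
  assumes m: "0 < Re m" "Re m < 1"
  shows "(lerch_cont s m \<longlongrightarrow> cut_value_strip s (of_real x) m) (below (of_real x))"
proof -
  have sl: "expi (- m) \<in> slit_plane" by (rule expi_minus_slit[OF m])
  have "isCont (\<lambda>w. lerch_cont (1 - s) (log_param w) (expi (- m))) (of_real x)"
  proof (rule isCont_o2[where g = "\<lambda>a. lerch_cont (1 - s) a (expi (- m))"])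
    show "isCont log_param (of_real x)" unfolding log_param_def using x by (intro continuous_intros) auto
    show "isCont (\<lambda>a. lerch_cont (1 - s) a (expi (- m))) (log_param (of_real x))"
      by (rule isCont_lerch_cont_a[OF _ sl]) (simp add: Re_log_param_real)
  qed
  moreover have "isCont (\<lambda>w. lerch_cont s (1 - m) (inverse w)) (of_real x)"
    by (rule isCont_o2[where g = "\<lambda>z. lerch_cont s (1 - m) z"])
       (use m x inverse_slit in \<open>auto intro!: continuous_intros isCont_lerch_cont_z\<close>)
  moreover have "isCont log_param (of_real x)" unfolding log_param_def using x by (intro continuous_intros) auto
  ultimately have "isCont (\<lambda>w. cut_value_strip s w m) (of_real x)"
    unfolding cut_value_strip_def using x by (intro continuous_intros) auto
  hence "((\<lambda>w. cut_value_strip s w m) \<longlongrightarrow> cut_value_strip s (of_real x) m) (below (of_real x))"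
    unfolding isCont_def by (rule tendsto_within_subset[where S = UNIV, simplified])
  thus ?thesis
    by (rule Lim_transform_eventually) (auto simp: eventually_at_filter cut_value_strip_eq m intro!: always_eventually)
qed

lemma continuous_on_cut_value_strip: "continuous_on (open_strip 1) (cut_value_strip s (of_real x))"
proof -
  have "isCont (cut_value_strip s (of_real x)) m" if m: "0 < Re m" "Re m < 1" for m
  proof -
    have "isCont (\<lambda>m. lerch_cont (1 - s) (log_param (of_real x)) (expi (- m))) m"
      by (rule isCont_o2[where g = "\<lambda>z. lerch_cont (1 - s) (log_param (of_real x)) z"])
         (use Re_log_param_real in \<open>auto intro!: continuous_intros isCont_lerch_cont_z expi_minus_slit m\<close>)
    moreover have "isCont (\<lambda>m. lerch_cont s (1 - m) (inverse (of_real x))) m"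
      by (rule isCont_o2[where g = "\<lambda>a. lerch_cont s a (inverse (of_real x))"])
         (use m inverse_slit in \<open>auto intro!: continuous_intros isCont_lerch_cont_a\<close>)
    ultimately show ?thesis unfolding cut_value_strip_def by (intro continuous_intros) auto
  qed
  thus ?thesis by (intro continuous_at_imp_continuous_on) auto
qed

end

text \<open>
  The duplication formula, as a continuation of \<open>cut_value_strip\<close> in \<open>m\<close> across the line \<open>Re m = 1\<close>.
\<close>

definition cut_value :: "complex \<Rightarrow> complex \<Rightarrow> complex \<Rightarrow> complex" where
  "cut_value s w m = 2 / 2 powr s * cut_value_strip s (w ^ 2) (m / 2) - lerch_cont s m (- w)"

lemma minus_real_slit: "x > 1 \<Longrightarrow> - complex_of_real x \<in> slit_plane"
  by (auto simp: slit_plane_iff)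

lemma tendsto_cut_value:
  assumes x: "x > 1" and m: "0 < Re m" "Re m < 2"
  shows "(lerch_slit s m \<longlongrightarrow> cut_value s (of_real x) m) (below (of_real x))"
proof -
  have x2: "x ^ 2 > 1" using x by (simp add: one_less_power)
  have "filterlim (\<lambda>w. w ^ 2) (below (of_real (x ^ 2))) (below (of_real x))"
    unfolding filterlim_at
  proof
    have "((\<lambda>w. w ^ 2) \<longlongrightarrow> of_real x ^ 2) (below (of_real x))" by (intro tendsto_intros)
    thus "((\<lambda>w. w ^ 2) \<longlongrightarrow> of_real (x ^ 2)) (below (of_real x))" by simp
    have "(Re \<longlongrightarrow> Re (of_real x)) (below (of_real x))" by (intro tendsto_intros)
    hence "\<forall>\<^sub>F w in below (of_real x). Re w > 0" by (rule order_tendstoD) (use x in simp)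
    moreover have "\<forall>\<^sub>F w in below (of_real x). Im w < 0" by (simp add: eventually_at_filter)
    ultimately show "\<forall>\<^sub>F w in below (of_real x). w ^ 2 \<in> {w. Im w < 0} \<and> w ^ 2 \<noteq> of_real (x ^ 2)"
    proof eventually_elim
      case (elim w)
      have "Im (w ^ 2) < 0" using elim by (simp add: power2_eq_square mult_pos_neg mult_neg_pos add_neg_neg)
      thus ?case by (auto simp del: of_real_power)
    qed
  qed
  moreover have "(lerch_cont s (m / 2) \<longlongrightarrow> cut_value_strip s (of_real (x ^ 2)) (m / 2)) (below (of_real (x ^ 2)))"
    by (rule tendsto_cut_value_strip[OF x2]) (use m in auto)
  ultimately have 1: "((\<lambda>w. lerch_cont s (m / 2) (w ^ 2)) \<longlongrightarrow> cut_value_strip s (of_real (x ^ 2)) (m / 2)) (below (of_real x))"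
    by (rule filterlim_compose[rotated])
  have "isCont (\<lambda>w. lerch_cont s m (- w)) (of_real x)"
    by (rule isCont_o2[where g = "\<lambda>z. lerch_cont s m z"])
       (use m minus_real_slit[OF x] in \<open>auto intro!: continuous_intros isCont_lerch_cont_z\<close>)
  hence 2: "((\<lambda>w. lerch_cont s m (- w)) \<longlongrightarrow> lerch_cont s m (- of_real x)) (below (of_real x))"
    unfolding isCont_def by (rule tendsto_within_subset[where S = UNIV, simplified])
  have "((\<lambda>w. 2 / 2 powr s * lerch_cont s (m / 2) (w ^ 2) - lerch_cont s m (- w)) \<longlongrightarrow> cut_value s (of_real x) m) (below (of_real x))"
    unfolding cut_value_def using tendsto_diff[OF tendsto_mult[OF tendsto_const[of "2 / 2 powr s"] 1] 2]
    unfolding of_real_power .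
  moreover have "\<forall>\<^sub>F w in below (of_real x). 2 / 2 powr s * lerch_cont s (m / 2) (w ^ 2) - lerch_cont s m (- w) = lerch_slit s m w"
  proof -
    have "2 / 2 powr s * lerch_cont s (m / 2) (w ^ 2) - lerch_cont s m (- w) = lerch_slit s m w" if "Im w < 0" for w
      using lerch_cont_duplication[OF m(1) that, of s] lerch_slit_eq_cont[OF m(1), of w s] that
      by (simp add: slit_plane_iff algebra_simps)
    thus ?thesis by (auto simp: eventually_at_filter intro!: always_eventually)
  qed
  ultimately show ?thesis by (rule Lim_transform_eventually)
qed

lemma continuous_on_cut_value:
  assumes x: "x > 1" shows "continuous_on (open_strip 2) (cut_value s (of_real x))"
proof -
  have x2: "x ^ 2 > 1" using x by (simp add: one_less_power)
  have 1: "continuous_on (open_strip 2) (\<lambda>m. cut_value_strip s (of_real (x ^ 2)) (m / 2))"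
    by (rule continuous_on_compose2[OF continuous_on_cut_value_strip[OF x2]]) (auto intro!: continuous_intros)
  have 2: "continuous_on (open_strip 2) (\<lambda>m. lerch_cont s m (- of_real x))"
    by (rule continuous_on_subset[OF holomorphic_on_imp_continuous_on[OF holomorphic_lerch_cont_a[OF minus_real_slit[OF x]]]]) auto
  show ?thesis unfolding cut_value_def using 1 2 by (auto intro!: continuous_intros)
qed

lemma below_nontrivial: "Im x = 0 \<Longrightarrow> below x \<noteq> bot"
proof -
  assume "Im x = 0"
  have "x islimpt {w. Im w < 0}"
    unfolding islimpt_approachable
  proof (intro allI impI)
    fix e :: real assume "e > 0"
    thus "\<exists>x'\<in>{w. Im w < 0}. x' \<noteq> x \<and> dist x' x < e"
      by (intro bexI[of _ "x - \<i> * of_real (e / 2)"]) (auto simp: dist_norm norm_mult \<open>Im x = 0\<close>)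
  qed
  thus ?thesis by (simp add: trivial_limit_within)
qed

lemma lerch_phi_cut:
  assumes "x > 1" "(lerch_slit s a \<longlongrightarrow> l) (below (of_real x))"
  shows "lerch_phi (of_real x) s a = l"
  using assms tendsto_Lim[OF below_nontrivial assms(2)] by (auto simp: lerch_phi_def)

lemma eventually_below_slit: "\<forall>\<^sub>F w in below x. w \<in> slit_plane"
  by (auto simp: eventually_at_filter slit_plane_iff intro!: always_eventually)

lemma tendsto_lerch_phi_cut:
  assumes a: "a \<notin> \<int>\<^sub>\<le>\<^sub>0" and x: "x > 1"
  shows "(lerch_slit s a \<longlongrightarrow> lerch_phi (of_real x) s a) (below (of_real x))"
proof -
  have "\<exists>l. (lerch_slit s a \<longlongrightarrow> l) (below (of_real x))"
    using a
  proof (induction rule: shift_induct_strip)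
    case (strip a)
    thus ?case using tendsto_cut_value[OF x] by blast
  next
    case (down a)
    then obtain l where "(lerch_slit s (a + 1) \<longlongrightarrow> l) (below (of_real x))" by blast
    hence "((\<lambda>w. 1 / a powr s + w * lerch_slit s (a + 1) w) \<longlongrightarrow> 1 / a powr s + of_real x * l) (below (of_real x))"
      by (intro tendsto_intros)
    hence "(lerch_slit s a \<longlongrightarrow> 1 / a powr s + of_real x * l) (below (of_real x))"
      by (rule Lim_transform_eventually)
         (use eventually_below_slit in eventually_elim, use lerch_slit_shift[OF down(1)] in simp)
    thus ?case by blast
  next
    case (up a)
    then obtain l where "(lerch_slit s a \<longlongrightarrow> l) (below (of_real x))" by blast
    hence "((\<lambda>w. (lerch_slit s a w - 1 / a powr s) / w) \<longlongrightarrow> (l - 1 / a powr s) / of_real x) (below (of_real x))"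
      using x by (intro tendsto_intros) auto
    moreover have "\<forall>\<^sub>F w in below (of_real x). (lerch_slit s a w - 1 / a powr s) / w = lerch_slit s (a + 1) w"
    proof -
      have "(lerch_slit s a w - 1 / a powr s) / w = lerch_slit s (a + 1) w" if "Im w < 0" for w
        using lerch_slit_shift[OF up(1), of w s] that by (auto simp: slit_plane_iff)
      thus ?thesis by (auto simp: eventually_at_filter intro!: always_eventually)
    qed
    ultimately show ?case by (blast intro: Lim_transform_eventually)
  qed
  thus ?thesis using lerch_phi_cut[OF x] by blast
qed

lemma lerch_phi_shift_cut:
  assumes a: "a \<notin> \<int>\<^sub>\<le>\<^sub>0" and x: "x > 1"
  shows "lerch_phi (of_real x) s a = 1 / a powr s + of_real x * lerch_phi (of_real x) s (a + 1)"
proof (rule lerch_phi_cut[OF x])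
  have "((\<lambda>w. 1 / a powr s + w * lerch_slit s (a + 1) w) \<longlongrightarrow> 1 / a powr s + of_real x * lerch_phi (of_real x) s (a + 1)) (below (of_real x))"
    by (intro tendsto_intros tendsto_lerch_phi_cut nonpos_Ints_plus_1 a x)
  thus "(lerch_slit s a \<longlongrightarrow> 1 / a powr s + of_real x * lerch_phi (of_real x) s (a + 1)) (below (of_real x))"
    by (rule Lim_transform_eventually)
       (use eventually_below_slit in eventually_elim, use lerch_slit_shift[OF a] in simp)
qed

section \<open>Hurwitz's formula\<close>

text \<open>
  Let \<open>a\<close> tend to 1 through real values. Then \<open>e(a)\<close> moves on the unit circle, where the series
  converges uniformly.
\<close>

lemma lerch_hurwitz_eq_Re_gt_1:
  assumes s: "Re s > 1" and m: "0 < Re m" "Re m < 1"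
  shows "rGamma s * lerch_cont (1 - s) 1 (expi (- m)) = lerch_dual s 1 m (lerch_series 1 s m) (lerch_series 1 s (1 - m))"
proof -
  define \<delta> where "\<delta> n = inverse (real (Suc (Suc n)))" for n
  define a where "a n = 1 - complex_of_real (\<delta> n)" for n
  have \<delta>: "0 < \<delta> n" "\<delta> n < 1" for n by (auto simp: \<delta>_def field_simps)
  have "\<delta> \<longlonglongrightarrow> 0" unfolding \<delta>_def by (rule LIMSEQ_Suc[OF LIMSEQ_inverse_real_of_nat])
  hence "a \<longlonglongrightarrow> 1 - of_real 0" unfolding a_def by (intro tendsto_intros)
  hence al: "a \<longlonglongrightarrow> 1" by simp
  have aS: "0 < Re (a n)" "Re (a n) < 1" for n using \<delta>[of n] by (auto simp: a_def)
  have ser: "lerch_cont s c w = lerch_series w s c" if "Re c > 0" "w \<in> slit_plane" "norm w = 1" for c w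
    using lerch_series_eq_slit[OF Re_pos_not_nonpos_Ints[OF that(1)], of w s] lerch_slit_eq_cont[OF that(1,2), of s] that s
    by (simp add: series_region_def)
  have nrm: "norm (expi (a n)) = 1" "norm (expi (- a n)) = 1" for n by (simp_all add: norm_expi a_def)
  have lim: "(\<lambda>n. lerch_cont s c (expi (f n))) \<longlonglongrightarrow> lerch_series 1 s c"
    if c: "Re c > 0" and f: "f \<longlonglongrightarrow> f0" "expi f0 = 1" "\<And>n. norm (expi (f n)) = 1" "\<And>n. expi (f n) \<in> slit_plane" for c f f0
  proof -
    have "(\<lambda>n. expi (f n)) \<longlonglongrightarrow> 1" using tendsto_expi[OF f(1)] f(2) by simp
    hence "(\<lambda>n. lerch_series (expi (f n)) s c) \<longlonglongrightarrow> lerch_series 1 s c"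
      by (intro continuous_on_tendsto_compose[OF continuous_on_lerch_series_z[OF s c]]) (use f(3) in auto)
    thus ?thesis using ser[OF c f(4) f(3)] by simp
  qed
  have "(\<lambda>n. lerch_dual s (a n) m (lerch_cont s m (expi (a n))) (lerch_cont s (1 - m) (expi (- a n))))
     \<longlonglongrightarrow> lerch_dual s 1 m (lerch_series 1 s m) (lerch_series 1 s (1 - m))"
  proof (intro tendsto_lerch_dual al tendsto_const)
    show "(\<lambda>n. lerch_cont s m (expi (a n))) \<longlonglongrightarrow> lerch_series 1 s m"
      by (rule lim[OF _ al]) (use m nrm expi_slit aS in auto)
    have "(\<lambda>n. - a n) \<longlonglongrightarrow> -1" using tendsto_minus[OF al] by simp
    thus "(\<lambda>n. lerch_cont s (1 - m) (expi (- a n))) \<longlonglongrightarrow> lerch_series 1 s (1 - m)"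
      by (rule lim[rotated]) (use m nrm expi_minus_slit aS in \<open>auto simp: expi_minus[of 1]\<close>)
  qed
  moreover have "(\<lambda>n. rGamma s * lerch_cont (1 - s) (a n) (expi (- m))) \<longlonglongrightarrow> rGamma s * lerch_cont (1 - s) 1 (expi (- m))"
    by (intro tendsto_mult tendsto_const isCont_tendsto_compose[OF isCont_lerch_cont_a al] expi_minus_slit m) simp
  moreover have "rGamma s * lerch_cont (1 - s) (a n) (expi (- m)) = lerch_dual s (a n) m (lerch_cont s m (expi (a n))) (lerch_cont s (1 - m) (expi (- a n)))" for n
    by (rule lerch_functional_eq[OF aS m])
  ultimately show ?thesis by (auto intro: LIMSEQ_unique)
qed

definition rho :: "complex \<Rightarrow> complex" where "rho s = of_real (1 / (2 * pi)) powr (s - 1)"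

lemma rot_polar:
  obtains \<rho> u where "\<rho> \<noteq> 0" "u \<noteq> 0" "rotm s = \<rho> / u" "rotp s = \<rho> * u" "u * u = - exp (of_real pi * \<i> * s)"
    "\<rho> = rho s" "u = exp (\<i> * of_real pi * (s - 1) / 2)"
proof -
  define \<rho> where "\<rho> = rho s"
  define u where "u = exp (\<i> * of_real pi * (s - 1) / 2)"
  have 1: "rotm s = \<rho> * (- \<i>) powr (s - 1)"
    unfolding rotm_def \<rho>_def rho_def mult.commute[of "- \<i>"] by (rule powr_times_real_left) auto
  have 2: "(- \<i>) powr (s - 1) = inverse u"
  proof -
    have "(- \<i>) powr (s - 1) = exp (- (\<i> * of_real pi * (s - 1) / 2))"
      by (simp add: powr_def field_simps)
    also have "\<dots> = inverse u" unfolding u_def by (rule exp_minus)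
    finally show ?thesis .
  qed
  have 3: "rotp s = \<rho> * \<i> powr (s - 1)"
    unfolding rotp_def \<rho>_def rho_def mult.commute[of "\<i>"] by (rule powr_times_real_left) auto
  have 4: "\<i> powr (s - 1) = u"
    by (simp add: powr_def u_def field_simps)
  have 5: "u * u = - exp (of_real pi * \<i> * s)"
  proof -
    have "\<i> * of_real pi * (s - 1) / 2 + \<i> * of_real pi * (s - 1) / 2 = of_real pi * \<i> * s - of_real pi * \<i>"
      by (simp add: field_simps)
    hence "u * u = exp (of_real pi * \<i> * s - of_real pi * \<i>)"
      unfolding u_def by (simp only: exp_add[symmetric])
    thus ?thesis by (simp add: exp_diff)
  qed
  show ?thesis
  proof (rule that[of \<rho> u])
    show "\<rho> \<noteq> 0" "u \<noteq> 0" by (simp_all add: \<rho>_def rho_def u_def)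
    show "rotm s = \<rho> / u" unfolding 1 2 divide_inverse ..
    show "rotp s = \<rho> * u" unfolding 3 4 ..
  qed (fact 5 \<rho>_def u_def)+
qed

lemma rot_square_diff: "rotm s * rotm s - rotp s * rotp s = 2 * of_real pi * \<i> * (rho s * rho s) * (rGamma s * rGamma (1 - s))"
proof -
  obtain \<rho> u where r: "\<rho> \<noteq> 0" "u \<noteq> 0" "rotm s = \<rho> / u" "rotp s = \<rho> * u" "u * u = - exp (of_real pi * \<i> * s)"
    "\<rho> = rho s" "u = exp (\<i> * of_real pi * (s - 1) / 2)"
    by (rule rot_polar)
  have "sin (of_real pi * s) = (exp (of_real pi * \<i> * s) - inverse (exp (of_real pi * \<i> * s))) / (2 * \<i>)"
    by (simp add: sin_exp_eq exp_minus mult_ac)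
  also have "exp (of_real pi * \<i> * s) = - (u * u)" using r(5) by simp
  finally have "sin (of_real pi * s) = (inverse (u * u) - u * u) / (2 * \<i>)" using r(2) by (simp add: field_simps)
  hence e: "2 * \<i> * sin (of_real pi * s) = inverse (u * u) - u * u" by simp
  have "rotm s * rotm s - rotp s * rotp s = \<rho> * \<rho> * (inverse (u * u) - u * u)"
    unfolding r(3,4) divide_inverse by (simp only: inverse_mult_distrib right_diff_distrib mult_ac)
  hence "rotm s * rotm s - rotp s * rotp s = \<rho> * \<rho> * (2 * \<i> * sin (of_real pi * s))"
    unfolding e .
  thus ?thesis unfolding rGamma_reflection_complex r(6) by simp
qed

text \<open>
  The two equations \<open>lerch_hurwitz_eq_Re_gt_1\<close> for \<open>m\<close> and \<open>1 - m\<close> form a linear system for \<open>\<zeta>(s, m)\<close> and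
  \<open>\<zeta>(s, 1 - m)\<close>. Its determinant is, up to elementary factors, \<open>rGamma s * rGamma (1 - s)\<close>, see
  \<open>rot_square_diff\<close>, and this is the solution.
\<close>

definition hurwitz_formula :: "complex \<Rightarrow> complex \<Rightarrow> complex" where
  "hurwitz_formula s m = Gamma (1 - s) / (rho s * rho s) *
     (rotm s * lerch_cont (1 - s) 1 (expi (- m)) * expi (- m) + rotp s * lerch_cont (1 - s) 1 (expi m) * expi m)"

lemma rho_nonzero [simp]: "rho s \<noteq> 0" by (simp add: rho_def)

lemma hurwitz_formula_eq_series:
  assumes s: "Re s > 1" "1 - s \<notin> \<int>\<^sub>\<le>\<^sub>0" and m: "0 < Re m" "Re m < 1"
  shows "hurwitz_formula s m = lerch_series 1 s m"
proof -
  define Z where "Z = lerch_series 1 s m"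
  define Z' where "Z' = lerch_series 1 s (1 - m)"
  define k where "k = 2 * of_real pi * \<i>"
  have k: "k \<noteq> 0" by (simp add: k_def)
  have e: "expi (-1) = 1" by (simp add: expi_minus)
  have 1: "k * (rGamma s * lerch_cont (1 - s) 1 (expi (- m)) * expi (- m)) = rotm s * Z - rotp s * Z'"
    using lerch_hurwitz_eq_Re_gt_1[OF s(1) m] k
    by (simp add: lerch_dual_def e Z_def Z'_def expi_minus[of m] flip: k_def)
  have 2: "k * (rGamma s * lerch_cont (1 - s) 1 (expi m) * expi m) = rotm s * Z' - rotp s * Z"
    using lerch_hurwitz_eq_Re_gt_1[of s "1 - m"] s m k
    by (simp add: lerch_dual_def e Z_def Z'_def expi_diff expi_minus flip: k_def)
  \<comment> \<open>Combine the two equations so that \<open>Z'\<close> cancels.\<close>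
  define Y where "Y = lerch_cont (1 - s) 1 (expi (- m)) * expi (- m)"
  define Y' where "Y' = lerch_cont (1 - s) 1 (expi m) * expi m"
  have "rGamma s * (k * (rotm s * Y + rotp s * Y')) = rotm s * (k * (rGamma s * Y)) + rotp s * (k * (rGamma s * Y'))"
    by (simp add: algebra_simps)
  also have "\<dots> = rotm s * (rotm s * Z - rotp s * Z') + rotp s * (rotm s * Z' - rotp s * Z)"
    using 1 2 by (simp add: Y_def Y'_def mult.assoc)
  also have "\<dots> = (rotm s * rotm s - rotp s * rotp s) * Z" by (simp add: algebra_simps)
  also have "\<dots> = rGamma s * (k * (rho s * rho s * rGamma (1 - s) * Z))"
    unfolding rot_square_diff k_def by (simp only: mult_ac)
  finally have "rGamma s * (k * (rotm s * Y + rotp s * Y')) = rGamma s * (k * (rho s * rho s * rGamma (1 - s) * Z))" .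
  moreover have "rGamma s \<noteq> 0" using rGamma_Gamma[of s] s by auto
  ultimately have eq: "rotm s * Y + rotp s * Y' = rho s * rho s * rGamma (1 - s) * Z" using k by simp
  have G: "Gamma (1 - s) * rGamma (1 - s) = 1"
    using s(2) by (subst rGamma_inverse_Gamma, intro right_inverse) (auto simp: Gamma_eq_zero_iff)
  have "hurwitz_formula s m = Gamma (1 - s) / (rho s * rho s) * (rotm s * Y + rotp s * Y')"
    by (simp add: hurwitz_formula_def Y_def Y'_def mult.assoc)
  also have "\<dots> = (Gamma (1 - s) * rGamma (1 - s)) * Z" unfolding eq by simp
  finally show ?thesis unfolding G Z_def by simp
qed

section \<open>Continuation of the Hurwitz zeta function\<close>

lemma connected_minus_1: "connected (- {1::complex})"
  by (rule connected_punctured_universe) simp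

lemma holomorphic_lerch_cont_1_minus:
  assumes "Re a > 0" "z \<in> slit_plane" shows "(\<lambda>s. lerch_cont (1 - s) a z) holomorphic_on A"
proof -
  have "(\<lambda>s. lerch_cont (1 - s) a z) holomorphic_on UNIV"
    by (rule holomorphic_lerch_cont) (use assms in \<open>auto intro: holomorphic_intros\<close>)
  thus ?thesis by (rule holomorphic_on_subset) simp
qed

text \<open>
  The complement of the poles 1, 2, 3, ... of \<open>\<Gamma>(1 - s)\<close>.
\<close>

definition hurwitz_domain :: "complex set" where "hurwitz_domain = {s. 1 - s \<notin> \<int>\<^sub>\<le>\<^sub>0}"

lemma open_hurwitz_domain: "open hurwitz_domain"
proof -
  have "closed (\<int>\<^sub>\<le>\<^sub>0 :: complex set)" by (intro closed_subset_Ints nonpos_Ints_subset_Ints)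
  hence "open ((\<lambda>s::complex. 1 - s) -` (- \<int>\<^sub>\<le>\<^sub>0))"
    by (intro open_vimage continuous_intros) auto
  thus ?thesis by (simp add: hurwitz_domain_def vimage_def)
qed

lemma holomorphic_hurwitz_formula:
  assumes m: "0 < Re m" "Re m < 1"
  shows "(\<lambda>s. hurwitz_formula s m) holomorphic_on hurwitz_domain"
  unfolding hurwitz_formula_def rho_def rotm_def rotp_def
  by (intro holomorphic_intros holomorphic_lerch_cont_1_minus expi_slit expi_minus_slit m)
     (auto simp: hurwitz_domain_def)

lemma continuous_on_hurwitz_formula: "continuous_on (open_strip 1) (hurwitz_formula s)"
proof -
  have "isCont (hurwitz_formula s) m" if m: "0 < Re m" "Re m < 1" for m
  proof -
    have "isCont (\<lambda>m. lerch_cont (1 - s) 1 (expi (- m))) m"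
      by (rule isCont_o2[where g = "\<lambda>z. lerch_cont (1 - s) 1 z"])
         (auto intro!: continuous_intros isCont_lerch_cont_z expi_minus_slit m)
    moreover have "isCont (\<lambda>m. lerch_cont (1 - s) 1 (expi m)) m"
      by (rule isCont_o2[where g = "\<lambda>z. lerch_cont (1 - s) 1 z"])
         (auto intro!: continuous_intros isCont_lerch_cont_z expi_slit m)
    ultimately show ?thesis unfolding hurwitz_formula_def by (intro continuous_intros) auto
  qed
  thus ?thesis by (intro continuous_at_imp_continuous_on) auto
qed

lemma minus_1_slit: "-1 \<in> slit_plane" by (simp add: slit_plane_iff)

lemma lerch_series_1_duplication:
  assumes "Re s > 1" "Re a > 0"
  shows "lerch_series 1 s a = 2 / 2 powr s * lerch_series 1 s (a / 2) - lerch_cont s a (-1)"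
proof -
  have "lerch_series (-1) s a = lerch_cont s a (-1)"
    using lerch_series_eq_slit[OF Re_pos_not_nonpos_Ints[OF assms(2)] _ minus_1_slit, of s]
      lerch_slit_eq_cont[OF assms(2) minus_1_slit, of s] assms by (simp add: series_region_def)
  thus ?thesis using lerch_series_duplication[OF assms(2), of 1 s] assms by (simp add: series_region_def algebra_simps)
qed

definition hurwitz_ext :: "complex \<Rightarrow> (complex \<Rightarrow> complex) \<Rightarrow> bool" where
  "hurwitz_ext a F \<longleftrightarrow> F holomorphic_on (- {1}) \<and> (\<forall>s. Re s > 1 \<longrightarrow> F s = lerch_series 1 s a)"

text \<open>
  Hurwitz's formula is singular at the positive integers only, and for \<open>Re s > 1\<close> it agrees with the
  series wherever it is regular. The series thus removes all singularities except \<open>s = 1\<close>.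
\<close>

lemma hurwitz_ext_strip:
  assumes m: "0 < Re m" "Re m < 1"
  defines "F \<equiv> \<lambda>s. if Re s > 1 then lerch_series 1 s m else hurwitz_formula s m"
  shows "hurwitz_ext m F" and "s \<in> hurwitz_domain \<Longrightarrow> F s = hurwitz_formula s m"
proof -
  have eq: "F s = hurwitz_formula s m" if "s \<in> hurwitz_domain" for s
    using hurwitz_formula_eq_series[of s m] that m by (auto simp: F_def hurwitz_domain_def)
  thus "s \<in> hurwitz_domain \<Longrightarrow> F s = hurwitz_formula s m" .
  have "F holomorphic_on hurwitz_domain"
    by (rule holomorphic_transform[OF holomorphic_hurwitz_formula[OF m]]) (simp add: eq)
  moreover have "F holomorphic_on {s. Re s > 1}"
    by (rule holomorphic_transform[OF holomorphic_lerch_series_1[OF m(1)]]) (simp add: F_def)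
  ultimately have "F holomorphic_on (hurwitz_domain \<union> {s. Re s > 1})"
    by (intro holomorphic_on_Un open_hurwitz_domain open_halfspace_Re_gt)
  moreover have "- {1} \<subseteq> hurwitz_domain \<union> {s. Re s > 1}"
  proof
    fix s :: complex assume s: "s \<in> - {1}"
    show "s \<in> hurwitz_domain \<union> {s. Re s > 1}"
    proof (cases "1 - s \<in> \<int>\<^sub>\<le>\<^sub>0")
      case True
      then obtain n where n: "1 - s = of_int n" "n \<le> 0" by (auto elim: nonpos_Ints_cases)
      hence "s = of_int (1 - n)" by (simp add: algebra_simps)
      moreover from this s have "n \<noteq> 0" by auto
      ultimately show ?thesis using n(2) by simp
    qed (simp add: hurwitz_domain_def)
  qed
  ultimately have "F holomorphic_on - {1}" by (rule holomorphic_on_subset)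
  thus "hurwitz_ext m F" by (simp add: hurwitz_ext_def F_def)
qed

text \<open>
  From \<open>\<zeta>(s, a / 2)\<close> with \<open>0 < Re (a / 2) < 1\<close> one obtains \<open>\<zeta>(s, a)\<close> also for \<open>1 \<le> Re a < 2\<close>.
\<close>

lemma hurwitz_ext_double:
  assumes "Re a > 0" "hurwitz_ext (a / 2) F"
  shows "hurwitz_ext a (\<lambda>s. 2 / 2 powr s * F s - lerch_cont s a (-1))"
  using assms lerch_series_1_duplication[of _ a] holomorphic_lerch_cont_s[OF assms(1) minus_1_slit]
  by (auto simp: hurwitz_ext_def intro!: holomorphic_intros)

lemma lerch_series_1_shift:
  "a \<notin> \<int>\<^sub>\<le>\<^sub>0 \<Longrightarrow> Re s > 1 \<Longrightarrow> lerch_series 1 s a = 1 / a powr s + lerch_series 1 s (a + 1)"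
  using lerch_series_shift[of a 1 s] by (simp add: series_region_def)

lemma hurwitz_ext_exists: "a \<notin> \<int>\<^sub>\<le>\<^sub>0 \<Longrightarrow> \<exists>F. hurwitz_ext a F"
proof (induction rule: shift_induct_strip)
  case (strip a)
  have "0 < Re (a / 2)" "Re (a / 2) < 1" using strip by simp_all
  from hurwitz_ext_strip(1)[OF this] show ?case using hurwitz_ext_double[OF strip(1)] by blast
next
  case (down a)
  then obtain F where F: "hurwitz_ext (a + 1) F" by blast
  have a0: "a \<noteq> 0" using down(1) by auto
  have "hurwitz_ext a (\<lambda>s. 1 / a powr s + F s)"
    using F lerch_series_1_shift[OF down(1)] a0 by (auto simp: hurwitz_ext_def intro!: holomorphic_intros)
  thus ?case by blast
next
  case (up a)
  then obtain F where F: "hurwitz_ext a F" by blast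
  have a0: "a \<noteq> 0" using up(1) by auto
  have "hurwitz_ext (a + 1) (\<lambda>s. F s - 1 / a powr s)"
    using F lerch_series_1_shift[OF up(1)] a0 by (auto simp: hurwitz_ext_def intro!: holomorphic_intros)
  thus ?case by blast
qed

lemma hurwitz_ext_lerch_at_1: "a \<notin> \<int>\<^sub>\<le>\<^sub>0 \<Longrightarrow> hurwitz_ext a (lerch_at_1 a)"
  unfolding lerch_at_1_def hurwitz_ext_def[symmetric] by (rule someI_ex[OF hurwitz_ext_exists])

lemma eq_on_minus_1:
  assumes "F holomorphic_on - {1}" "G holomorphic_on - {1}" "\<And>s. Re s > 1 \<Longrightarrow> F s = G s" "s \<noteq> 1"
  shows "F s = (G s :: complex)"
proof (rule analytic_continuation_open[where s = "{s. Re s > 1}" and s' = "- {1}" and f = F and g = G])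
  have "(2::complex) \<in> {s. Re s > 1}" by simp
  thus "{s::complex. Re s > 1} \<noteq> {}" by blast
  show "{s. Re s > 1} \<subseteq> - {1::complex}" by auto
  show "F z = G z" if "z \<in> {s. Re s > 1}" for z using assms(3) that by simp
qed (use assms(1,2,4) connected_minus_1 in \<open>simp_all add: open_halfspace_Re_gt open_Compl\<close>)

lemma lerch_at_1_unique:
  assumes "a \<notin> \<int>\<^sub>\<le>\<^sub>0" "hurwitz_ext a F" "s \<noteq> 1"
  shows "lerch_at_1 a s = F s"
proof (rule eq_on_minus_1[where F = "lerch_at_1 a" and G = F])
  note h = hurwitz_ext_lerch_at_1[OF assms(1), unfolded hurwitz_ext_def] assms(2)[unfolded hurwitz_ext_def]
  show "lerch_at_1 a holomorphic_on - {1}" "F holomorphic_on - {1}" using h by blast+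
  show "lerch_at_1 a s = F s" if "Re s > 1" for s using h that by simp
qed fact

lemma lerch_phi_1:
  assumes "a \<notin> \<int>\<^sub>\<le>\<^sub>0" shows "lerch_phi 1 s a = lerch_at_1 a s"
  using hurwitz_ext_lerch_at_1[OF assms] by (auto simp: lerch_phi_def hurwitz_ext_def)

lemma lerch_phi_shift_1:
  assumes a: "a \<notin> \<int>\<^sub>\<le>\<^sub>0" and s: "s \<noteq> 1"
  shows "lerch_phi 1 s a = 1 / a powr s + lerch_phi 1 s (a + 1)"
proof -
  have a1: "a + 1 \<notin> \<int>\<^sub>\<le>\<^sub>0" by (rule nonpos_Ints_plus_1[OF a])
  have a0: "a \<noteq> 0" using a by auto
  have "hurwitz_ext a (\<lambda>s. 1 / a powr s + lerch_at_1 (a + 1) s)"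
    using hurwitz_ext_lerch_at_1[OF a1] lerch_series_1_shift[OF a] a0 by (auto simp: hurwitz_ext_def intro!: holomorphic_intros)
  from lerch_at_1_unique[OF a this s] show ?thesis by (simp add: lerch_phi_1 a a1)
qed

lemma continuous_on_lerch_phi_1:
  assumes s: "s \<noteq> 1"
  shows "continuous_on (open_strip 2) (\<lambda>m. lerch_phi 1 s m)"
proof (cases "Re s > 1")
  case True
  have "continuous_on (open_strip 2) (\<lambda>m. lerch_series 1 s m)"
    by (rule continuous_on_subset[OF continuous_on_lerch_series_a[OF True]]) auto
  thus ?thesis by (rule continuous_on_eq) (use True in \<open>auto simp: lerch_phi_def\<close>)
next
  case False
  have sd: "s \<in> hurwitz_domain"
  proof (rule ccontr)
    assume "s \<notin> hurwitz_domain"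
    then obtain n where n: "1 - s = of_int n" "n \<le> 0" by (auto simp: hurwitz_domain_def elim: nonpos_Ints_cases)
    hence "s = of_int (1 - n)" by (simp add: algebra_simps)
    thus False using False n s by auto
  qed
  have 1: "continuous_on (open_strip 2) (\<lambda>m. hurwitz_formula s (m / 2))"
    by (rule continuous_on_compose2[OF continuous_on_hurwitz_formula]) (auto intro!: continuous_intros)
  have 2: "continuous_on (open_strip 2) (\<lambda>m. lerch_cont s m (-1))"
    by (rule continuous_on_subset[OF holomorphic_on_imp_continuous_on[OF holomorphic_lerch_cont_a[OF minus_1_slit]]]) auto
  have "continuous_on (open_strip 2) (\<lambda>m. 2 / 2 powr s * hurwitz_formula s (m / 2) - lerch_cont s m (-1))"
    using 1 2 by (auto intro!: continuous_intros)
  thus ?thesis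
  proof (rule continuous_on_eq)
    fix m assume "m \<in> open_strip 2"
    hence m: "0 < Re m" "0 < Re (m / 2)" "Re (m / 2) < 1" by auto
    have an: "m \<notin> \<int>\<^sub>\<le>\<^sub>0" using m(1) by (rule Re_pos_not_nonpos_Ints)
    show "2 / 2 powr s * hurwitz_formula s (m / 2) - lerch_cont s m (-1) = lerch_phi 1 s m"
      using lerch_at_1_unique[OF an hurwitz_ext_double[OF m(1) hurwitz_ext_strip(1)[OF m(2,3)]] s]
        hurwitz_ext_strip(2)[OF m(2,3) sd] by (simp add: lerch_phi_1[OF an])
  qed
qed

lemma lerch_functional_eq_1:
  assumes m: "0 < Re m" "Re m < 1" and s: "s \<noteq> 1"
  shows "rGamma s * lerch_cont (1 - s) 1 (expi (- m)) = lerch_dual s 1 m (lerch_phi 1 s m) (lerch_phi 1 s (1 - m))"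
proof -
  have an: "m \<notin> \<int>\<^sub>\<le>\<^sub>0" "1 - m \<notin> \<int>\<^sub>\<le>\<^sub>0" using m by (auto intro!: Re_pos_not_nonpos_Ints)
  note h = hurwitz_ext_lerch_at_1[OF an(1), unfolded hurwitz_ext_def] hurwitz_ext_lerch_at_1[OF an(2), unfolded hurwitz_ext_def]
  have "rGamma s * lerch_cont (1 - s) 1 (expi (- m)) = lerch_dual s 1 m (lerch_at_1 m s) (lerch_at_1 (1 - m) s)"
  proof (rule eq_on_minus_1[OF _ _ _ s, where F = "\<lambda>s. rGamma s * lerch_cont (1 - s) 1 (expi (- m))"
        and G = "\<lambda>s. lerch_dual s 1 m (lerch_at_1 m s) (lerch_at_1 (1 - m) s)"])
    show "(\<lambda>s. rGamma s * lerch_cont (1 - s) 1 (expi (- m))) holomorphic_on - {1}"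
      by (intro holomorphic_intros holomorphic_lerch_cont_1_minus expi_minus_slit m) auto
    have "lerch_at_1 m holomorphic_on - {1}" "lerch_at_1 (1 - m) holomorphic_on - {1}" using h by auto
    thus "(\<lambda>s. lerch_dual s 1 m (lerch_at_1 m s) (lerch_at_1 (1 - m) s)) holomorphic_on - {1}"
      unfolding lerch_dual_def rotm_def rotp_def by (intro holomorphic_intros) auto
    show "rGamma s * lerch_cont (1 - s) 1 (expi (- m)) = lerch_dual s 1 m (lerch_at_1 m s) (lerch_at_1 (1 - m) s)"
      if "Re s > 1" for s
      using lerch_hurwitz_eq_Re_gt_1[OF that m] h that by simp
  qed
  thus ?thesis by (simp add: lerch_phi_1 an)
qed

section \<open>All values of the first argument together\<close>

lemma slit_cases:
  obtains "w \<in> slit_plane" | "w = 1" | x where "x > 1" "w = complex_of_real x"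
proof (cases "w \<in> slit_plane")
  case False
  then obtain x where "w = complex_of_real x" "x \<ge> 1" by (auto simp: slit_plane_def)
  thus ?thesis using that by (cases "x = 1") auto
qed (use that in auto)

lemma lerch_phi_shift:
  assumes a: "a \<notin> \<int>\<^sub>\<le>\<^sub>0" and w: "w = 1 \<Longrightarrow> s \<noteq> 1"
  shows "lerch_phi w s a = 1 / a powr s + w * lerch_phi w s (a + 1)"
proof (cases w rule: slit_cases)
  case 1
  thus ?thesis using lerch_slit_shift[OF a 1] by (simp add: lerch_phi_slit a nonpos_Ints_plus_1)
next
  case 2
  thus ?thesis using lerch_phi_shift_1[OF a] w by simp
next
  case (3 x)
  thus ?thesis using lerch_phi_shift_cut[OF a] by simp
qed

lemma continuous_on_lerch_phi:
  assumes w: "w = 1 \<Longrightarrow> s \<noteq> 1"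
  shows "continuous_on (open_strip 2) (lerch_phi w s)"
proof (cases w rule: slit_cases)
  case 1
  have "continuous_on (open_strip 2) (\<lambda>m. lerch_cont s m w)"
    by (rule continuous_on_subset[OF holomorphic_on_imp_continuous_on[OF holomorphic_lerch_cont_a[OF 1]]]) auto
  thus ?thesis
    by (rule continuous_on_eq) (use 1 in \<open>auto simp: lerch_phi_slit lerch_slit_eq_cont Re_pos_not_nonpos_Ints\<close>)
next
  case 2
  thus ?thesis using continuous_on_lerch_phi_1 w by simp
next
  case (3 x)
  show ?thesis
    by (rule continuous_on_eq[OF continuous_on_cut_value[OF 3(1)]])
       (use 3 lerch_phi_cut[OF 3(1) tendsto_cut_value[OF 3(1)]] in auto)
qed

text \<open>
  On the line \<open>Re a = 0\<close> the shift formula reduces the claim to \<open>Re a = 1\<close>.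
\<close>

lemma isCont_lerch_phi:
  assumes w: "w = 1 \<Longrightarrow> s \<noteq> 1" and a: "0 \<le> Re a" "Re a < 2" "a \<noteq> 0"
  shows "isCont (lerch_phi w s) a"
proof -
  have op: "open (open_strip 2)"
    using open_Int[OF open_halfspace_Re_gt[of 0] open_halfspace_Re_lt[of 2]] by (simp add: Int_def)
  have c: "isCont (lerch_phi w s) a" if "0 < Re a" "Re a < 2" for a
    using continuous_on_lerch_phi[OF w] that by (simp add: continuous_on_eq_continuous_at op)
  show ?thesis
  proof (cases "Re a = 0")
    case False
    thus ?thesis using c a by simp
  next
    case True
    have an: "a \<notin> \<real>\<^sub>\<le>\<^sub>0" using True a by (auto simp: complex_nonpos_Reals_iff complex_eq_iff)
    have "isCont (\<lambda>a. lerch_phi w s (a + 1)) a"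
      by (rule isCont_o2[where g = "lerch_phi w s"]) (use True in \<open>auto intro!: continuous_intros c\<close>)
    hence "isCont (\<lambda>a. 1 / a powr s + w * lerch_phi w s (a + 1)) a"
      using an a by (intro continuous_intros) auto
    moreover have "\<forall>\<^sub>F a' in nhds a. lerch_phi w s a' = 1 / a' powr s + w * lerch_phi w s (a' + 1)"
    proof -
      have "\<forall>\<^sub>F a' in nhds a. a' \<in> - \<real>\<^sub>\<le>\<^sub>0"
        by (rule eventually_nhds_in_open) (use an in \<open>auto simp: open_Compl closed_nonpos_Reals_complex\<close>)
      thus ?thesis
      proof eventually_elim
        case (elim a')
        hence "a' \<notin> \<int>\<^sub>\<le>\<^sub>0" by (auto elim!: nonpos_Ints_cases simp: complex_nonpos_Reals_iff)
        thus ?case by (rule lerch_phi_shift[OF _ w])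
      qed
    qed
    ultimately show ?thesis by (simp add: isCont_cong)
  qed
qed

lemma tendsto_lerch_slit:
  assumes "a \<notin> \<int>\<^sub>\<le>\<^sub>0" "w \<in> slit_plane" "(f \<longlongrightarrow> w) F"
  shows "((\<lambda>n. lerch_slit s a (f n)) \<longlongrightarrow> lerch_phi w s a) F"
proof -
  have "isCont (lerch_slit s a) w"
    using holomorphic_on_imp_continuous_on[OF holomorphic_lerch_slit[OF assms(1), of s]] assms(2)
    by (simp add: continuous_on_eq_continuous_at open_slit_plane)
  thus ?thesis unfolding lerch_phi_slit[OF assms(1,2)] using assms(3) by (rule isCont_tendsto_compose)
qed

text \<open>
  A positive null sequence below \<open>1 / 2\<close>: \<open>e(- small_shift n)\<close> rotates the positive axis into the lower
  half-plane.
\<close>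

definition small_shift :: "nat \<Rightarrow> complex" where "small_shift n = of_real (inverse (real (Suc (Suc (Suc n)))))"

lemma small_shift_bounds: "0 < Re (small_shift n)" "Re (small_shift n) < 1 / 2" "Im (small_shift n) = 0"
  by (auto simp: small_shift_def field_simps)

lemma small_shift_lim: "small_shift \<longlonglongrightarrow> 0"
proof -
  have "(\<lambda>n. complex_of_real (inverse (real (Suc (Suc (Suc n)))))) \<longlonglongrightarrow> of_real 0"
    by (intro tendsto_of_real LIMSEQ_Suc[OF LIMSEQ_Suc[OF LIMSEQ_inverse_real_of_nat]])
  thus ?thesis by (simp add: small_shift_def[abs_def])
qed

lemma expi_0 [simp]: "expi 0 = 1" by (simp add: expi_def)

text \<open>
  The clockwise rotation matters only for \<open>w\<close> on the cut, which it approaches from below.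
\<close>

lemma tendsto_lerch_rotate:
  assumes a: "a \<notin> \<int>\<^sub>\<le>\<^sub>0" and w: "w \<noteq> 1"
  shows "(\<lambda>n. lerch_slit s a (w * expi (- small_shift n))) \<longlonglongrightarrow> lerch_phi w s a"
proof -
  have lim: "(\<lambda>n. w * expi (- small_shift n)) \<longlonglongrightarrow> w"
    using tendsto_mult[OF tendsto_const[of w] tendsto_expi[OF tendsto_minus[OF small_shift_lim]]] by simp
  show ?thesis
  proof (cases w rule: slit_cases)
    case 1
    thus ?thesis using tendsto_lerch_slit[OF a _ lim] by simp
  next
    case (3 x)
    have im: "Im (w * expi (- small_shift n)) < 0" for n
    proof -
      have "Im (w * expi (- small_shift n)) = - (x * sin (2 * pi * Re (small_shift n)))"
        using small_shift_bounds[of n] by (simp add: 3(2) expi_def Im_exp)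
      moreover have "sin (2 * pi * Re (small_shift n)) > 0"
        using small_shift_bounds[of n] by (intro sin_gt_zero) auto
      ultimately show ?thesis using 3(1) by simp
    qed
    have ne: "w * expi (- small_shift n) \<noteq> of_real x" for n
    proof
      assume "w * expi (- small_shift n) = of_real x"
      thus False using im[of n] by simp
    qed
    have "filterlim (\<lambda>n. w * expi (- small_shift n)) (below (of_real x)) sequentially"
      unfolding filterlim_at using lim im ne 3(2) by simp
    thus ?thesis unfolding 3(2) by (rule filterlim_compose[OF tendsto_lerch_phi_cut[OF a 3(1)]])
  qed (use w in simp)
qed

section \<open>The functional equation for all admissible parameters\<close>

definition lerch_equation :: "complex \<Rightarrow> complex \<Rightarrow> complex \<Rightarrow> bool" where
  "lerch_equation s a m \<longleftrightarrow> rGamma s * lerch_phi (expi (- m)) (1 - s) a =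
     lerch_dual s a m (lerch_phi (expi a) s m) (lerch_phi (expi (- a)) s (1 - m))"

lemma expi_neq_1: "Im a \<noteq> 0 \<Longrightarrow> expi a \<noteq> 1"
proof
  assume "Im a \<noteq> 0" "expi a = 1"
  hence "exp (- 2 * pi * Im a) = 1" using norm_expi[of a] by simp
  thus False using \<open>Im a \<noteq> 0\<close> by simp
qed

lemma expi_slit_upper: "Im a > 0 \<Longrightarrow> expi a \<in> slit_plane"
  by (rule norm_less_1_slit) (simp add: norm_expi)

lemma lerch_equation_interior:
  assumes a: "0 < Re a" "Re a < 1" and m: "0 < Re m" "Re m < 1"
  shows "lerch_equation s a m"
proof -
  have "a \<notin> \<int>\<^sub>\<le>\<^sub>0" "m \<notin> \<int>\<^sub>\<le>\<^sub>0" "1 - m \<notin> \<int>\<^sub>\<le>\<^sub>0" using a m by (auto intro!: Re_pos_not_nonpos_Ints)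
  moreover have "expi a \<in> slit_plane" "expi (- a) \<in> slit_plane" "expi (- m) \<in> slit_plane"
    using a m by (auto intro!: expi_slit expi_minus_slit)
  ultimately show ?thesis
    using lerch_functional_eq[OF a m, of s] a m unfolding lerch_equation_def by (simp add: lerch_phi_slit lerch_slit_eq_cont)
qed

text \<open>
  Move \<open>a\<close> horizontally into the strip. On the line \<open>Re a = 1\<close> the point \<open>e(a)\<close> lies on the cut, on the
  line \<open>Re a = 0\<close> the point \<open>e(-a)\<close> does; in either case the movement rotates it clockwise.
\<close>

lemma lerch_equation_boundary_a:
  assumes a: "Re a = 1 \<and> Im a < 0 \<or> Re a = 0 \<and> Im a > 0" and m: "0 < Re m" "Re m < 1"
  shows "lerch_equation s a m"
proof -
  define b where "b n = (if Re a = 1 then a - small_shift n else a + small_shift n)" for n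
  have b: "0 < Re (b n)" "Re (b n) < 1" for n using a small_shift_bounds[of n] by (auto simp: b_def)
  have bl: "b \<longlonglongrightarrow> a"
  proof (cases "Re a = 1")
    case True
    thus ?thesis using tendsto_diff[OF tendsto_const[of a] small_shift_lim] by (simp add: b_def[abs_def])
  next
    case False
    thus ?thesis using tendsto_add[OF tendsto_const[of a] small_shift_lim] by (simp add: b_def[abs_def])
  qed
  have mn: "m \<notin> \<int>\<^sub>\<le>\<^sub>0" "1 - m \<notin> \<int>\<^sub>\<le>\<^sub>0" using m by (auto intro!: Re_pos_not_nonpos_Ints)
  have one: "expi a \<noteq> 1" "expi (- a) \<noteq> 1" using a by (auto intro!: expi_neq_1)
  have bs: "expi (b n) \<in> slit_plane" "expi (- b n) \<in> slit_plane" for n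
    using b by (auto intro!: expi_slit expi_minus_slit)
  have P: "(\<lambda>n. lerch_phi (expi (b n)) s m) \<longlonglongrightarrow> lerch_phi (expi a) s m"
    unfolding lerch_phi_slit[OF mn(1) bs(1)]
  proof (cases "Re a = 1")
    case True
    have "expi (b n) = expi a * expi (- small_shift n)" for n using True by (simp add: b_def expi_add[symmetric])
    thus "(\<lambda>n. lerch_slit s m (expi (b n))) \<longlonglongrightarrow> lerch_phi (expi a) s m"
      using tendsto_lerch_rotate[OF mn(1) one(1), of s] by simp
  next
    case False
    thus "(\<lambda>n. lerch_slit s m (expi (b n))) \<longlonglongrightarrow> lerch_phi (expi a) s m"
      using a by (intro tendsto_lerch_slit mn tendsto_expi bl expi_slit_upper) auto
  qed
  have Q: "(\<lambda>n. lerch_phi (expi (- b n)) s (1 - m)) \<longlonglongrightarrow> lerch_phi (expi (- a)) s (1 - m)"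
    unfolding lerch_phi_slit[OF mn(2) bs(2)]
  proof (cases "Re a = 1")
    case True
    thus "(\<lambda>n. lerch_slit s (1 - m) (expi (- b n))) \<longlonglongrightarrow> lerch_phi (expi (- a)) s (1 - m)"
      using a by (intro tendsto_lerch_slit mn tendsto_expi tendsto_minus bl expi_slit_upper) auto
  next
    case False
    have "expi (- b n) = expi (- a) * expi (- small_shift n)" for n using False by (simp add: b_def expi_add[symmetric])
    thus "(\<lambda>n. lerch_slit s (1 - m) (expi (- b n))) \<longlonglongrightarrow> lerch_phi (expi (- a)) s (1 - m)"
      using tendsto_lerch_rotate[OF mn(2) one(2), of s] by simp
  qed
  have "expi (- m) \<noteq> 1" using expi_minus_slit[OF m] by (auto simp: slit_plane_iff)
  hence "isCont (lerch_phi (expi (- m)) (1 - s)) a" using a by (intro isCont_lerch_phi) auto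
  hence "(\<lambda>n. rGamma s * lerch_phi (expi (- m)) (1 - s) (b n)) \<longlonglongrightarrow> rGamma s * lerch_phi (expi (- m)) (1 - s) a"
    by (intro tendsto_mult tendsto_const isCont_tendsto_compose[OF _ bl])
  moreover have "(\<lambda>n. lerch_dual s (b n) m (lerch_phi (expi (b n)) s m) (lerch_phi (expi (- b n)) s (1 - m)))
      \<longlonglongrightarrow> lerch_dual s a m (lerch_phi (expi a) s m) (lerch_phi (expi (- a)) s (1 - m))"
    by (intro tendsto_lerch_dual bl tendsto_const P Q)
  moreover have "rGamma s * lerch_phi (expi (- m)) (1 - s) (b n) =
      lerch_dual s (b n) m (lerch_phi (expi (b n)) s m) (lerch_phi (expi (- b n)) s (1 - m))" for n
    using lerch_equation_interior[OF b m] unfolding lerch_equation_def .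
  ultimately show ?thesis unfolding lerch_equation_def by (auto intro: LIMSEQ_unique)
qed

text \<open>
  The conditions on \<open>t\<close>, written for \<open>a = 1 - t / (2 \<pi>)\<close>. On each of the two boundary lines only one half is
  included, the one where moving into the strip leaves the cut downwards.
\<close>

definition a_region :: "complex \<Rightarrow> bool" where
  "a_region a \<longleftrightarrow> (0 < Re a \<and> Re a < 1) \<or> (Re a = 1 \<and> Im a \<le> 0) \<or> (Re a = 0 \<and> Im a > 0)"

lemma lerch_equation_strip:
  assumes a: "a_region a" "a = 1 \<Longrightarrow> s \<noteq> 1" and m: "0 < Re m" "Re m < 1"
  shows "lerch_equation s a m"
proof (cases "a = 1")
  case True
  have "lerch_phi (expi (- m)) (1 - s) 1 = lerch_cont (1 - s) 1 (expi (- m))"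
    using lerch_phi_slit[OF _ expi_minus_slit[OF m], of 1] lerch_slit_eq_cont[OF _ expi_minus_slit[OF m], of 1]
    by (simp add: Re_pos_not_nonpos_Ints)
  thus ?thesis using lerch_functional_eq_1[OF m a(2)[OF True]] unfolding lerch_equation_def True by (simp add: expi_minus)
next
  case False
  hence "\<not> (Re a = 1 \<and> Im a = 0)" by (auto simp: complex_eq_iff)
  hence "(0 < Re a \<and> Re a < 1) \<or> (Re a = 1 \<and> Im a < 0 \<or> Re a = 0 \<and> Im a > 0)"
    using a(1) unfolding a_region_def by linarith
  thus ?thesis using lerch_equation_interior[of a m s] lerch_equation_boundary_a[of a m s] m by blast
qed

lemma a_region_not_nonpos: "a_region a \<Longrightarrow> a \<notin> \<int>\<^sub>\<le>\<^sub>0"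
  by (auto simp: a_region_def elim!: nonpos_Ints_cases)

lemma a_region_expi_eq_1: "a_region a \<Longrightarrow> expi a = 1 \<or> expi (- a) = 1 \<Longrightarrow> a = 1"
proof (rule ccontr)
  assume a: "a_region a" "expi a = 1 \<or> expi (- a) = 1" "a \<noteq> 1"
  show False
  proof (cases "Im a = 0")
    case True
    hence "0 < Re a" "Re a < 1" using a(1,3) by (auto simp: a_region_def complex_eq_iff)
    hence "expi a \<in> slit_plane" "expi (- a) \<in> slit_plane" by (auto intro!: expi_slit expi_minus_slit)
    thus False using a(2) by (auto simp: slit_plane_iff)
  qed (use a expi_neq_1[of a] expi_neq_1[of "- a"] in auto)
qed

text \<open>
  Move \<open>m\<close> to the right into the strip. This rotates \<open>e(-m)\<close> clockwise, so that for \<open>Im m > 0\<close>, where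
  this point is on the cut, the boundary value on the left side is the one from below.
\<close>

lemma lerch_equation_imaginary:
  assumes a: "a_region a" "a = 1 \<Longrightarrow> s \<noteq> 1" and m: "Re m = 0" "m \<noteq> 0"
  shows "lerch_equation s a m"
proof -
  define c where "c n = m + small_shift n" for n
  have c: "0 < Re (c n)" "Re (c n) < 1" for n using m small_shift_bounds[of n] by (auto simp: c_def)
  have cl: "c \<longlonglongrightarrow> m"
    using tendsto_add[OF tendsto_const[of m] small_shift_lim] by (simp add: c_def[abs_def])
  have an: "a \<notin> \<int>\<^sub>\<le>\<^sub>0" by (rule a_region_not_nonpos[OF a(1)])
  have Im: "Im m \<noteq> 0" using m by (auto simp: complex_eq_iff)
  have w: "expi a = 1 \<Longrightarrow> s \<noteq> 1" "expi (- a) = 1 \<Longrightarrow> s \<noteq> 1"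
    using a_region_expi_eq_1[OF a(1)] a(2) by auto
  have P: "(\<lambda>n. lerch_phi (expi a) s (c n)) \<longlonglongrightarrow> lerch_phi (expi a) s m"
    by (rule isCont_tendsto_compose[OF isCont_lerch_phi[OF w(1)] cl]) (use m in auto)
  have Q: "(\<lambda>n. lerch_phi (expi (- a)) s (1 - c n)) \<longlonglongrightarrow> lerch_phi (expi (- a)) s (1 - m)"
  proof (rule isCont_tendsto_compose[OF isCont_lerch_phi[OF w(2)]])
    show "(\<lambda>n. 1 - c n) \<longlonglongrightarrow> 1 - m" by (intro tendsto_intros cl)
  qed (use m in auto)
  have "lerch_phi (expi (- c n)) (1 - s) a = lerch_slit (1 - s) a (expi (- m) * expi (- small_shift n))" for n
    using lerch_phi_slit[OF an expi_minus_slit[OF c], of n "1 - s"] by (simp add: c_def expi_add[symmetric])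
  hence "(\<lambda>n. lerch_phi (expi (- c n)) (1 - s) a) \<longlonglongrightarrow> lerch_phi (expi (- m)) (1 - s) a"
    using tendsto_lerch_rotate[OF an, of "expi (- m)" "1 - s"] expi_neq_1[of "- m"] Im by simp
  hence "(\<lambda>n. rGamma s * lerch_phi (expi (- c n)) (1 - s) a) \<longlonglongrightarrow> rGamma s * lerch_phi (expi (- m)) (1 - s) a"
    by (intro tendsto_mult tendsto_const)
  moreover have "(\<lambda>n. lerch_dual s a (c n) (lerch_phi (expi a) s (c n)) (lerch_phi (expi (- a)) s (1 - c n)))
      \<longlonglongrightarrow> lerch_dual s a m (lerch_phi (expi a) s m) (lerch_phi (expi (- a)) s (1 - m))"
    by (intro tendsto_lerch_dual cl tendsto_const P Q)
  moreover have "rGamma s * lerch_phi (expi (- c n)) (1 - s) a =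
      lerch_dual s a (c n) (lerch_phi (expi a) s (c n)) (lerch_phi (expi (- a)) s (1 - c n))" for n
    using lerch_equation_strip[OF a c] unfolding lerch_equation_def .
  ultimately show ?thesis unfolding lerch_equation_def by (auto intro: LIMSEQ_unique)
qed

text \<open>
  This is \<open>(- m) powr s = exp (\<pi> \<i> s) * m powr s\<close>. For \<open>Im m \<le> 0\<close> the argument of \<open>- m\<close> exceeds that of \<open>m\<close> by
  \<open>\<pi>\<close>; above the real axis it is smaller by \<open>\<pi>\<close>, which makes no difference for integers \<open>s\<close>.
\<close>

lemma rot_powr_cancel:
  assumes m: "m \<noteq> 0" "Re m \<ge> 0" and c: "Im m \<le> 0 \<and> (Re m = 0 \<longrightarrow> Im m < 0) \<or> s \<in> \<nat>"
  shows "rotm s / m powr s + rotp s / (- m) powr s = 0"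
proof -
  obtain \<rho> u where r: "\<rho> \<noteq> 0" "u \<noteq> 0" "rotm s = \<rho> / u" "rotp s = \<rho> * u" "u * u = - exp (of_real pi * \<i> * s)"
    "\<rho> = rho s" "u = exp (\<i> * of_real pi * (s - 1) / 2)"
    by (rule rot_polar)
  have key: "(- m) powr s = exp (of_real pi * \<i> * s) * m powr s"
  proof (cases "s \<in> \<nat>")
    case True
    then obtain n where n: "s = of_nat n" by (auto elim: Nats_cases)
    have "exp (of_real pi * \<i> * s) = exp (of_nat n * (\<i> * of_real pi))"
      by (simp only: n mult_ac)
    also have "\<dots> = exp (\<i> * of_real pi) ^ n" by (rule exp_of_nat_mult)
    finally have "exp (of_real pi * \<i> * s) = (-1) ^ n" by simp
    moreover have "(- m) powr s = (- m) ^ n" "m powr s = m ^ n" using m by (simp_all add: n powr_nat)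
    ultimately show ?thesis by (simp add: power_minus[of m])
  next
    case False
    hence im: "Im m \<le> 0" "Re m = 0 \<Longrightarrow> Im m < 0" using c by auto
    have "Ln (- m) = Ln m + \<i> * of_real pi"
      using m im by (subst Ln_minus) auto
    thus ?thesis using m by (simp add: powr_def ring_distribs exp_add mult_ac)
  qed
  have "m powr s \<noteq> 0" "exp (of_real pi * \<i> * s) \<noteq> 0" using m by auto
  hence "rotm s / m powr s + rotp s / (- m) powr s = (rotm s * exp (of_real pi * \<i> * s) + rotp s) / (exp (of_real pi * \<i> * s) * m powr s)"
    unfolding key by (simp add: divide_simps)
  also have "exp (of_real pi * \<i> * s) = - (u * u)" using r(5) by simp
  also have "rotm s * - (u * u) + rotp s = 0" unfolding r(3,4) using r(2) by simp
  finally show ?thesis by simp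
qed

text \<open>
  The left side has period 1 in \<open>m\<close>. On the right, the shift formula splits off one term from each
  of the two Lerch functions, and these two terms cancel.
\<close>

lemma lerch_equation_shift:
  assumes a: "a_region a" "a = 1 \<Longrightarrow> s \<noteq> 1" and m: "m \<notin> \<int>" "Re m \<ge> 0" "Im m \<le> 0 \<or> s \<in> \<nat>"
    and fe: "lerch_equation s a m"
  shows "lerch_equation s a (m + 1)"
proof -
  have w: "expi a = 1 \<Longrightarrow> s \<noteq> 1" "expi (- a) = 1 \<Longrightarrow> s \<noteq> 1"
    using a_region_expi_eq_1[OF a(1)] a(2) by auto
  have mn: "m \<notin> \<int>\<^sub>\<le>\<^sub>0" using m(1) nonpos_Ints_subset_Ints by blast
  have mn': "- m \<notin> \<int>\<^sub>\<le>\<^sub>0" using m(1) nonpos_Ints_subset_Ints minus_in_Ints_iff by blast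
  have m0: "m \<noteq> 0" using m(1) by auto
  have "rotm s / m powr s + rotp s / (- m) powr s = 0"
    by (rule rot_powr_cancel) (use m m0 in \<open>auto simp: complex_eq_iff less_le\<close>)
  hence c: "rotp s * (1 / (- m) powr s) = - (rotm s * (1 / m powr s))" by (simp add: add_eq_0_iff)
  define P where "P = lerch_phi (expi a) s (m + 1)"
  define Q where "Q = lerch_phi (expi (- a)) s (1 - m)"
  have 1: "lerch_phi (expi a) s m = 1 / m powr s + expi a * P"
    unfolding P_def by (rule lerch_phi_shift[OF mn w(1)])
  have 2: "lerch_phi (expi (- a)) s (1 - (m + 1)) = 1 / (- m) powr s + expi (- a) * Q"
    using lerch_phi_shift[OF mn' w(2)] unfolding Q_def by simp
  have "lerch_dual s a (m + 1) P (1 / (- m) powr s + expi (- a) * Q) = lerch_dual s a m (1 / m powr s + expi a * P) Q"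
  proof -
    have "lerch_dual s a (m + 1) P (1 / (- m) powr s + expi (- a) * Q) = expi (a * m) / (2 * of_real pi * \<i>) *
        (expi a * (rotm s * P) - (expi a * expi (- a)) * (rotp s * (1 / (- m) powr s) + expi (- a) * (rotp s * Q)))"
      by (simp add: lerch_dual_def ring_distribs expi_add mult_ac)
    also have "expi a * expi (- a) = 1" by (simp add: expi_minus)
    finally show ?thesis unfolding c by (simp add: lerch_dual_def ring_distribs mult_ac)
  qed
  moreover have "expi (- (m + 1)) = expi (- m)" by (simp only: expi_minus expi_add expi_1 mult_1_right)
  ultimately show ?thesis using fe unfolding lerch_equation_def 1 2 P_def[symmetric] Q_def[symmetric] by simp
qed

lemma lerch_equation_general:
  assumes a: "a_region a" "a = 1 \<Longrightarrow> s \<noteq> 1" and m: "m \<notin> \<int>" "Re m \<ge> 0" "Re m < 1 \<or> Im m \<le> 0 \<or> s \<in> \<nat>"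
  shows "lerch_equation s a m"
proof -
  have base: "lerch_equation s a m" if "m \<notin> \<int>" "Re m \<ge> 0" "Re m < 1" for m
  proof (cases "Re m = 0")
    case True
    from that(1) have "m \<noteq> 0" by auto
    thus ?thesis by (intro lerch_equation_imaginary a True)
  next
    case False
    thus ?thesis using that by (intro lerch_equation_strip a) auto
  qed
  show ?thesis
  proof (cases "Re m < 1")
    case False
    hence im: "Im m \<le> 0 \<or> s \<in> \<nat>" using m by auto
    have "lerch_equation s a m" if "m \<notin> \<int>" "Re m \<ge> 0" "Re m < real (Suc n)" "Im m \<le> 0 \<or> s \<in> \<nat>" for n m
      using that
    proof (induction n arbitrary: m)
      case 0
      thus ?case using base by simp
    next
      case (Suc n)
      show ?case
      proof (cases "Re m < 1")
        case False
        have mi: "m - 1 \<notin> \<int>" using Suc.prems(1) by (metis Ints_1 Ints_add diff_add_cancel)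
        have "lerch_equation s a (m - 1)" by (rule Suc.IH) (use mi Suc.prems False in auto)
        from lerch_equation_shift[OF a mi _ _ this] show ?thesis using Suc.prems False by simp
      qed (use base Suc.prems in auto)
    qed
    moreover obtain n :: nat where "Re m < real n" using reals_Archimedean2 by blast
    hence "Re m < real (Suc n)" by simp
    ultimately show ?thesis using m im by blast
  qed (use base m in auto)
qed

theorem mainTheorem1:
  fixes k t m :: complex
  assumes "Re m \<ge> 0"
    and "m \<notin> \<int>\<^sub>\<le>\<^sub>0" and "1 - m \<notin> \<int>\<^sub>\<le>\<^sub>0"
    and "1 + k \<notin> \<int>\<^sub>\<le>\<^sub>0"
    and "t = 0 \<Longrightarrow> k \<noteq> 0"
    and "(0 < Re t \<and> Re t < 2 * pi) \<or> (Re t = 0 \<and> Im t \<ge> 0) \<or> (Re t = 2 * pi \<and> Im t < 0)"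
    and "Re m < 1 \<or> Im m \<le> 0 \<or> k \<in> \<nat>"
  shows "lerch_phi (exp (- 2 * \<i> * m * of_real pi)) (- k) (1 - t / (2 * of_real pi)) =
    \<i> * (-1) powr k * exp (- (1 / 2) * \<i> * (3 * k * of_real pi + 2 * m * (- 2 * of_real pi + t)))
      * (2 * of_real pi) powr (- 1 - k) * Gamma (1 + k)
      * (- lerch_phi (exp (- \<i> * t)) (1 + k) m
         + (-1) powr k * exp (\<i> * t) * lerch_phi (exp (\<i> * t)) (1 + k) (1 - m))"
proof -
  define a where "a = 1 - t / (2 * of_real pi)"
  define s where "s = 1 + k"
  have s_minus: "1 - s = - k" by (simp add: s_def)
  have ap: "2 * of_real pi * a = 2 * of_real pi - t" by (simp add: a_def field_simps)
  have ReIm: "Re a = 1 - Re t / (2 * pi)" "Im a = - Im t / (2 * pi)"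
  proof -
    have "a = 1 - t / of_real (2 * pi)" by (simp add: a_def)
    thus "Re a = 1 - Re t / (2 * pi)" "Im a = - Im t / (2 * pi)"
      by (simp_all only: minus_complex.simps one_complex.simps Re_divide_of_real Im_divide_of_real diff_0 minus_divide_left)
  qed
  have reg: "a_region a"
    using assms(6) unfolding a_region_def ReIm by (auto simp: field_simps)
  have a1: "a = 1 \<Longrightarrow> s \<noteq> 1" using assms(5) by (auto simp: a_def s_def)
  have mi: "m \<notin> \<int>"
  proof
    assume "m \<in> \<int>"
    then obtain n where n: "m = of_int n" by (auto elim: Ints_cases)
    show False
    proof (cases "n \<le> 0")
      case False
      hence "1 - m = of_int (1 - n)" "1 - n \<le> 0" by (auto simp: n)
      thus False using assms(3) by (metis nonpos_Ints_of_int)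
    next
      case True
      thus False using n assms(2) by (metis nonpos_Ints_of_int)
    qed
  qed
  have sk: "k \<in> \<nat> \<Longrightarrow> s \<in> \<nat>" by (simp add: s_def)
  have fe: "lerch_equation s a m"
    by (rule lerch_equation_general[OF reg a1 mi]) (use assms(1,7) sk in auto)
  have z: "exp (- 2 * \<i> * m * of_real pi) = expi (- m)" by (simp add: expi_def mult_ac)
  have ea: "2 * of_real pi * \<i> * a = 2 * of_real pi * \<i> - \<i> * t"
  proof -
    have "2 * of_real pi * \<i> * a = \<i> * (2 * of_real pi * a)" by (simp only: mult_ac)
    thus ?thesis unfolding ap by (simp add: algebra_simps)
  qed
  have w: "expi a = exp (- \<i> * t)" "expi (- a) = exp (\<i> * t)"
    unfolding expi_def using ea by (simp_all add: exp_diff exp_minus inverse_eq_divide)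
  have G: "rGamma s * Gamma s = 1"
    using assms(4) by (subst rGamma_inverse_Gamma, intro left_inverse) (auto simp: Gamma_eq_zero_iff s_def)
  define P where "P = lerch_phi (exp (- \<i> * t)) s m"
  define Q where "Q = lerch_phi (exp (\<i> * t)) s (1 - m)"
  have "Gamma s * (rGamma s * lerch_phi (expi (- m)) (1 - s) a) = Gamma s * lerch_dual s a m P Q"
    using fe unfolding lerch_equation_def w P_def Q_def by simp
  also have "Gamma s * (rGamma s * lerch_phi (expi (- m)) (1 - s) a) = (rGamma s * Gamma s) * lerch_phi (expi (- m)) (1 - s) a"
    by (simp only: mult_ac)
  finally have main: "lerch_phi (expi (- m)) (- k) a = Gamma s * lerch_dual s a m P Q"
    unfolding G mult_1_left s_minus .
  define p where "p = complex_of_real (ln (2 * pi))"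
  define E where "E = exp (\<i> * of_real pi * k / 2)"
  have E0: "E \<noteq> 0" by (simp add: E_def)
  have m1k: "(-1) powr k = E * E"
    by (simp add: powr_def E_def mult_ac flip: exp_add)
  have two_pi: "exp p = 2 * of_real pi" by (simp add: p_def exp_of_real)
  have c1: "(2 * of_real pi) powr (- 1 - k) = exp (- (k * p)) / (2 * of_real pi)"
  proof -
    have "(2 * of_real pi) powr (- 1 - k) = exp ((- 1 - k) * p)"
      using Ln_of_real[of "2 * pi"] by (simp add: powr_def p_def)
    also have "(- 1 - k) * p = - (k * p) - p" by (simp add: algebra_simps)
    finally show ?thesis by (simp add: exp_diff two_pi)
  qed
  obtain \<rho> u where r: "\<rho> \<noteq> 0" "u \<noteq> 0" "rotm s = \<rho> / u" "rotp s = \<rho> * u" "u * u = - exp (of_real pi * \<i> * s)"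
    "\<rho> = rho s" "u = exp (\<i> * of_real pi * (s - 1) / 2)"
    by (rule rot_polar)
  have u: "u = E" by (simp add: r(7) E_def s_def)
  have \<rho>: "\<rho> = exp (- (k * p))"
  proof -
    have "complex_of_real (1 / (2 * pi)) \<noteq> 0" by simp
    hence "\<rho> = exp ((s - 1) * Ln (complex_of_real (1 / (2 * pi))))" unfolding r(6) rho_def by (simp only: powr_def if_False)
    also have "Ln (complex_of_real (1 / (2 * pi))) = of_real (ln (1 / (2 * pi)))" by (rule Ln_of_real) simp
    also have "ln (1 / (2 * pi)) = - ln (2 * pi)" by (simp add: ln_div)
    also have "(s - 1) * complex_of_real (- ln (2 * pi)) = - (k * p)" by (simp only: s_def p_def) simp
    finally show ?thesis .
  qed
  have c2: "exp (- (1 / 2) * \<i> * (3 * k * of_real pi + 2 * m * (- 2 * of_real pi + t))) = expi (a * m) / (E * E * E)"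
  proof -
    have "- (1 / 2) * \<i> * (3 * k * of_real pi + 2 * m * (- 2 * of_real pi + t))
        = (2 * of_real pi * \<i> * a) * m - (\<i> * of_real pi * k / 2 + \<i> * of_real pi * k / 2 + \<i> * of_real pi * k / 2)"
      unfolding ea by (simp add: field_simps)
    thus ?thesis by (simp only: exp_diff exp_add E_def expi_def mult.assoc)
  qed
  have "lerch_dual s a m P Q = \<rho> / (2 * of_real pi) * expi (a * m) * \<i> * (- (P / E) + exp (\<i> * t) * E * Q)"
  proof -
    have inv: "inverse (2 * of_real pi * \<i>) = - (\<i> * inverse (2 * complex_of_real pi))" by simp
    have "X * - (\<i> * c) * (r * e * P - T * (r * E * Q)) = r * c * X * \<i> * (- (P * e) + T * E * Q)"
      for X c r e T by (simp add: algebra_simps)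
    thus ?thesis unfolding lerch_dual_def r(3,4) u w(2) divide_inverse inv .
  qed
  also have "\<dots> = \<i> * (-1) powr k * exp (- (1 / 2) * \<i> * (3 * k * of_real pi + 2 * m * (- 2 * of_real pi + t)))
      * (2 * of_real pi) powr (- 1 - k) * (- P + (-1) powr k * exp (\<i> * t) * Q)"
  proof -
    have "r * X * \<i> * (- (p / E) + T * E * q) = \<i> * (E * E) * (X / (E * E * E)) * r * (- p + E * E * T * q)" for r X p q T
    proof -
      define D where "D = X / (E * E * E)"
      define p' where "p' = p / E"
      have "X = D * (E * E * E)" "p = p' * E" using E0 by (simp_all add: D_def p'_def)
      thus ?thesis unfolding D_def[symmetric] p'_def[symmetric] by (simp add: algebra_simps)
    qed
    thus ?thesis unfolding m1k c1 c2 \<rho> by (simp only: times_divide_eq_right times_divide_eq_left)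
  qed
  finally have dual: "lerch_dual s a m P Q = \<i> * (-1) powr k * exp (- (1 / 2) * \<i> * (3 * k * of_real pi + 2 * m * (- 2 * of_real pi + t)))
      * (2 * of_real pi) powr (- 1 - k) * (- P + (-1) powr k * exp (\<i> * t) * Q)" .
  show ?thesis
    unfolding z a_def[symmetric] s_def[symmetric] P_def[symmetric] Q_def[symmetric] main dual by (simp only: mult_ac)
qed

end
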